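(* Let $k\geq 2$ be an integer, and let $\mu_k^2(n)\in\{0,1\}$ be the indicator that $n$ is $k$-free. Let $g:\mathbb{N}\to\{-1,1\}$ be a completely multiplicative function that is $\chi$-pretentious for some real and non-principal Dirichlet character $\chi$, and further assume that for some constant $c>0$ $$\sum_{p\leq x}|1-g(p)\chi(p)|\ll \frac{x^{1/k}}{\exp(c\sqrt{\log x})},$$ where the sum is over primes $p\le x$. Let $f=\mu_k^2\, g$ (pointwise product), a multiplicative function supported on the $k$-free integers. Then there exists a constant $\lambda>0$ such that $$\sum_{n\leq x}f(n)\ll \frac{x^{1/k}}{\exp(\lambda(\log x)^{1/4})}.$$
   Context: $\mathbb{N}$ is the set of positive integers. For an integer $k\ge 2$, an integer $n$ is $k$-free if it is not divisible by $p^k$ for any prime $p$. A function $f:\mathbb{N}\to\mathbb{C}$ is multiplicative if $f(nm)=f(n)f(m)$ whenever $\gcd(n,m)=1$, and completely multiplicative if this holds for all $n,m$. A real Dirichlet character is one with values in $\{-1,0,1\}$. For multiplicative functions $g_1,g_2$ with $|g_1|,|g_2|\le 1$, let $\mathbb{D}(g_1,g_2)=\left(\sum_{p}\frac{1-\mathrm{Re}(g_1(p)\overline{g_2(p)})}{p}\right)^{1/2}\in[0,\infty]$, the sum being over all primes; $g_1$ is called $g_2$-pretentious if $\mathbb{D}(g_1,g_2)<\infty$. The notation $F(x)\ll G(x)$ means that there is a constant $C>0$ such that $|F(x)|\leq C|G(x)|$ for all sufficiently large real $x>0$. *)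

theory Defs
  imports
    "HOL-Analysis.Analysis"
    "HOL-Computational_Algebra.Primes"
    "HOL-Library.Landau_Symbols"
begin

text \<open>
  Arithmetic functions on the positive integers are rendered as functions of type
  \<^typ>\<open>nat \<Rightarrow> complex\<close>; their value at \<open>0\<close> carries no meaning, so all conditions and
  sums below are restricted to positive arguments. The exception is a Dirichlet character,
  which is defined at \<open>0\<close> as well.
\<close>

definition multiplicative :: "(nat \<Rightarrow> complex) \<Rightarrow> bool" where
  "multiplicative f \<longleftrightarrow>
     (\<forall>m n. m > 0 \<longrightarrow> n > 0 \<longrightarrow> coprime m n \<longrightarrow> f (m * n) = f m * f n)"

definition completely_multiplicative :: "(nat \<Rightarrow> complex) \<Rightarrow> bool" where
  "completely_multiplicative f \<longleftrightarrow> (\<forall>m n. m > 0 \<longrightarrow> n > 0 \<longrightarrow> f (m * n) = f m * f n)"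

definition kfree :: "nat \<Rightarrow> nat \<Rightarrow> bool" where
  "kfree k n \<longleftrightarrow> (\<forall>p. prime p \<longrightarrow> \<not> p ^ k dvd n)"

definition mu_sq :: "nat \<Rightarrow> nat \<Rightarrow> complex" where
  "mu_sq k n = (if kfree k n then 1 else 0)"

definition dirichlet_character :: "nat \<Rightarrow> (nat \<Rightarrow> complex) \<Rightarrow> bool" where
  "dirichlet_character q chi \<longleftrightarrow> q > 0 \<and>
     (\<forall>m n. chi (m * n) = chi m * chi n) \<and>
     (\<forall>n. chi (n + q) = chi n) \<and>
     (\<forall>n. chi n \<noteq> 0 \<longleftrightarrow> coprime n q)"

definition principal_character :: "nat \<Rightarrow> nat \<Rightarrow> complex" where
  "principal_character q n = (if coprime n q then 1 else 0)"

definition real_character :: "(nat \<Rightarrow> complex) \<Rightarrow> bool" where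
  "real_character chi \<longleftrightarrow> (\<forall>n. chi n \<in> {-1, 0, 1})"

text \<open>
  For functions bounded by \<open>1\<close> in absolute value the terms of the sum are nonnegative, so
  it diverges to \<open>\<infinity>\<close> exactly when it is not summable.
\<close>

definition pretentious_dist :: "(nat \<Rightarrow> complex) \<Rightarrow> (nat \<Rightarrow> complex) \<Rightarrow> ennreal" where
  "pretentious_dist g h =
     (let t = (\<lambda>p. (1 - Re (g p * cnj (h p))) / real p)
      in if t summable_on {p. prime p} then ennreal (sqrt (\<Sum>\<^sub>\<infinity>p | prime p. t p)) else \<infinity>)"

definition pretentious :: "(nat \<Rightarrow> complex) \<Rightarrow> (nat \<Rightarrow> complex) \<Rightarrow> bool" where
  "pretentious g h \<longleftrightarrow> pretentious_dist g h < \<infinity>"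

lemma kfree_mult_coprime:
  assumes "coprime m n"
  shows "kfree k (m * n) \<longleftrightarrow> kfree k m \<and> kfree k n"
proof -
  have "p ^ k dvd m * n \<longleftrightarrow> p ^ k dvd m \<or> p ^ k dvd n" if p: "prime p" for p
  proof
    assume d: "p ^ k dvd m * n"
    have "\<not> p dvd m \<or> \<not> p dvd n"
      using assms p by (meson coprime_common_divisor not_prime_unit)
    then have "coprime (p ^ k) m \<or> coprime (p ^ k) n"
      using p by (auto simp: prime_imp_coprime coprime_power_left_iff)
    with d show "p ^ k dvd m \<or> p ^ k dvd n"
      by (auto simp: coprime_dvd_mult_left_iff coprime_dvd_mult_right_iff)
  qed auto
  then show ?thesis
    unfolding kfree_def by blast
qed

lemma multiplicative_mu_sq_mult:
  assumes "completely_multiplicative g"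
  shows "multiplicative (\<lambda>n. mu_sq k n * g n)"
  using assms
  by (auto simp: multiplicative_def completely_multiplicative_def mu_sq_def kfree_mult_coprime)

end

theory Submission
  imports Defs
    "HOL-Complex_Analysis.Complex_Analysis"
    "HOL-Computational_Algebra.Squarefree"
    "HOL-Number_Theory.Cong"
    "HOL-Number_Theory.Prime_Powers"
    "HOL-Real_Asymp.Real_Asymp"
begin

text \<open>
  Write \<open>g = h * \<chi>\<close> as a Dirichlet convolution. Then \<open>h\<close> is bounded by the divisor function and
  lives on integers all of whose primes satisfy \<open>g(p) \<noteq> \<chi>(p)\<close>. By hypothesis these primes are so
  sparse that \<open>\<Sum> |h(n)| n^(-1/k) exp(\<tau> sqrt(log n))\<close> converges, so the boundedness of the partial
  sums of \<open>\<chi>\<close> gives \<open>\<Sum>_(n \<le> y) g(n) \<lless> y^(1/k) exp(-\<tau> sqrt(log y))\<close>. Since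
  \<open>f(n) = \<Sum>_(d^k | n) \<mu>(d) g(d)^k g(n/d^k)\<close>, the hyperbola method, split at
  \<open>n/d^k = exp(\<eta> sqrt(log x))\<close>, reduces the theorem to
  \<open>\<Sum>_(d \<le> z) \<mu>(d) g(d)^k \<lless> z exp(-c sqrt(log z))\<close>; the choice of the split is what turns the
  square root into a fourth root. For even \<open>k\<close> this is the prime number theorem, for odd \<open>k\<close> it
  follows in the same way as before from its analogue for \<open>\<mu>\<chi>\<close>.

  Both prime number theorems come from the classical zero-free region of \<open>L(s, \<chi>)\<close>. The only
  information on logarithmic derivatives that it needs is one-sided and follows from Schwarz' lemma
  once the zeros in a disc have been divided out by Blaschke factors. In that region \<open>1/L\<close> grows
  at most like a small power of \<open>|t|\<close>, which suffices for Newman's contour argument: on rectangles of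
  height \<open>exp(\<eta> sqrt(log N))\<close> it bounds the tail of \<open>\<Sum> \<mu>(n)\<chi>(n)/n\<close> by
  \<open>exp(-c sqrt(log N))\<close>, without Perron's formula.
\<close>

subsection \<open>Logarithmic derivatives of bounded holomorphic functions\<close>

text \<open>The split point is forced by two opposing costs. For \<open>d\<close> below the cut, the
  partial sums of g run up to \<open>x / d ^ k\<close>, which may be as small as \<open>Y\<close>,
  so they save only exp(-\<tau> sqrt(log Y)). Beyond the cut the values of g are bounded trivially,
  and this costs a factor \<open>Y\<close> against the saving exp(-c sqrt(log x)) of the Moebius
  sum. Hence log Y can be at most a small multiple of sqrt(log x), and sqrt(log Y) then has the
  order of the fourth root of log x. The character is fixed, so every constant may depend on it. A
  real zero of L(s, \<chi>) very close to 1 is therefore excluded by L(1, \<chi>) \<noteq> 0 and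
  continuity alone. Newman's argument is run on \<Sum> \<mu>(n)\<chi>(n)/n because it evaluates a
  Dirichlet series on the edge of its half-plane of absolute convergence. The sums of
  \<mu>(n)\<chi>(n) are recovered by partial summation, in which the limit of the series
  cancels.\<close>

lemma Borel_Caratheodory:
  assumes hol: "f holomorphic_on ball 0 r" and r: "r > 0" and f0: "f 0 = 0" and A: "A > 0"
    and Re: "\<And>z. z \<in> ball 0 r \<Longrightarrow> Re (f z) < A"
  shows "cmod (deriv f 0) \<le> 2 * A / r"
    and "\<And>z. z \<in> ball 0 r \<Longrightarrow> cmod (f z) \<le> 2 * A * cmod z / (r - cmod z)"
proof -
  define F where "F = (\<lambda>z. f (of_real r * z))"
  define w where "w = (\<lambda>z. F z / (2 * of_real A - F z))"
  have im: "(\<lambda>z. complex_of_real r * z) ` ball 0 1 \<subseteq> ball 0 r"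
    using r by (auto simp: norm_mult)
  have holF: "F holomorphic_on ball 0 1"
    unfolding F_def
    using holomorphic_on_compose_gen[OF _ hol im] by (auto simp: o_def intro!: holomorphic_intros)
  have ReF: "Re (F z) < A" if "z \<in> ball 0 1" for z
    using Re[of "of_real r * z"] r that by (auto simp: F_def norm_mult)
  have ne: "2 * of_real A - F z \<noteq> 0" if "z \<in> ball 0 1" for z
  proof
    assume "2 * of_real A - F z = 0"
    hence "Re (F z) = 2 * A" by (simp add: complex_eq_iff)
    thus False using ReF[OF that] A by simp
  qed
  have holw: "w holomorphic_on ball 0 1"
    unfolding w_def by (intro holomorphic_intros holF) (use ne in auto)
  have F0: "F 0 = 0" by (simp add: F_def f0)
  have w0: "w 0 = 0" by (simp add: w_def F0)
  have wlt: "cmod (w z) < 1" if "cmod z < 1" for z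
  proof -
    have z: "z \<in> ball 0 1" using that by simp
    have "(cmod (F z))\<^sup>2 < (cmod (2 * of_real A - F z))\<^sup>2"
    proof -
      have "A * Re (F z) < A * A" using ReF[OF z] A by simp
      thus ?thesis
        unfolding cmod_power2 by (simp add: power2_eq_square algebra_simps)
    qed
    hence "cmod (F z) < cmod (2 * of_real A - F z)"
      using power2_less_imp_less norm_ge_zero by blast
    thus ?thesis by (simp add: w_def norm_divide divide_less_eq_1)
  qed
  have dF: "(F has_field_derivative (deriv F 0)) (at 0)"
    using holomorphic_derivI[OF holF, of 0] by simp
  have df: "(f has_field_derivative (deriv f 0)) (at 0)"
    using holomorphic_derivI[OF hol, of 0] r by simp
  have "(F has_field_derivative (deriv f 0 * of_real r)) (at 0)"
    unfolding F_def using df by (auto intro!: derivative_eq_intros DERIV_chain'[where f="\<lambda>z. of_real r * z"])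
  hence dF': "deriv F 0 = deriv f 0 * of_real r" by (rule DERIV_imp_deriv)
  have "(w has_field_derivative (deriv F 0 / (2 * of_real A))) (at 0)"
    unfolding w_def by (rule derivative_eq_intros refl dF)+ (use A in \<open>auto simp: F0 field_simps\<close>)
  hence "deriv w 0 = deriv f 0 * of_real r / (2 * of_real A)"
    unfolding dF' by (rule DERIV_imp_deriv)
  moreover have "cmod (deriv w 0) \<le> 1"
    using Schwarz_Lemma(2)[OF holw w0 wlt, of 0] by simp
  ultimately have "cmod (deriv f 0) * r / (2 * A) \<le> 1"
    using A r by (simp add: norm_mult norm_divide)
  thus "cmod (deriv f 0) \<le> 2 * A / r"
    using A r by (simp add: field_simps)
  fix z :: complex assume z: "z \<in> ball 0 r"
  define u where "u = z / of_real r"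
  have u: "cmod u < 1" using z r by (simp add: u_def norm_divide field_simps)
  have Fu: "F u = f z" using r by (simp add: F_def u_def)
  have wu: "cmod (w u) \<le> cmod u"
    using Schwarz_Lemma(1)[OF holw w0 wlt u] .
  have "f z * (1 + w u) = 2 * of_real A * w u"
    using ne[of u] u by (simp add: w_def Fu field_simps)
  hence "cmod (f z) * cmod (1 + w u) = 2 * A * cmod (w u)"
    using A by (metis abs_of_pos norm_mult norm_numeral norm_of_real)
  moreover have "cmod (1 + w u) \<ge> 1 - cmod u"
    using wu norm_triangle_ineq2[of 1 "- w u"] by simp
  ultimately have "cmod (f z) * (1 - cmod u) \<le> 2 * A * cmod u"
    using wu A by (smt (verit) mult_left_mono norm_ge_zero)
  hence "cmod (f z) * (1 - cmod u) * r \<le> 2 * A * cmod u * r"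
    using r by (intro mult_right_mono) auto
  hence "cmod (f z) * (r - cmod u * r) \<le> 2 * A * (cmod u * r)"
    by (simp add: algebra_simps)
  moreover have "cmod u * r = cmod z" using r by (simp add: u_def norm_divide)
  ultimately have "cmod (f z) * (r - cmod z) \<le> 2 * A * cmod z" by metis
  thus "cmod (f z) \<le> 2 * A * cmod z / (r - cmod z)"
    using z by (simp add: pos_le_divide_eq)
qed

text \<open>Without zeros in the disc, log f exists, and an upper bound for |f| is a one-sided bound
  for its real part. Borel-Caratheodory turns this into a bound for log f itself, hence for its
  derivative at the centre and for |f| from below.\<close>

lemma nonvanishing_log:
  assumes hol: "f holomorphic_on ball s r" and r: "r > 0"
    and nz: "\<And>z. z \<in> ball s r \<Longrightarrow> f z \<noteq> 0"
    and K: "\<And>z. z \<in> ball s r \<Longrightarrow> cmod (f z) < K"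
  shows "cmod (deriv f s / f s) \<le> 2 * ln (K / cmod (f s)) / r"
    and "\<And>z. z \<in> ball s r \<Longrightarrow>
      cmod (f z) \<ge> cmod (f s) * exp (- (2 * ln (K / cmod (f s)) * cmod (z - s) / (r - cmod (z - s))))"
proof -
  obtain g where g: "g holomorphic_on ball s r" "\<And>z. z \<in> ball s r \<Longrightarrow> f z = exp (g z)"
    using contractible_imp_holomorphic_log[OF hol] convex_imp_contractible[OF convex_ball] nz
    by blast
  define F where "F = (\<lambda>z. g (s + z) - g s)"
  define A where "A = ln (K / cmod (f s))"
  have s: "s \<in> ball s r" using r by simp
  have K0: "K > 0" using K[OF s] by (meson norm_ge_zero order_le_less_trans)
  have A: "A > 0"
    unfolding A_def using K[OF s] nz[OF s] K0 by (intro ln_gt_zero) (simp add: field_simps)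
  have im: "(\<lambda>z. s + z) ` ball 0 r \<subseteq> ball s r" by (auto simp: dist_norm)
  have holF: "F holomorphic_on ball 0 r"
  proof -
    have "(\<lambda>z. s + z) holomorphic_on ball 0 r" by (intro holomorphic_on_add holomorphic_on_const holomorphic_on_ident)
    from holomorphic_on_compose_gen[OF this g(1) im] show ?thesis
      unfolding F_def o_def by (intro holomorphic_on_diff holomorphic_on_const)
  qed
  have Reg: "Re (g z) = ln (cmod (f z))" if "z \<in> ball s r" for z
    using g(2)[OF that] by simp
  have ReF: "Re (F z) < A" if "z \<in> ball 0 r" for z
  proof -
    have z: "s + z \<in> ball s r" using that by (auto simp: dist_norm)
    have "ln (cmod (f (s+z))) < ln K" using K[OF z] nz[OF z] K0 by simp
    thus ?thesis using nz[OF s] K0 by (simp add: F_def A_def Reg[OF z] Reg[OF s] ln_div)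
  qed
  have F0: "F 0 = 0" by (simp add: F_def)
  note BC = Borel_Caratheodory[OF holF r F0 A ReF]
  have dg: "(g has_field_derivative (deriv g s)) (at s)"
    using holomorphic_derivI[OF g(1), of s] s by simp
  have "((\<lambda>z. exp (g z)) has_field_derivative (exp (g s) * deriv g s)) (at s)"
    by (rule derivative_eq_intros refl dg)+
  hence "(f has_field_derivative (exp (g s) * deriv g s)) (at s)"
    by (rule has_field_derivative_transform_within_open[OF _ open_ball s]) (use g(2) in auto)
  hence "deriv f s = f s * deriv g s" using g(2)[OF s] by (simp add: DERIV_imp_deriv)
  moreover have "(F has_field_derivative (deriv g s)) (at 0)"
    unfolding F_def using dg
    by (auto intro!: derivative_eq_intros DERIV_chain'[where f="\<lambda>z. s + z" and g=g and x=0, THEN DERIV_cong])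
  ultimately show "cmod (deriv f s / f s) \<le> 2 * ln (K / cmod (f s)) / r"
    using BC(1) nz[OF s] by (simp add: DERIV_imp_deriv A_def)
  fix z assume z: "z \<in> ball s r"
  have "z - s \<in> ball 0 r" using z by (auto simp: dist_norm norm_minus_commute)
  from BC(2)[OF _ this] have "cmod (g z - g s) \<le> 2 * A * cmod (z - s) / (r - cmod (z - s))"
    by (simp add: F_def)
  hence "Re (g z) \<ge> Re (g s) - 2 * A * cmod (z - s) / (r - cmod (z - s))"
    using abs_Re_le_cmod[of "g z - g s"] by (simp; linarith)
  hence "exp (Re (g z)) \<ge> exp (Re (g s)) * exp (- (2 * A * cmod (z - s) / (r - cmod (z - s))))"
    by (simp flip: exp_add)
  thus "cmod (f z) \<ge> cmod (f s) * exp (- (2 * ln (K / cmod (f s)) * cmod (z - s) / (r - cmod (z - s))))"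
    using g(2)[OF z] g(2)[OF s] by (simp add: A_def)
qed

text \<open>Removing the zero \<open>s + \<rho>\<close> by a Blaschke factor of the disc. If the zero lies in the
  closed left half of the disc, this only increases \<open>- Re (f' s / f s)\<close>.\<close>

lemma Blaschke_remove_zero:
  assumes hol: "f holomorphic_on S" and S: "open S" "cball s r \<subseteq> S" and r: "r > 0"
    and K: "\<And>z. z \<in> cball s r \<Longrightarrow> cmod (f z) \<le> K"
    and zero: "f (s + \<rho>) = 0" and \<rho>: "cmod \<rho> < r" and fs: "f s \<noteq> 0"
  obtains h where "h holomorphic_on S" "\<And>z. z \<in> cball s r \<Longrightarrow> cmod (h z) \<le> K"
    "cmod (f s) * r = cmod (h s) * cmod \<rho>"
    "\<And>z. z \<in> cball s r \<Longrightarrow> h z = 0 \<Longrightarrow> f z = 0"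
    "- Re (deriv f s / f s) = - Re (deriv h s / h s) + Re \<rho> * (1 / (cmod \<rho>)\<^sup>2 - 1 / r\<^sup>2)"
proof -
  define g where "g = (\<lambda>z. if z = s + \<rho> then deriv f (s + \<rho>) else (f z - f (s + \<rho>)) / (z - (s + \<rho>)))"
  have sr: "s + \<rho> \<in> cball s r" using \<rho> by (simp add: dist_norm)
  have sS: "s \<in> S" using S r by auto
  have hg: "g holomorphic_on S"
    unfolding g_def by (rule pole_lemma[OF hol]) (use sr S in \<open>auto simp: interior_open\<close>)
  have fg: "f z = (z - (s + \<rho>)) * g z" for z
    using zero by (auto simp: g_def)
  have \<rho>0: "\<rho> \<noteq> 0" using zero fs by auto
  \<comment> \<open>\<open>(z - (s + \<rho>)) / q z\<close> is the Blaschke factor of the disc. It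
    has modulus 1 on the circle, so dividing \<open>f\<close> by it preserves the bound
    \<open>K\<close> there and, by the maximum principle, inside.\<close>
  define q where "q = (\<lambda>z. (of_real (r\<^sup>2) - cnj \<rho> * (z - s)) / of_real r)"
  define h where "h = (\<lambda>z. g z * q z)"
  have hh: "h holomorphic_on S"
    unfolding h_def q_def by (intro holomorphic_intros hg) (use r in auto)
  have qmod: "cmod (q z) = cmod (z - (s + \<rho>))" if "cmod (z - s) = r" for z
  proof -
    define u where "u = z - s"
    have u: "u * cnj u = of_real (r\<^sup>2)"
      unfolding u_def complex_norm_square[symmetric] using that by simp
    have "of_real (r\<^sup>2) - cnj \<rho> * u = u * cnj (u - \<rho>)"
      using u by (simp add: algebra_simps)
    hence "cmod (of_real (r\<^sup>2) - cnj \<rho> * u) = r * cmod (u - \<rho>)"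
      using that by (simp only: norm_mult complex_mod_cnj) (simp add: u_def)
    thus ?thesis using r by (simp add: q_def u_def norm_divide diff_diff_eq)
  qed
  have qnz: "q z \<noteq> 0" if "z \<in> cball s r" for z
  proof
    assume "q z = 0"
    hence "of_real (r\<^sup>2) = cnj \<rho> * (z - s)" using r by (simp add: q_def)
    hence "cmod (of_real (r\<^sup>2)) = cmod \<rho> * cmod (z - s)" by (metis complex_mod_cnj norm_mult)
    hence "r\<^sup>2 = cmod \<rho> * cmod (z - s)" by (simp add: norm_power)
    also have "\<dots> \<le> cmod \<rho> * r" using that by (intro mult_left_mono) (auto simp: dist_norm norm_minus_commute)
    also have "\<dots> < r * r" using \<rho> r by simp
    finally show False by (simp add: power2_eq_square)
  qed
  have bd: "cmod (h z) \<le> K" if "z \<in> cball s r" for z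
  proof (rule maximum_modulus_frontier[of h "cball s r"])
    show "h holomorphic_on interior (cball s r)"
      by (rule holomorphic_on_subset[OF hh]) (use S interior_subset in blast)
    show "continuous_on (closure (cball s r)) h"
      using continuous_on_subset[OF holomorphic_on_imp_continuous_on[OF hh]] S by simp
    fix w assume "w \<in> frontier (cball s r)"
    hence w: "cmod (w - s) = r" using r by (simp add: dist_norm norm_minus_commute)
    have "cmod (h w) = cmod (f w)"
      by (simp add: h_def fg norm_mult qmod[OF w])
    also have "\<dots> \<le> K" using w by (intro K) (simp add: dist_norm norm_minus_commute)
    finally show "cmod (h w) \<le> K" .
  qed (use that in auto)
  have gs: "f s = - \<rho> * g s" using fg[of s] by simp
  have hs: "h s = of_real r * g s" using r by (simp add: h_def q_def power2_eq_square)
  have gs0: "g s \<noteq> 0" using gs fs by auto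
  have dg: "(g has_field_derivative deriv g s) (at s)"
    using holomorphic_derivI[OF hg S(1) sS] .
  have "(f has_field_derivative (g s - \<rho> * deriv g s)) (at s)"
  proof -
    have "((\<lambda>z. (z - (s + \<rho>)) * g z) has_field_derivative (g s - \<rho> * deriv g s)) (at s)"
      by (rule derivative_eq_intros refl dg)+ (simp add: algebra_simps)
    moreover have "(\<lambda>z. (z - (s + \<rho>)) * g z) = f" using fg by auto
    ultimately show ?thesis by simp
  qed
  hence df: "deriv f s / f s = deriv g s / g s - 1 / \<rho>"
    using gs gs0 \<rho>0 by (simp add: DERIV_imp_deriv field_simps)
  have "(h has_field_derivative (deriv g s * of_real r + g s * (- cnj \<rho> / of_real r))) (at s)"
  proof -
    have dq: "(q has_field_derivative (- cnj \<rho> / of_real r)) (at s)"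
      unfolding q_def using r by (auto intro!: derivative_eq_intros)
    show ?thesis
      unfolding h_def
      by (rule derivative_eq_intros refl dg dq)+ (use r in \<open>simp add: q_def power2_eq_square\<close>)
  qed
  hence "deriv h s = deriv g s * of_real r + g s * (- cnj \<rho> / of_real r)"
    by (rule DERIV_imp_deriv)
  hence dh: "deriv h s / h s = deriv g s / g s - cnj \<rho> / of_real (r\<^sup>2)"
    using hs gs0 r by (simp add: field_simps power2_eq_square)
  have "Re (1 / \<rho>) = Re \<rho> / (cmod \<rho>)\<^sup>2" by (simp add: Re_divide cmod_power2)
  moreover have "Re (cnj \<rho> / of_real (r\<^sup>2)) = Re \<rho> / r\<^sup>2"
    unfolding Re_divide_of_real by simp
  ultimately have main: "- Re (deriv f s / f s) = - Re (deriv h s / h s) + Re \<rho> * (1 / (cmod \<rho>)\<^sup>2 - 1 / r\<^sup>2)"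
    by (simp add: df dh algebra_simps)
  show thesis
  proof (rule that[of h])
    show "cmod (f s) * r = cmod (h s) * cmod \<rho>"
      using r by (simp add: gs hs norm_mult)
    show "h z = 0 \<Longrightarrow> f z = 0" if "z \<in> cball s r" for z
      using qnz[OF that] by (auto simp: h_def fg)
  qed (use hh bd main in auto)
qed

text \<open>The zeros within \<open>r / 2\<close> of \<open>s\<close> are divided out one by one.
  None lies to the right of \<open>s\<close>, so each step can only increase -Re(f'/f) at
  \<open>s\<close>, and the bound on the disc is kept. Once the disc of radius \<open>r / 2\<close>
  is free of zeros, \<open>nonvanishing_log\<close> gives the factor 2 / (r/2) = 4/r.\<close>

lemma neg_Re_log_deriv_le:
  assumes hol: "f holomorphic_on S" and S: "open S" "cball s r \<subseteq> S" and r: "r > 0"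
    and K: "\<And>z. z \<in> cball s r \<Longrightarrow> cmod (f z) < K"
    and zeros: "\<And>z. z \<in> cball s r \<Longrightarrow> f z = 0 \<Longrightarrow> Re z \<le> Re s" and fs: "f s \<noteq> 0"
  shows "- Re (deriv f s / f s) \<le> 4 * ln (K / cmod (f s)) / r"
proof -
  \<comment> \<open>The maximum principle preserves only weak inequalities, while
    \<open>nonvanishing_log\<close> asks for a strict one. Compactness provides a gap
    \<open>K' < K\<close> that survives all removals.\<close>
  have cont: "\<exists>K'<K. \<forall>z\<in>cball s r. cmod (f z) \<le> K'" if K: "\<And>z. z \<in> cball s r \<Longrightarrow> cmod (f z) < K"
  proof -
    have "continuous_on (cball s r) (\<lambda>z. cmod (f z))"
      using continuous_on_subset[OF holomorphic_on_imp_continuous_on[OF hol] S(2)]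
      by (intro continuous_intros) auto
    then obtain w where "w \<in> cball s r" "\<forall>z\<in>cball s r. cmod (f z) \<le> cmod (f w)"
      using continuous_attains_sup[of "cball s r" "\<lambda>z. cmod (f z)"] r by auto
    thus ?thesis using K by blast
  qed
  then obtain K' where K': "K' < K" "\<And>z. z \<in> cball s r \<Longrightarrow> cmod (f z) \<le> K'" using K by blast
  have K0: "0 < K" using K[of s] r by (smt (verit) centre_in_cball norm_ge_zero)
  \<comment> \<open>\<open>n\<close> limits the number of removals: a zero at distance at most
    \<open>r / 2\<close> leaves a quotient at least twice as large at \<open>s\<close>, and at
    \<open>n = 0\<close> the premise contradicts the bound \<open>K'\<close>.\<close>
  have "cmod (f s) * 2 ^ n > K \<Longrightarrow> - Re (deriv f s / f s) \<le> 4 * ln (K / cmod (f s)) / r"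
    if "f holomorphic_on S" "\<And>z. z \<in> cball s r \<Longrightarrow> cmod (f z) \<le> K'"
      "\<And>z. z \<in> cball s r \<Longrightarrow> f z = 0 \<Longrightarrow> Re z \<le> Re s" "f s \<noteq> 0" for n f
    using that
  proof (induction n arbitrary: f)
    case 0
    hence "cmod (f s) \<le> K'" using r by simp
    thus ?case using K'(1) 0(1) by simp
  next
    case (Suc n)
    note f = Suc.prems(2-)
    show ?case
    proof (cases "\<exists>z\<in>cball s (r/2). f z = 0")
      case False
      have sub: "ball s (r/2) \<subseteq> cball s r" using r by auto
      have "cmod (deriv f s / f s) \<le> 2 * ln (K / cmod (f s)) / (r/2)"
      proof (rule nonvanishing_log)
        show "f holomorphic_on ball s (r/2)"
          by (rule holomorphic_on_subset[OF f(1)]) (use sub S in auto)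
        show "cmod (f z) < K" if "z \<in> ball s (r/2)" for z
          using f(2)[of z] sub that K'(1) by fastforce
      qed (use False r in auto)
      thus ?thesis using abs_Re_le_cmod[of "deriv f s / f s"] by (simp add: field_simps)
    next
      case True
      then obtain z where z: "z \<in> cball s (r/2)" "f z = 0" by blast
      define \<rho> where "\<rho> = z - s"
      have z': "z = s + \<rho>" by (simp add: \<rho>_def)
      have \<rho>: "cmod \<rho> \<le> r/2" using z by (simp add: \<rho>_def dist_norm norm_minus_commute)
      have \<rho>0: "\<rho> \<noteq> 0" using z f by (auto simp: \<rho>_def)
      have Re\<rho>: "Re \<rho> \<le> 0"
        using f(3)[of z] z r by (auto simp: \<rho>_def)
      obtain h where h: "h holomorphic_on S" "\<And>z. z \<in> cball s r \<Longrightarrow> cmod (h z) \<le> K'"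
        "cmod (f s) * r = cmod (h s) * cmod \<rho>"
        "\<And>z. z \<in> cball s r \<Longrightarrow> h z = 0 \<Longrightarrow> f z = 0"
        "- Re (deriv f s / f s) = - Re (deriv h s / h s) + Re \<rho> * (1 / (cmod \<rho>)\<^sup>2 - 1 / r\<^sup>2)"
        by (rule Blaschke_remove_zero[of f S s r K' \<rho>]) (use f S r \<rho> z z' in auto)
      have hs0: "h s \<noteq> 0" using h(3) f r by auto
      have "cmod (f s) * r \<le> cmod (h s) * (r/2)" unfolding h(3) using \<rho> by (intro mult_left_mono) auto
      hence le2: "2 * cmod (f s) \<le> cmod (h s)" using r by (simp add: field_simps)
      hence le: "cmod (f s) \<le> cmod (h s)" using norm_ge_zero[of "f s"] by linarith
      have "K < cmod (h s) * 2 ^ n"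
      proof -
        have "K < 2 * cmod (f s) * 2 ^ n" using Suc.prems(1) by simp
        also have "\<dots> \<le> cmod (h s) * 2 ^ n" using le2 by (intro mult_right_mono) auto
        finally show ?thesis .
      qed
      hence "- Re (deriv h s / h s) \<le> 4 * ln (K / cmod (h s)) / r"
        by (rule Suc.IH) (use h f hs0 in auto)
      also have "\<dots> \<le> 4 * ln (K / cmod (f s)) / r"
        using le hs0 f(4) r K0
        by (intro divide_right_mono mult_left_mono) (auto intro!: divide_left_mono)
      finally have 1: "- Re (deriv h s / h s) \<le> 4 * ln (K / cmod (f s)) / r" .
      have "(cmod \<rho>)\<^sup>2 \<le> r\<^sup>2" using \<rho> r by (intro power_mono) auto
      hence "1 / (cmod \<rho>)\<^sup>2 - 1 / r\<^sup>2 \<ge> 0" using \<rho>0 r by (simp add: frac_le)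
      hence "Re \<rho> * (1 / (cmod \<rho>)\<^sup>2 - 1 / r\<^sup>2) \<le> 0" using Re\<rho> by (simp add: mult_nonpos_nonneg)
      with h(5) 1 show ?thesis by linarith
    qed
  qed
  moreover obtain n where "K / cmod (f s) < 2 ^ n"
    using real_arch_pow[of 2 "K / cmod (f s)"] by auto
  hence "cmod (f s) * 2 ^ n > K" using fs by (simp add: field_simps)
  ultimately show ?thesis using hol K'(2) zeros fs by blast
qed

text \<open>The zero \<open>s - \<delta>\<close> is taken out first, so that its contribution
  -1/\<delta> is kept, and the previous estimate is applied to the quotient. In the zero-free region
  this term is played off against the pole of zeta.\<close>

lemma neg_Re_log_deriv_le_zero:
  assumes hol: "f holomorphic_on S" and S: "open S" "cball s r \<subseteq> S" and r: "r > 0"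
    and K: "\<And>z. z \<in> cball s r \<Longrightarrow> cmod (f z) < K"
    and zeros: "\<And>z. z \<in> cball s r \<Longrightarrow> f z = 0 \<Longrightarrow> Re z \<le> Re s" and fs: "f s \<noteq> 0"
    and zero: "f (s - of_real \<delta>) = 0" and \<delta>: "0 < \<delta>" "\<delta> < r"
  shows "- Re (deriv f s / f s) \<le> 4 * ln (K / cmod (f s)) / r - 1 / \<delta> + \<delta> / r\<^sup>2"
proof -
  have "continuous_on (cball s r) (\<lambda>z. cmod (f z))"
    using continuous_on_subset[OF holomorphic_on_imp_continuous_on[OF hol] S(2)]
    by (intro continuous_intros) auto
  then obtain w where w: "w \<in> cball s r" "\<forall>z\<in>cball s r. cmod (f z) \<le> cmod (f w)"
    using continuous_attains_sup[of "cball s r" "\<lambda>z. cmod (f z)"] r by auto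
  define K' where "K' = cmod (f w)"
  have K': "K' < K" "\<And>z. z \<in> cball s r \<Longrightarrow> cmod (f z) \<le> K'" using w K by (auto simp: K'_def)
  have K0: "0 < K" using K'(1) by (smt (verit) K'_def norm_ge_zero)
  obtain h where h: "h holomorphic_on S" "\<And>z. z \<in> cball s r \<Longrightarrow> cmod (h z) \<le> K'"
    "cmod (f s) * r = cmod (h s) * cmod (- of_real \<delta> :: complex)"
    "\<And>z. z \<in> cball s r \<Longrightarrow> h z = 0 \<Longrightarrow> f z = 0"
    "- Re (deriv f s / f s) = - Re (deriv h s / h s) + Re (- of_real \<delta>) * (1 / (cmod (- of_real \<delta> :: complex))\<^sup>2 - 1 / r\<^sup>2)"
    by (rule Blaschke_remove_zero[of f S s r K' "- of_real \<delta>"]) (use hol S r K' zero \<delta> fs in auto)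
  have h3: "cmod (f s) * r = cmod (h s) * \<delta>" using h(3) \<delta> by simp
  hence hs0: "h s \<noteq> 0" using fs r by auto
  have "cmod (f s) * r \<le> cmod (h s) * r" unfolding h3 using \<delta> by (intro mult_left_mono) auto
  hence le: "cmod (f s) \<le> cmod (h s)" using r by simp
  have "- Re (deriv h s / h s) \<le> 4 * ln (K / cmod (h s)) / r"
    by (rule neg_Re_log_deriv_le[OF h(1) S r _ _ hs0]) (use h K' zeros in force)+
  also have "\<dots> \<le> 4 * ln (K / cmod (f s)) / r"
    using le hs0 fs r K0 by (intro divide_right_mono mult_left_mono) (auto intro!: divide_left_mono)
  finally have 1: "- Re (deriv h s / h s) \<le> 4 * ln (K / cmod (f s)) / r" .
  have "Re (- of_real \<delta>) * (1 / (cmod (- of_real \<delta> :: complex))\<^sup>2 - 1 / r\<^sup>2) = - 1 / \<delta> + \<delta> / r\<^sup>2"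
    using \<delta> r by (simp add: field_simps power2_eq_square)
  with h(5) 1 show ?thesis by linarith
qed

subsection \<open>Newman's contour argument with an error term\<close>

lemma powr_diff_MVT:
  fixes u y :: real assumes "u > 0"
  obtains \<xi> where "u < \<xi>" "\<xi> < u + 1" "(u + 1) powr y - u powr y = y * \<xi> powr (y - 1)"
proof -
  have "\<exists>z>u. z < u + 1 \<and> (u + 1) powr y - u powr y = (u + 1 - u) * (y * z powr (y - 1))"
    by (rule MVT2) (use assms in \<open>auto intro!: derivative_eq_intros simp: powr_diff\<close>)
  thus ?thesis using that by auto
qed

text \<open>Comparison with the integral. For y > 1 the terms increase and the last one is left
  over; it equals \<open>real N powr y / real N\<close> and is absorbed because
  \<open>y \<le> real N\<close>. In \<open>Newman_bound\<close>, y is -Re z, whence the condition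
  \<open>R \<le> real N\<close> there.\<close>

lemma sum_powr_le:
  fixes y :: real assumes y: "y > 0" "y \<le> real N" and N: "N > 0"
  shows "(\<Sum>n=1..N. real n powr (y - 1)) \<le> 2 * real N powr y / y"
proof (cases "y \<le> 1")
  case True
  have "(\<Sum>n=1..N. real n powr (y - 1)) \<le> real N powr y / y"
    using N
  proof (induction N rule: nat_induct_non_zero)
    case (Suc n)
    obtain \<xi> where \<xi>: "real n < \<xi>" "\<xi> < real n + 1"
      "(real n + 1) powr y - real n powr y = y * \<xi> powr (y - 1)"
      using powr_diff_MVT[of "real n" y] Suc by auto
    have "(real n + 1) powr (y - 1) \<le> \<xi> powr (y - 1)"
      using \<xi> True Suc.hyps by (intro powr_mono2') auto
    hence "y * (real n + 1) powr (y - 1) \<le> (real n + 1) powr y - real n powr y"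
      unfolding \<xi>(3) using y by (intro mult_left_mono) auto
    hence "(real n + 1) powr (y - 1) \<le> (real n + 1) powr y / y - real n powr y / y"
      using y by (simp add: field_simps)
    thus ?case using Suc.IH by (simp add: add_ac)
  qed (use y True in auto)
  thus ?thesis using y by (smt (verit) divide_nonneg_pos powr_ge_zero mult_2 add_divide_distrib)
next
  case False
  have "(\<Sum>n=1..N. real n powr (y - 1)) \<le> real N powr y / y + real N powr (y - 1)"
    using N
  proof (induction N rule: nat_induct_non_zero)
    case (Suc n)
    obtain \<xi> where \<xi>: "real n < \<xi>" "\<xi> < real n + 1"
      "(real n + 1) powr y - real n powr y = y * \<xi> powr (y - 1)"
      using powr_diff_MVT[of "real n" y] Suc by auto
    have "real n powr (y - 1) \<le> \<xi> powr (y - 1)"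
      using \<xi> False Suc.hyps by (intro powr_mono2) auto
    hence "y * real n powr (y - 1) \<le> (real n + 1) powr y - real n powr y"
      unfolding \<xi>(3) using y by (intro mult_left_mono) auto
    hence "real n powr (y - 1) \<le> (real n + 1) powr y / y - real n powr y / y"
      using y by (simp add: field_simps)
    thus ?case using Suc.IH by (simp add: add_ac)
  qed (use y False in auto)
  also have "real N powr (y - 1) = real N powr y / real N"
    using N by (simp add: powr_diff)
  also have "\<dots> \<le> real N powr y / y"
    using y by (intro divide_left_mono) auto
  finally show ?thesis by simp
qed

lemma norm_of_nat_powr: "n > 0 \<Longrightarrow> cmod (of_nat n powr z) = real n powr Re z"
  by (subst norm_powr_real_powr) auto

lemma sums_powr_telescope:
  fixes x :: real assumes x: "x > 0"
  shows "(\<lambda>n. (real (n + N) powr (-x) - real (Suc (n + N)) powr (-x)) / x) sums (real N powr (-x) / x)"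
proof -
  have "(\<lambda>n. real n powr (-x)) \<longlonglongrightarrow> 0"
    using x by real_asymp
  hence "(\<lambda>n. real (n + N) powr (-x)) \<longlonglongrightarrow> 0"
    by (rule LIMSEQ_ignore_initial_segment)
  from sums_divide[OF telescope_sums'[OF this], of x] show ?thesis by simp
qed

text \<open>With x = Re z, the mean value theorem bounds n^(-1-x) by ((n-1)^(-x) - n^(-x)) / x, and
  these differences telescope.\<close>

lemma dirichlet_tail_le:
  fixes a :: "nat \<Rightarrow> complex"
  assumes a: "\<And>n. cmod (a n) \<le> 1" and N: "N > 0" and z: "Re z > 0"
    and F: "(\<lambda>n. a n * of_nat n powr (-1 - z)) sums F"
  shows "cmod (F - (\<Sum>n=1..N. a n * of_nat n powr (-1 - z))) \<le> real N powr (- Re z) / Re z"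
proof -
  define t where "t = (\<lambda>n. a n * of_nat n powr (-1 - z))"
  have "(\<lambda>n. t (n + Suc N)) sums (F - (\<Sum>n<Suc N. t n))"
    using F unfolding t_def by (rule sums_split_initial_segment)
  moreover have "(\<Sum>n<Suc N. t n) = (\<Sum>n=1..N. t n)"
    by (intro sum.mono_neutral_right) (auto simp: t_def not_less_eq_eq)
  ultimately have S: "(\<lambda>n. t (n + Suc N)) sums (F - (\<Sum>n=1..N. t n))" by simp
  have "cmod (t (n + Suc N)) \<le> (real (n + N) powr (- Re z) - real (Suc (n + N)) powr (- Re z)) / Re z" for n
  proof -
    obtain \<xi> where \<xi>: "real (n + N) < \<xi>" "\<xi> < real (n + N) + 1"
      "(real (n + N) + 1) powr (- Re z) - real (n + N) powr (- Re z) = (- Re z) * \<xi> powr (- Re z - 1)"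
      using powr_diff_MVT[of "real (n + N)" "- Re z"] N by auto
    have "cmod (t (n + Suc N)) = cmod (a (n + Suc N)) * real (n + Suc N) powr (-1 - Re z)"
      unfolding t_def norm_mult by (subst norm_of_nat_powr) auto
    also have "\<dots> \<le> 1 * real (n + Suc N) powr (-1 - Re z)"
      by (intro mult_right_mono a) auto
    also have "\<dots> \<le> 1 * \<xi> powr (-1 - Re z)"
      using \<xi>(1,2) z N by (intro mult_left_mono powr_mono2') auto
    also have "-1 - Re z = - Re z - 1" by simp
    also have "1 * \<xi> powr (- Re z - 1) = \<xi> powr (- Re z - 1)" by simp
    also have "\<dots> = (real (n + N) powr (- Re z) - real (Suc (n + N)) powr (- Re z)) / Re z"
      using \<xi>(3) z by (simp add: field_simps)
    finally show ?thesis .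
  qed
  hence "cmod (F - (\<Sum>n=1..N. t n)) \<le> real N powr (- Re z) / Re z"
    using S sums_powr_telescope[OF z, of N] by (metis (no_types, lifting) norm_sums_le)
  thus ?thesis by (simp add: t_def)
qed

text \<open>The contour is cut at the imaginary axis because the two halves are estimated
  differently. Rectangles with different \<open>d\<close> share the right half, which allows two
  functions with different left edges to be subtracted there.\<close>

lemma rectangle_Cauchy_split:
  assumes d: "d > 0" and R: "R > 0"
    and G: "G holomorphic_on cbox (Complex (-d) (-R)) (Complex R R)"
  shows "2 * of_real pi * \<i> * G 0 =
     contour_integral (linepath (Complex 0 (-R)) (Complex R (-R))) (\<lambda>z. G z / z)
   + contour_integral (linepath (Complex R (-R)) (Complex R R)) (\<lambda>z. G z / z)
   + contour_integral (linepath (Complex R R) (Complex 0 R)) (\<lambda>z. G z / z)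
   + (contour_integral (linepath (Complex 0 R) (Complex (-d) R)) (\<lambda>z. G z / z)
   + contour_integral (linepath (Complex (-d) R) (Complex (-d) (-R))) (\<lambda>z. G z / z)
   + contour_integral (linepath (Complex (-d) (-R)) (Complex 0 (-R))) (\<lambda>z. G z / z))"
proof -
  define Q where "Q = cbox (Complex (-d) (-R)) (Complex R R)"
  define \<gamma> where "\<gamma> = rectpath (Complex (-d) (-R)) (Complex R R)"
  have int: "0 \<in> interior Q" "0 \<in> box (Complex (-d) (-R)) (Complex R R)"
    using d R by (auto simp: Q_def interior_cbox in_box_complex_iff)
  have sub: "path_image \<gamma> \<subseteq> Q - {0}"
    using d R int unfolding \<gamma>_def Q_def
    by (subst path_image_rectpath_cbox_minus_box) auto
  have "((\<lambda>w. G w / (w - 0)) has_contour_integral (2 * pi * \<i> * winding_number \<gamma> 0 * G 0)) \<gamma>"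
    by (rule Cauchy_integral_formula_convex_simple[of Q])
       (use G int sub in \<open>auto simp: Q_def \<gamma>_def\<close>)
  hence 1: "((\<lambda>w. G w / w) has_contour_integral (2 * pi * \<i> * G 0)) \<gamma>"
    using winding_number_rectpath[OF int(2)] by (simp add: \<gamma>_def)
  have cont: "continuous_on (Q - {0}) (\<lambda>w. G w / w)"
    using continuous_on_subset[OF holomorphic_on_imp_continuous_on[OF G]]
    by (intro continuous_intros) (auto simp: Q_def)
  have seg: "continuous_on (closed_segment x y) (\<lambda>w. G w / w)" if "closed_segment x y \<subseteq> Q - {0}" for x y
    using continuous_on_subset[OF cont that] .
  let ?a1 = "Complex (-d) (-R)" and ?a2 = "Complex R (-R)" and ?a3 = "Complex R R" and ?a4 = "Complex (-d) R"
  have segs: "closed_segment ?a1 ?a2 \<subseteq> Q - {0}" "closed_segment ?a2 ?a3 \<subseteq> Q - {0}"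
    "closed_segment ?a3 ?a4 \<subseteq> Q - {0}" "closed_segment ?a4 ?a1 \<subseteq> Q - {0}"
    using sub by (auto simp: \<gamma>_def rectpath_def Let_def path_image_join)
  have ci: "(\<lambda>w. G w / w) contour_integrable_on linepath x y" if "closed_segment x y \<subseteq> Q - {0}" for x y
    by (rule contour_integrable_continuous_linepath) (rule seg[OF that])
  have "2 * pi * \<i> * G 0 = contour_integral \<gamma> (\<lambda>w. G w / w)"
    using contour_integral_unique[OF 1] by simp
  also have "\<dots> = contour_integral (linepath ?a1 ?a2) (\<lambda>w. G w / w) + (contour_integral (linepath ?a2 ?a3) (\<lambda>w. G w / w)
      + (contour_integral (linepath ?a3 ?a4) (\<lambda>w. G w / w) + contour_integral (linepath ?a4 ?a1) (\<lambda>w. G w / w)))"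
    unfolding \<gamma>_def rectpath_def Let_def using ci segs
    by (simp add: contour_integral_join contour_integrable_joinI valid_path_join)
  also have "contour_integral (linepath ?a1 ?a2) (\<lambda>w. G w / w) =
      contour_integral (linepath ?a1 (Complex 0 (-R))) (\<lambda>w. G w / w) + contour_integral (linepath (Complex 0 (-R)) ?a2) (\<lambda>w. G w / w)"
    by (rule contour_integral_split_linepath[OF seg[OF segs(1)]])
       (use d R in \<open>auto simp: closed_segment_same_Im closed_segment_eq_real_ivl\<close>)
  also have "contour_integral (linepath ?a3 ?a4) (\<lambda>w. G w / w) =
      contour_integral (linepath ?a3 (Complex 0 R)) (\<lambda>w. G w / w) + contour_integral (linepath (Complex 0 R) ?a4) (\<lambda>w. G w / w)"
    by (rule contour_integral_split_linepath[OF seg[OF segs(3)]])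
       (use d R in \<open>auto simp: closed_segment_same_Im closed_segment_eq_real_ivl\<close>)
  finally show ?thesis by (simp add: algebra_simps)
qed

text \<open>If (Im z)^2 = R^2, then 1 + z^2/R^2 contains the factor Re z. On the horizontal edges it
  cancels the 1/|Re z| in the bounds for the tail and for the partial sum, which would otherwise
  blow up at the imaginary axis.\<close>

lemma Newman_kernel_horizontal:
  assumes R: "R > 0" and z: "\<bar>Im z\<bar> = R" "\<bar>Re z\<bar> \<le> R"
  shows "cmod ((1 + z\<^sup>2 / of_real (R\<^sup>2)) / z) \<le> 3 * \<bar>Re z\<bar> / R\<^sup>2"
proof -
  have "Im z * Im z = R * R" using z by (metis abs_mult_self_eq)
  hence "1 + z\<^sup>2 / of_real (R\<^sup>2) = of_real (Re z / R\<^sup>2) * (of_real (Re z) + 2 * \<i> * of_real (Im z))"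
    using R by (simp add: complex_eq_iff field_simps power2_eq_square)
  hence eq: "cmod (1 + z\<^sup>2 / of_real (R\<^sup>2)) = \<bar>Re z\<bar> / R\<^sup>2 * cmod (of_real (Re z) + 2 * \<i> * of_real (Im z))"
    using R by (simp add: norm_mult norm_divide norm_power)
  have "cmod (of_real (Re z) + 2 * \<i> * of_real (Im z)) \<le> \<bar>Re z\<bar> + 2 * \<bar>Im z\<bar>"
    by (rule order_trans[OF norm_triangle_ineq]) (simp add: norm_mult)
  also have "\<dots> \<le> 3 * R" using z by simp
  finally have le: "cmod (of_real (Re z) + 2 * \<i> * of_real (Im z)) \<le> 3 * R" .
  have "cmod (1 + z\<^sup>2 / of_real (R\<^sup>2)) \<le> \<bar>Re z\<bar> / R\<^sup>2 * (3 * R)"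
    unfolding eq by (intro mult_left_mono le) auto
  moreover have "cmod z \<ge> R" using abs_Im_le_cmod[of z] z by simp
  ultimately have "cmod (1 + z\<^sup>2 / of_real (R\<^sup>2)) / cmod z \<le> (\<bar>Re z\<bar> / R\<^sup>2 * (3 * R)) / R"
    using R by (intro frac_le) auto
  thus ?thesis using R by (simp add: norm_divide mult.commute[of 3])
qed

lemma Newman_kernel_vertical:
  assumes R: "R > 0" and z: "\<bar>Im z\<bar> \<le> R" "\<bar>Re z\<bar> = d" "0 < d" "d \<le> R"
  shows "cmod ((1 + z\<^sup>2 / of_real (R\<^sup>2)) / z) \<le> 3 / d"
proof -
  have "(Re z)\<^sup>2 \<le> R\<^sup>2" "(Im z)\<^sup>2 \<le> R\<^sup>2"
    using z R by (auto simp: abs_le_square_iff[symmetric])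
  hence "(cmod z)\<^sup>2 \<le> 2 * R\<^sup>2" by (simp add: cmod_power2)
  hence "cmod (z\<^sup>2 / of_real (R\<^sup>2)) \<le> 2"
    using R by (simp add: norm_divide norm_power field_simps)
  hence "cmod (1 + z\<^sup>2 / of_real (R\<^sup>2)) \<le> 3"
    using norm_triangle_ineq[of 1 "z\<^sup>2 / of_real (R\<^sup>2)"] by simp
  moreover have "cmod z \<ge> d" using abs_Re_le_cmod[of z] z by simp
  ultimately show ?thesis unfolding norm_divide using z by (intro frac_le) auto
qed

text \<open>On the right half the difference of \<open>F\<close> and its partial sum is a tail; on
  the left half the two are treated separately. The kernel is 1 at the origin, so Cauchy's formula
  yields the difference there. The term 6/R comes from the tail and the partial sum, the terms with
  \<open>B\<close> from the horizontal edges and the left edge for \<open>F\<close>.\<close>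

lemma Newman_bound:
  fixes a :: "nat \<Rightarrow> complex"
  assumes a: "\<And>n. cmod (a n) \<le> 1" and R: "1 \<le> R" "R \<le> real N" and d: "0 < d" "d \<le> 1"
    and hol: "F holomorphic_on cbox (Complex (-d) (-R)) (Complex R R)"
    and sums: "\<And>z. Re z > 0 \<Longrightarrow> (\<lambda>n. a n * of_nat n powr (-1 - z)) sums F z"
    and B: "\<And>z. -d \<le> Re z \<Longrightarrow> Re z \<le> 0 \<Longrightarrow> \<bar>Im z\<bar> \<le> R \<Longrightarrow> cmod (F z) \<le> B"
  shows "cmod (F 0 - (\<Sum>n=1..N. a n / of_nat n)) \<le> 6 / R + B / R\<^sup>2 + B * R * real N powr (-d) / d"
proof -
  have N: "N > 0" using R by (cases N) auto
  define S where "S = (\<lambda>z::complex. \<Sum>n=1..N. a n * of_nat n powr (-1 - z))"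
  define K where "K = (\<lambda>z::complex. of_nat N powr z * (1 + z\<^sup>2 / of_real (R\<^sup>2)))"
  have "cmod (F 0) \<le> B" using B[of 0] d R by auto
  hence B0: "B \<ge> 0" by (rule order_trans[OF norm_ge_zero])
  have holS: "S holomorphic_on A" for A
    unfolding S_def by (intro holomorphic_intros) auto
  have holK: "K holomorphic_on A" for A
    unfolding K_def using R N by (intro holomorphic_intros) auto
  have normN: "cmod (of_nat N powr z) = real N powr Re z" for z
    using N by (rule norm_of_nat_powr)
  have Kdiv: "cmod (f * K z / z) = cmod f * real N powr Re z * cmod ((1 + z\<^sup>2 / of_real (R\<^sup>2)) / z)" for f z
    by (simp add: K_def norm_mult norm_divide normN)
  have K0: "K 0 = 1" using N by (simp add: K_def)
  let ?J = "\<lambda>f x y. contour_integral (linepath x y) (\<lambda>z. f z * K z / z)"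
  define right where "right = (\<lambda>f. ?J f (Complex 0 (-R)) (Complex R (-R)) + ?J f (Complex R (-R)) (Complex R R)
     + ?J f (Complex R R) (Complex 0 R))"
  define left where "left = (\<lambda>f d. ?J f (Complex 0 R) (Complex (-d) R) + ?J f (Complex (-d) R) (Complex (-d) (-R))
     + ?J f (Complex (-d) (-R)) (Complex 0 (-R)))"
  have cF: "2 * of_real pi * \<i> * F 0 = right F + left F d"
    using rectangle_Cauchy_split[OF d(1), of R "\<lambda>z. F z * K z"] R hol holK
    by (auto intro!: holomorphic_intros simp: left_def right_def K0)
  \<comment> \<open>The partial sum is entire, so its left edge can be moved out to distance
    \<open>R\<close>; \<open>F\<close> has to stay within distance \<open>d\<close>.\<close>
  have cS: "2 * of_real pi * \<i> * S 0 = right S + left S R"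
    using rectangle_Cauchy_split[of R R "\<lambda>z. S z * K z"] R holS holK
    by (auto intro!: holomorphic_intros simp: left_def right_def K0)
  have hor: "closed_segment (Complex x v) (Complex y v) = {z. Im z = v \<and> Re z \<in> closed_segment x y}" for x y v
    by (auto simp: closed_segment_same_Im)
  have ver: "closed_segment (Complex v x) (Complex v y) = {z. Re z = v \<and> Im z \<in> closed_segment x y}" for x y v
    by (auto simp: closed_segment_same_Re)
  note seg = hor ver closed_segment_eq_real_ivl
  have contF: "continuous_on A F" if "A \<subseteq> cbox (Complex (-d) (-R)) (Complex R R)" for A
    using holomorphic_on_imp_continuous_on[OF hol] continuous_on_subset that by blast
  have int: "(\<lambda>z. f z * K z / z) contour_integrable_on linepath x y"
    if "continuous_on (closed_segment x y) f" "0 \<notin> closed_segment x y" for f x y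
    using that holomorphic_on_imp_continuous_on[OF holK]
    by (intro contour_integrable_continuous_linepath continuous_intros) auto
  have diffJ: "?J F x y - ?J S x y = ?J (\<lambda>z. F z - S z) x y"
    if "closed_segment x y \<subseteq> cbox (Complex (-d) (-R)) (Complex R R)" "0 \<notin> closed_segment x y" for x y
    using contour_integral_diff[OF int[OF contF[OF that(1)] that(2)] int[OF holomorphic_on_imp_continuous_on[OF holS] that(2)]]
    by (simp add: algebra_simps diff_divide_distrib)
  have rightdiff: "right F - right S = right (\<lambda>z. F z - S z)"
  proof -
    have *: "?J F (Complex 0 (-R)) (Complex R (-R)) - ?J S (Complex 0 (-R)) (Complex R (-R)) = ?J (\<lambda>z. F z - S z) (Complex 0 (-R)) (Complex R (-R))"
      "?J F (Complex R (-R)) (Complex R R) - ?J S (Complex R (-R)) (Complex R R) = ?J (\<lambda>z. F z - S z) (Complex R (-R)) (Complex R R)"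
      "?J F (Complex R R) (Complex 0 R) - ?J S (Complex R R) (Complex 0 R) = ?J (\<lambda>z. F z - S z) (Complex R R) (Complex 0 R)"
      by (rule diffJ; use R d in \<open>auto simp: seg in_cbox_complex_iff\<close>)+
    show ?thesis unfolding right_def *[symmetric] by (simp add: algebra_simps)
  qed
  have bJ: "cmod (?J f x y) \<le> b * l"
    if "continuous_on (closed_segment x y) f" "0 \<notin> closed_segment x y"
       "\<And>z. z \<in> closed_segment x y \<Longrightarrow> cmod (f z) * real N powr Re z * cmod ((1 + z\<^sup>2 / of_real (R\<^sup>2)) / z) \<le> b"
       "cmod (y - x) \<le> l" "b \<ge> 0" for f x y b l
  proof -
    have "cmod (?J f x y) \<le> b * cmod (y - x)"
      by (rule contour_integral_bound_linepath[OF int[OF that(1,2)] that(5)]) (use that(3) Kdiv in auto)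
    also have "\<dots> \<le> b * l" using that by (intro mult_left_mono) auto
    finally show ?thesis .
  qed
  have contFS: "continuous_on A (\<lambda>z. F z - S z)" if "A \<subseteq> cbox (Complex (-d) (-R)) (Complex R R)" for A
    by (intro continuous_intros contF that holomorphic_on_imp_continuous_on holS)
  have b1: "cmod (F z - S z) * real N powr Re z * cmod ((1 + z\<^sup>2 / of_real (R\<^sup>2)) / z) \<le> 3 / R\<^sup>2"
    if "0 \<le> Re z" "Re z \<le> R" "\<bar>Im z\<bar> \<le> R" "\<bar>Im z\<bar> = R \<or> Re z = R" for z
  proof (cases "Re z = 0")
    case True
    hence "\<bar>Im z\<bar> = R" using that R by auto
    from Newman_kernel_horizontal[OF _ this] have "cmod ((1 + z\<^sup>2 / of_real (R\<^sup>2)) / z) = 0" using True R by auto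
    thus ?thesis using R by (metis mult_zero_right zero_le_divide_iff zero_le_numeral zero_le_power2)
  next
    case False
    hence x: "Re z > 0" using that by auto
    have "cmod ((1 + z\<^sup>2 / of_real (R\<^sup>2)) / z) \<le> 3 * Re z / R\<^sup>2"
    proof (cases "\<bar>Im z\<bar> = R")
      case True thus ?thesis using Newman_kernel_horizontal[of R z] R that by auto
    next
      case False
      hence "Re z = R" using that by auto
      thus ?thesis using Newman_kernel_vertical[of R z R] R that by (auto simp: power2_eq_square)
    qed
    moreover have "cmod (F z - S z) \<le> real N powr (- Re z) / Re z"
      unfolding S_def by (rule dirichlet_tail_le[OF a N x sums[OF x]])
    ultimately have "cmod (F z - S z) * real N powr Re z * cmod ((1 + z\<^sup>2 / of_real (R\<^sup>2)) / z)
       \<le> (real N powr (- Re z) / Re z) * real N powr Re z * (3 * Re z / R\<^sup>2)"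
      using x by (intro mult_mono) auto
    also have "\<dots> = 3 / R\<^sup>2" using x N by (simp add: powr_minus field_simps)
    finally show ?thesis .
  qed
  have R3: "3 / R\<^sup>2 \<ge> 0" by simp
  have I1: "cmod (right (\<lambda>z. F z - S z)) \<le> 12 / R"
  proof -
    have "cmod (?J (\<lambda>z. F z - S z) (Complex 0 (-R)) (Complex R (-R))) \<le> 3 / R\<^sup>2 * R"
      by (rule bJ[OF contFS _ b1 _ R3]) (use R d in \<open>auto simp: seg in_cbox_complex_iff cmod_def real_sqrt_mult\<close>)
    moreover have "cmod (?J (\<lambda>z. F z - S z) (Complex R (-R)) (Complex R R)) \<le> 3 / R\<^sup>2 * (2 * R)"
      by (rule bJ[OF contFS _ b1 _ R3]) (use R d in \<open>auto simp: seg in_cbox_complex_iff cmod_def real_sqrt_mult\<close>)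
    moreover have "cmod (?J (\<lambda>z. F z - S z) (Complex R R) (Complex 0 R)) \<le> 3 / R\<^sup>2 * R"
      by (rule bJ[OF contFS _ b1 _ R3]) (use R d in \<open>auto simp: seg in_cbox_complex_iff cmod_def real_sqrt_mult\<close>)
    ultimately have "cmod (right (\<lambda>z. F z - S z)) \<le> 3 / R\<^sup>2 * R + 3 / R\<^sup>2 * (2 * R) + 3 / R\<^sup>2 * R"
      unfolding right_def by (intro order_trans[OF norm_triangle_ineq] add_mono)
    thus ?thesis using R by (simp add: power2_eq_square field_simps)
  qed
  have b2: "cmod (S z) * real N powr Re z * cmod ((1 + z\<^sup>2 / of_real (R\<^sup>2)) / z) \<le> 6 / R\<^sup>2"
    if "Re z \<le> 0" "- R \<le> Re z" "\<bar>Im z\<bar> \<le> R" "\<bar>Im z\<bar> = R \<or> Re z = -R" for z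
  proof (cases "Re z = 0")
    case True
    hence "\<bar>Im z\<bar> = R" using that R by auto
    from Newman_kernel_horizontal[OF _ this] have "cmod ((1 + z\<^sup>2 / of_real (R\<^sup>2)) / z) = 0" using True R by auto
    thus ?thesis using R by (metis mult_zero_right zero_le_divide_iff zero_le_numeral zero_le_power2)
  next
    case False
    define y where "y = - Re z"
    have y: "y > 0" "y \<le> R" using that False by (auto simp: y_def)
    have "cmod ((1 + z\<^sup>2 / of_real (R\<^sup>2)) / z) \<le> 3 * y / R\<^sup>2"
    proof (cases "\<bar>Im z\<bar> = R")
      case True thus ?thesis using Newman_kernel_horizontal[of R z] R that by (auto simp: y_def)
    next
      case False
      hence "Re z = - R" using that by auto
      thus ?thesis using Newman_kernel_vertical[of R z R] R that by (auto simp: power2_eq_square y_def)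
    qed
    moreover have "cmod (S z) \<le> (\<Sum>n=1..N. real n powr (y - 1))"
      unfolding S_def
    proof (rule sum_norm_le)
      fix n assume n: "n \<in> {1..N}"
      have "cmod (a n * of_nat n powr (- 1 - z)) = cmod (a n) * real n powr (-1 - Re z)"
        using n by (simp add: norm_mult norm_of_nat_powr)
      also have "\<dots> \<le> 1 * real n powr (-1 - Re z)" by (intro mult_right_mono a) auto
      also have "-1 - Re z = y - 1" by (simp add: y_def)
      finally show "cmod (a n * of_nat n powr (- 1 - z)) \<le> real n powr (y - 1)" by simp
    qed
    hence "cmod (S z) \<le> 2 * real N powr y / y"
      using sum_powr_le[of y N] y R N by linarith
    ultimately have "cmod (S z) * real N powr Re z * cmod ((1 + z\<^sup>2 / of_real (R\<^sup>2)) / z)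
       \<le> (2 * real N powr y / y) * real N powr Re z * (3 * y / R\<^sup>2)"
      using y by (intro mult_mono) auto
    also have "\<dots> = 6 / R\<^sup>2" using y N by (simp add: y_def powr_minus field_simps)
    finally show ?thesis .
  qed
  have R6: "6 / R\<^sup>2 \<ge> 0" by simp
  have contS: "continuous_on A S" for A
    by (intro holomorphic_on_imp_continuous_on holS)
  have I2: "cmod (left S R) \<le> 24 / R"
  proof -
    have "cmod (?J S (Complex 0 R) (Complex (-R) R)) \<le> 6 / R\<^sup>2 * R"
      by (rule bJ[OF contS _ b2 _ R6]) (use R in \<open>auto simp: seg cmod_def real_sqrt_mult\<close>)
    moreover have "cmod (?J S (Complex (-R) R) (Complex (-R) (-R))) \<le> 6 / R\<^sup>2 * (2 * R)"
      by (rule bJ[OF contS _ b2 _ R6]) (use R in \<open>auto simp: seg cmod_def real_sqrt_mult\<close>)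
    moreover have "cmod (?J S (Complex (-R) (-R)) (Complex 0 (-R))) \<le> 6 / R\<^sup>2 * R"
      by (rule bJ[OF contS _ b2 _ R6]) (use R in \<open>auto simp: seg cmod_def real_sqrt_mult\<close>)
    ultimately have "cmod (left S R) \<le> 6 / R\<^sup>2 * R + 6 / R\<^sup>2 * (2 * R) + 6 / R\<^sup>2 * R"
      unfolding left_def by (intro order_trans[OF norm_triangle_ineq] add_mono)
    thus ?thesis using R by (simp add: power2_eq_square field_simps)
  qed
  have b3: "cmod (F z) * real N powr Re z * cmod ((1 + z\<^sup>2 / of_real (R\<^sup>2)) / z) \<le> 3 * B / R\<^sup>2"
    if "Re z \<le> 0" "- d \<le> Re z" "\<bar>Im z\<bar> = R" for z
  proof -
    have "3 * \<bar>Re z\<bar> / R\<^sup>2 \<le> 3 / R\<^sup>2" using that d by (intro divide_right_mono) auto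
    hence "cmod ((1 + z\<^sup>2 / of_real (R\<^sup>2)) / z) \<le> 3 / R\<^sup>2"
      using Newman_kernel_horizontal[of R z] R that d by auto
    moreover have "real N powr Re z \<le> 1"
      using powr_mono[of "Re z" 0 "real N"] that N by auto
    ultimately have "cmod (F z) * real N powr Re z * cmod ((1 + z\<^sup>2 / of_real (R\<^sup>2)) / z) \<le> B * 1 * (3 / R\<^sup>2)"
      using B[of z] that B0 by (intro mult_mono) auto
    thus ?thesis by (simp add: mult_ac)
  qed
  have b4: "cmod (F z) * real N powr Re z * cmod ((1 + z\<^sup>2 / of_real (R\<^sup>2)) / z) \<le> 3 * B * real N powr (-d) / d"
    if "Re z = - d" "\<bar>Im z\<bar> \<le> R" for z
  proof -
    have "cmod ((1 + z\<^sup>2 / of_real (R\<^sup>2)) / z) \<le> 3 / d"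
      using Newman_kernel_vertical[of R z d] R that d by auto
    hence "cmod (F z) * real N powr Re z * cmod ((1 + z\<^sup>2 / of_real (R\<^sup>2)) / z) \<le> B * real N powr (-d) * (3 / d)"
      using B[of z] that B0 d by (intro mult_mono) auto
    thus ?thesis by (simp add: mult_ac)
  qed
  have I3: "cmod (left F d) \<le> 6 * B / R\<^sup>2 + 6 * B * R * real N powr (-d) / d"
  proof -
    have p: "3 * B / R\<^sup>2 \<ge> 0" "3 * B * real N powr (-d) / d \<ge> 0" using B0 d by auto
    have "cmod (?J F (Complex 0 R) (Complex (-d) R)) \<le> 3 * B / R\<^sup>2 * 1"
      by (rule bJ[OF contF _ b3 _ p(1)]) (use R d in \<open>auto simp: seg in_cbox_complex_iff cmod_def real_sqrt_mult\<close>)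
    moreover have "cmod (?J F (Complex (-d) R) (Complex (-d) (-R))) \<le> 3 * B * real N powr (-d) / d * (2 * R)"
      by (rule bJ[OF contF _ b4 _ p(2)]) (use R d in \<open>auto simp: seg in_cbox_complex_iff cmod_def real_sqrt_mult\<close>)
    moreover have "cmod (?J F (Complex (-d) (-R)) (Complex 0 (-R))) \<le> 3 * B / R\<^sup>2 * 1"
      by (rule bJ[OF contF _ b3 _ p(1)]) (use R d in \<open>auto simp: seg in_cbox_complex_iff cmod_def real_sqrt_mult\<close>)
    ultimately have "cmod (left F d) \<le> 3 * B / R\<^sup>2 * 1 + 3 * B * real N powr (-d) / d * (2 * R) + 3 * B / R\<^sup>2 * 1"
      unfolding left_def by (intro order_trans[OF norm_triangle_ineq] add_mono)
    thus ?thesis by (simp add: field_simps)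
  qed
  have "2 * of_real pi * \<i> * (F 0 - S 0) = right (\<lambda>z. F z - S z) + left F d - left S R"
    unfolding rightdiff[symmetric] right_diff_distrib cF cS by simp
  hence "cmod (2 * of_real pi * \<i> * (F 0 - S 0)) = cmod (right (\<lambda>z. F z - S z) + left F d - left S R)"
    by (rule arg_cong)
  hence "cmod (2 * of_real pi * \<i> * (F 0 - S 0)) \<le> cmod (right (\<lambda>z. F z - S z)) + cmod (left F d) + cmod (left S R)"
    using norm_triangle_ineq4[of "right (\<lambda>z. F z - S z) + left F d" "left S R"]
      norm_triangle_ineq[of "right (\<lambda>z. F z - S z)" "left F d"] by linarith
  hence "2 * pi * cmod (F 0 - S 0) \<le> 12 / R + (6 * B / R\<^sup>2 + 6 * B * R * real N powr (-d) / d) + 24 / R"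
    using I1 I2 I3 by (simp add: norm_mult)
  hence *: "2 * pi * cmod (F 0 - S 0) \<le> 6 * (6 / R + B / R\<^sup>2 + B * R * real N powr (-d) / d)"
    by (simp add: algebra_simps add_divide_distrib)
  have "6 * cmod (F 0 - S 0) \<le> 2 * pi * cmod (F 0 - S 0)"
    using pi_gt3 by (intro mult_right_mono) auto
  from order_trans[OF this *]
  have "cmod (F 0 - S 0) \<le> 6 / R + B / R\<^sup>2 + B * R * real N powr (-d) / d"
    by (simp only: mult_le_cancel_left_pos zero_less_numeral)
  moreover have "S 0 = (\<Sum>n=1..N. a n / of_nat n)"
    unfolding S_def by (intro sum.cong) (auto simp: powr_minus_divide)
  ultimately show ?thesis by simp
qed

subsection \<open>Dirichlet convolution and the Moebius function\<close>

definition mob :: "nat \<Rightarrow> real" where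
  "mob n = (if squarefree n then (-1) ^ card (prime_factors n) else 0)"

definition dconv :: "(nat \<Rightarrow> real) \<Rightarrow> (nat \<Rightarrow> real) \<Rightarrow> nat \<Rightarrow> real" where
  "dconv f g n = (\<Sum>d | d dvd n. f d * g (n div d))"

text \<open>One notion for the constant 1, \<chi>, its square and g. Multiplicativity is asked for
  positive arguments only, since the value of g at 0 carries no meaning.\<close>

definition sgn_mult :: "(nat \<Rightarrow> real) \<Rightarrow> bool" where
  "sgn_mult a \<longleftrightarrow> a 1 = 1 \<and> (\<forall>m>0. \<forall>n>0. a (m * n) = a m * a n) \<and> (\<forall>n. a n \<in> {-1, 0, 1})"

lemma sgn_multD:
  assumes "sgn_mult a"
  shows "a 1 = 1" "m > 0 \<Longrightarrow> n > 0 \<Longrightarrow> a (m * n) = a m * a n" "\<bar>a n\<bar> \<le> 1"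
    and "a n = -1 \<or> a n = 0 \<or> a n = 1"
proof -
  show "a n = -1 \<or> a n = 0 \<or> a n = 1" using assms by (auto simp: sgn_mult_def)
  thus "\<bar>a n\<bar> \<le> 1" by auto
qed (use assms in \<open>auto simp: sgn_mult_def\<close>)

lemma sgn_mult_one: "sgn_mult (\<lambda>_. 1)"
  by (simp add: sgn_mult_def)

lemma sgn_mult_square: "sgn_mult a \<Longrightarrow> sgn_mult (\<lambda>n. (a n)\<^sup>2)"
  using sgn_multD(4)[of a] by (auto simp: sgn_mult_def power_mult_distrib power2_eq_1_iff)

lemma mob_1 [simp]: "mob 1 = 1" "mob (Suc 0) = 1"
  by (simp_all add: mob_def)

lemma abs_mob_le: "\<bar>mob n\<bar> \<le> 1"
  by (simp add: mob_def power_abs)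

lemma abs_mob_mult_le:
  assumes "sgn_mult a" shows "\<bar>mob n * a n\<bar> \<le> 1"
  using mult_mono[OF abs_mob_le[of n] sgn_multD(3)[OF assms, of n]] by (simp add: abs_mult)

lemma mob_prime_mult:
  assumes "prime p" "\<not> p dvd d" "d > 0"
  shows "mob (p * d) = - mob d"
proof -
  have cop: "coprime p d" using assms by (simp add: prime_imp_coprime)
  have "squarefree (p * d) \<longleftrightarrow> squarefree d"
    using squarefree_mult_coprime[OF cop] squarefree_prime[OF assms(1)] squarefree_multD(2) by blast
  moreover have "prime_factors (p * d) = insert p (prime_factors d)"
    using assms by (subst prime_factors_product) (auto simp: prime_prime_factors)
  moreover have "p \<notin> prime_factors d" using assms by auto
  ultimately show ?thesis by (simp add: mob_def)
qed

lemma mob_square_dvd: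
  assumes "prime p" "p\<^sup>2 dvd d" shows "mob d = 0"
  using squarefreeD[OF _ assms(2)] assms(1) by (auto simp: mob_def)

text \<open>The Euler factor of the convolution at p is (1 - u(p)X) / (1 - v(p)X), which is 1 when
  u(p) = v(p). In terms of divisors, \<open>d\<close> and \<open>p * d\<close> with p not dividing d
  cancel each other.\<close>

lemma mob_conv_eq_0:
  assumes u: "sgn_mult u" and v: "sgn_mult v" and p: "prime p" "p dvd n" "u p = v p" and n: "n > 0"
  shows "dconv (\<lambda>d. mob d * u d) v n = 0"
proof -
  define D0 where "D0 = {d. d dvd n \<and> \<not> p dvd d}"
  define D1 where "D1 = {d. d dvd n \<and> p dvd d}"
  define t where "t = (\<lambda>d. mob d * u d * v (n div d))"
  have fin: "finite D0" "finite D1" using n by (auto simp: D0_def D1_def)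
  have inj: "inj_on (\<lambda>d. p * d) D0" using p by (auto simp: inj_on_def)
  have p0: "p > 0" using p by (simp add: prime_gt_0_nat)
  have "(\<Sum>d\<in>D1. t d) = (\<Sum>d\<in>(\<lambda>d. p * d) ` D0. t d)"
  proof (rule sum.mono_neutral_right)
    show "(\<lambda>d. p * d) ` D0 \<subseteq> D1"
    proof
      fix x assume "x \<in> (\<lambda>d. p * d) ` D0"
      then obtain d where d: "x = p * d" "d dvd n" "\<not> p dvd d" by (auto simp: D0_def)
      have "coprime p d" using p d by (simp add: prime_imp_coprime)
      thus "x \<in> D1" using d p by (auto simp: D1_def divides_mult)
    qed
    show "\<forall>i\<in>D1 - (\<lambda>d. p * d) ` D0. t i = 0"
    proof
      fix i assume i: "i \<in> D1 - (\<lambda>d. p * d) ` D0"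
      then obtain e where e: "i = p * e" by (auto simp: D1_def)
      have "e dvd n" using i e by (auto simp: D1_def intro: dvd_mult_right)
      hence "p dvd e" using i e by (auto simp: D0_def)
      hence "p\<^sup>2 dvd i" using e by (simp add: power2_eq_square mult_dvd_mono)
      thus "t i = 0" using mob_square_dvd[OF p(1)] by (simp add: t_def)
    qed
  qed (use fin in auto)
  also have "\<dots> = (\<Sum>d\<in>D0. t (p * d))" using inj by (simp add: sum.reindex)
  also have "\<dots> = (\<Sum>d\<in>D0. - t d)"
  proof (rule sum.cong)
    fix d assume d: "d \<in> D0"
    have d0: "d > 0" using d n by (auto simp: D0_def intro: Nat.gr0I)
    have "coprime p d" using p d by (simp add: D0_def prime_imp_coprime)
    hence "p * d dvd n" using d p by (auto simp: D0_def divides_mult)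
    then obtain m where m: "n = p * d * m" by (auto elim: dvdE)
    have m0: "m > 0" using m n by (auto intro: Nat.gr0I)
    have "n div (p * d) = m" "n div d = p * m" using m d0 p0 by auto
    thus "t (p * d) = - t d"
      using mob_prime_mult[OF p(1), of d] d d0 p0 m0 p(3) sgn_multD(2)[OF u, of p d] sgn_multD(2)[OF v, of p m]
      by (simp add: t_def D0_def)
  qed auto
  finally have "(\<Sum>d\<in>D1. t d) = - (\<Sum>d\<in>D0. t d)" by (simp add: sum_negf)
  moreover have "{d. d dvd n} = D0 \<union> D1" "D0 \<inter> D1 = {}" by (auto simp: D0_def D1_def)
  ultimately show ?thesis
    using sum.union_disjoint[OF fin, of t] by (simp add: dconv_def t_def)
qed

lemma mob_conv_self:
  assumes u: "sgn_mult u" and n: "n > 0"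
  shows "dconv (\<lambda>d. mob d * u d) u n = (if n = 1 then 1 else 0)"
proof (cases "n = 1")
  case True
  thus ?thesis using sgn_multD(1)[OF u] by (simp add: dconv_def)
next
  case False
  then obtain p where "prime p" "p dvd n" using prime_factor_nat by blast
  thus ?thesis using mob_conv_eq_0[OF u u] False n by auto
qed

lemma mob_sum: "n > 0 \<Longrightarrow> (\<Sum>d | d dvd n. mob d) = (if n = 1 then 1 else 0)"
  using mob_conv_self[OF sgn_mult_one, of n] by (simp add: dconv_def)

lemma dconv_assoc:
  assumes n: "n > 0"
  shows "dconv (dconv f g) h n = dconv f (dconv g h) n"
proof -
  have "dconv (dconv f g) h n = (\<Sum>d | d dvd n. \<Sum>e | e dvd d. f e * g (d div e) * h (n div d))"
    by (simp add: dconv_def sum_distrib_right)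
  also have "\<dots> = (\<Sum>(d,e)\<in>(SIGMA d:{d. d dvd n}. {e. e dvd d}). f e * g (d div e) * h (n div d))"
    using n by (subst sum.Sigma) (auto intro: finite_divisors_nat dest: dvd_pos_nat)
  also have "\<dots> = (\<Sum>(e,c)\<in>(SIGMA e:{e. e dvd n}. {c. c dvd n div e}). f e * (g c * h (n div e div c)))"
    by (rule sum.reindex_bij_witness[of _ "\<lambda>(e,c). (e * c, e)" "\<lambda>(d,e). (e, d div e)"])
       (use n in \<open>auto elim!: dvdE simp: div_mult2_eq mult_ac\<close>)
  also have "\<dots> = (\<Sum>e | e dvd n. \<Sum>c | c dvd n div e. f e * (g c * h (n div e div c)))"
    using n by (subst sum.Sigma) (auto intro: finite_divisors_nat simp: dvd_div_eq_0_iff)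
  also have "\<dots> = dconv f (dconv g h) n"
    by (simp add: dconv_def sum_distrib_left)
  finally show ?thesis .
qed

lemma dconv_delta:
  assumes "\<And>m. m > 0 \<Longrightarrow> g m = (if m = 1 then 1 else 0)" "n > 0"
  shows "dconv f g n = f n"
proof -
  have "dconv f g n = (\<Sum>d | d dvd n. if d = n then f n else 0)"
    unfolding dconv_def
  proof (rule sum.cong)
    fix d assume "d \<in> {d. d dvd n}"
    then obtain e where e: "n = d * e" by auto
    thus "f d * g (n div d) = (if d = n then f n else 0)" using assms by auto
  qed auto
  also have "\<dots> = f n" using assms(2) by simp
  finally show ?thesis .
qed

lemma dconv_commute: "n > 0 \<Longrightarrow> dconv f g n = dconv g f n"
  unfolding dconv_def
  by (rule sum.reindex_bij_witness[of _ "\<lambda>d. n div d" "\<lambda>d. n div d"]) (auto elim!: dvdE)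

lemma sum_dconv:
  "(\<Sum>n | n > 0 \<and> real n \<le> x. dconv f g n)
    = (\<Sum>m | m > 0 \<and> real m \<le> x. f m * (\<Sum>n | n > 0 \<and> real n \<le> x / real m. g n))"
proof -
  have fin: "finite {n. n > 0 \<and> real n \<le> y}" for y
    by (rule finite_subset[of _ "{..nat \<lfloor>y\<rfloor>}"]) (auto simp: le_nat_floor)
  have "(\<Sum>n | n > 0 \<and> real n \<le> x. dconv f g n)
      = (\<Sum>(n,d)\<in>(SIGMA n:{n. n > 0 \<and> real n \<le> x}. {d. d dvd n}). f d * g (n div d))"
    unfolding dconv_def using fin by (subst sum.Sigma) auto
  also have "\<dots> = (\<Sum>(m,n)\<in>(SIGMA m:{m. m > 0 \<and> real m \<le> x}. {n. n > 0 \<and> real n \<le> x / real m}). f m * g n)"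
  proof (rule sum.reindex_bij_witness[of _ "\<lambda>(m,n). (m * n, m)" "\<lambda>(n,d). (d, n div d)"])
    fix a assume "a \<in> (SIGMA n:{n. n > 0 \<and> real n \<le> x}. {d. d dvd n})"
    then obtain d e where a: "a = (d * e, d)" "d * e > 0" "real (d * e) \<le> x" by (auto elim!: dvdE)
    have "real d * 1 \<le> real d * real e" using a by (intro mult_left_mono) auto
    also have "\<dots> \<le> x" using a by simp
    finally have "real d \<le> x" by simp
    thus "(case a of (n, d) \<Rightarrow> (d, n div d)) \<in> (SIGMA m:{m. m > 0 \<and> real m \<le> x}. {n. n > 0 \<and> real n \<le> x / real m})"
      using a by (auto simp: field_simps)
  qed (auto simp: field_simps elim!: dvdE)
  also have "\<dots> = (\<Sum>m | m > 0 \<and> real m \<le> x. \<Sum>n | n > 0 \<and> real n \<le> x / real m. f m * g n)"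
    using fin by (subst sum.Sigma) auto
  finally show ?thesis by (simp add: sum_distrib_left)
qed

subsection \<open>Dirichlet series in the half-plane of absolute convergence\<close>

text \<open>The index 0 contributes nothing because \<open>0 powr z = 0\<close>.\<close>

definition dser :: "(nat \<Rightarrow> real) \<Rightarrow> complex \<Rightarrow> complex" where
  "dser a s = (\<Sum>n. of_real (a n) * of_nat n powr (-s))"

definition dabs :: "(nat \<Rightarrow> real) \<Rightarrow> complex \<Rightarrow> bool" where
  "dabs a s \<longleftrightarrow> summable (\<lambda>n. \<bar>a n\<bar> * real n powr (- Re s))"

lemma norm_dser_term: "norm (of_real (a n) * of_nat n powr (-s)) = \<bar>a n\<bar> * real n powr (- Re s)"
  by (cases "n = 0") (auto simp: norm_mult norm_of_nat_powr)

lemma dabs_sums: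
  assumes "dabs a s"
  shows "(\<lambda>n. of_real (a n) * of_nat n powr (-s)) sums dser a s"
  using assms unfolding dser_def dabs_def
  by (intro summable_sums summable_norm_cancel[of "\<lambda>n. of_real (a n) * of_nat n powr (-s)"]) (simp add: norm_dser_term)

lemma dabs_bounded:
  assumes "\<And>n. \<bar>a n\<bar> \<le> 1" "Re s > 1" shows "dabs a s"
  unfolding dabs_def
proof (rule summable_comparison_test')
  show "summable (\<lambda>n. real n powr (- Re s))"
    using assms by (subst summable_real_powr_iff) auto
  show "norm (\<bar>a n\<bar> * real n powr (- Re s)) \<le> real n powr (- Re s)" if "n \<ge> 0" for n
    using mult_right_mono[OF assms(1)[of n], of "real n powr (- Re s)"] by simp
qed

lemma dabs_ln:
  assumes "\<And>n. \<bar>a n\<bar> \<le> ln (real n)" "Re s > 1" shows "dabs a s"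
  unfolding dabs_def
proof (rule summable_comparison_test')
  \<comment> \<open>Half of the distance to the line Re s = 1 is spent on the logarithm, the other
    half on convergence.\<close>
  define e where "e = (Re s - 1) / 2"
  have e: "e > 0" using assms by (simp add: e_def)
  show "summable (\<lambda>n. (1 / e) * real n powr (- 1 - e))"
    using e by (intro summable_mult) (subst summable_real_powr_iff, auto)
  show "norm (\<bar>a n\<bar> * real n powr (- Re s)) \<le> (1 / e) * real n powr (- 1 - e)" if "n \<ge> 1" for n
  proof -
    have "\<bar>a n\<bar> \<le> real n powr e / e"
      using assms(1)[of n] ln_powr_bound[of "real n" e] that e by simp
    hence "\<bar>a n\<bar> * real n powr (- Re s) \<le> (real n powr e / e) * real n powr (- Re s)"
      by (intro mult_right_mono) auto
    also have "\<dots> = (1 / e) * (real n powr e * real n powr (- Re s))" by simp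
    also have "real n powr e * real n powr (- Re s) = real n powr (- 1 - e)"
      by (simp add: powr_add[symmetric] e_def field_simps)
    finally show ?thesis by simp
  qed
qed

text \<open>Absolute convergence makes the family of products unconditionally summable over pairs,
  so it may be summed along the fibres of m * n instead.\<close>

lemma dser_mult:
  assumes f: "dabs f s" and g: "dabs g s"
  shows "dser f s * dser g s = dser (dconv f g) s"
proof -
  define F where "F = (\<lambda>n. complex_of_real (f n) * of_nat n powr (-s))"
  define G where "G = (\<lambda>n. complex_of_real (g n) * of_nat n powr (-s))"
  \<comment> \<open>Index 0 is left out because its set of divisors is infinite; its terms vanish
    anyway.\<close>
  define P where "P = {0::nat<..}"
  have abs: "(\<lambda>x. norm (H x)) summable_on P \<and> infsum H P = h"
    if "summable (\<lambda>n. norm (H n))" "H sums h" "H 0 = 0" for H :: "nat \<Rightarrow> complex" and h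
  proof -
    have "((\<lambda>n. norm (H n)) has_sum (suminf (\<lambda>n. norm (H n)))) UNIV"
      using that by (intro norm_summable_imp_has_sum) auto
    hence "(\<lambda>x. norm (H x)) summable_on UNIV" by (rule has_sum_imp_summable)
    moreover have "(H has_sum h) UNIV" using that by (intro norm_summable_imp_has_sum)
    hence "(H has_sum h) P"
      by (rule has_sum_cong_neutral[THEN iffD1, rotated -1]) (use that in \<open>auto simp: P_def\<close>)
    ultimately show ?thesis by (auto simp: infsumI intro: summable_on_subset_banach)
  qed
  have F: "(\<lambda>x. norm (F x)) summable_on P" "infsum F P = dser f s"
    using abs[of F "dser f s"] dabs_sums[OF f] f by (auto simp: F_def norm_dser_term dabs_def)
  have G: "(\<lambda>x. norm (G x)) summable_on P" "infsum G P = dser g s"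
    using abs[of G "dser g s"] dabs_sums[OF g] g by (auto simp: G_def norm_dser_term dabs_def)
  have FG: "(\<lambda>x. norm ((\<lambda>(m,n). F m * G n) x)) summable_on P \<times> P"
    unfolding Infinite_Sum.abs_summable_on_Sigma_iff
    using F G infsum_nonneg[of P "\<lambda>y. norm (G y)"]
    by (auto simp: norm_mult infsum_cmult_right' abs_mult intro!: summable_on_cmult_right summable_on_cmult_left)
  hence FGs: "(\<lambda>(m,n). F m * G n) summable_on P \<times> P" by (rule abs_summable_summable)
  define Q where "Q = (SIGMA k:P. {d. d dvd k})"
  define T where "T = (\<lambda>(k,d). F d * G (k div d))"
  have bij: "bij_betw (\<lambda>(m,n). (m * n, m)) (P \<times> P) Q"
    by (rule bij_betw_byWitness[where f' = "\<lambda>(k,d). (d, k div d)"])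
       (auto simp: P_def Q_def elim!: dvdE)
  have eq: "T ((\<lambda>(m,n). (m * n, m)) x) = (\<lambda>(m,n). F m * G n) x" if "x \<in> P \<times> P" for x
    using that by (auto simp: T_def P_def)
  have "dser f s * dser g s = infsum (\<lambda>m. infsum (\<lambda>n. F m * G n) P) P"
    unfolding F(2)[symmetric] G(2)[symmetric]
    by (simp add: infsum_cmult_right' infsum_cmult_left')
  also have "\<dots> = infsum (\<lambda>(m,n). F m * G n) (P \<times> P)"
    using FGs by (rule infsum_Sigma'_banach)
  also have "((\<lambda>(m,n). F m * G n) has_sum \<dots>) (P \<times> P)"
    using FGs by (rule has_sum_infsum)
  hence "(T has_sum (infsum (\<lambda>(m,n). F m * G n) (P \<times> P))) Q"
    unfolding has_sum_reindex_bij_betw[OF bij, symmetric]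
    by (rule has_sum_cong[THEN iffD1, rotated]) (use eq in auto)
  hence TQ: "T summable_on Q" "infsum T Q = infsum (\<lambda>(m,n). F m * G n) (P \<times> P)"
    by (auto simp: infsumI has_sum_imp_summable)
  have inner: "infsum (\<lambda>d. T (k,d)) {d. d dvd k} = of_real (dconv f g k) * of_nat k powr (-s)" if "k \<in> P" for k
  proof -
    have "infsum (\<lambda>d. T (k,d)) {d. d dvd k} = (\<Sum>d | d dvd k. T (k,d))"
      using that by (intro infsum_finite) (auto simp: P_def)
    also have "\<dots> = (\<Sum>d | d dvd k. of_real (f d * g (k div d)) * of_nat k powr (-s))"
    proof (rule sum.cong)
      fix d assume "d \<in> {d. d dvd k}"
      then obtain e where e: "k = d * e" by auto
      hence d: "d > 0" "e > 0" using that by (auto simp: P_def)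
      have "of_nat k powr (-s) = of_nat d powr (-s) * of_nat e powr (-s :: complex)"
        unfolding e of_nat_mult by (rule powr_times_real) auto
      thus "T (k,d) = of_real (f d * g (k div d)) * of_nat k powr (-s)"
        using e d by (simp add: T_def F_def G_def)
    qed auto
    also have "\<dots> = of_real (dconv f g k) * of_nat k powr (-s)"
      by (simp add: dconv_def sum_distrib_right)
    finally show ?thesis .
  qed
  have inner_summable: "(\<lambda>k. infsum (\<lambda>d. T (k,d)) {d. d dvd k}) summable_on P"
    using summable_on_Sigma_banach[of "\<lambda>k d. T (k,d)" P "\<lambda>k. {d. d dvd k}"] TQ(1) by (simp add: Q_def)
  have "infsum (\<lambda>k. infsum (\<lambda>d. T (k,d)) {d. d dvd k}) P = infsum T Q"
    unfolding Q_def by (rule infsum_Sigma_banach) (use TQ Q_def in auto)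
  with inner_summable have "((\<lambda>k. infsum (\<lambda>d. T (k,d)) {d. d dvd k}) has_sum infsum T Q) P"
    by (metis has_sum_infsum)
  hence "((\<lambda>k. of_real (dconv f g k) * of_nat k powr (-s)) has_sum infsum T Q) P"
    by (rule has_sum_cong[THEN iffD1, rotated]) (use inner in auto)
  hence "((\<lambda>k. of_real (dconv f g k) * of_nat k powr (-s)) has_sum infsum T Q) UNIV"
    by (rule has_sum_cong_neutral[THEN iffD1, rotated -1]) (auto simp: P_def)
  from sums_unique[OF has_sum_imp_sums[OF this]] show ?thesis
    using TQ(2) \<open>dser f s * dser g s = _\<close> calculation by (simp add: dser_def)
qed

lemma dser_cong: "(\<And>n. n > 0 \<Longrightarrow> a n = b n) \<Longrightarrow> dser a s = dser b s"
  unfolding dser_def by (rule suminf_cong) (metis bot_nat_0.not_eq_extremum mult_zero_right of_nat_0 powr_0)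

lemma dser_mob:
  assumes a: "sgn_mult a" and s: "Re s > 1"
  shows "dser (\<lambda>n. mob n * a n) s * dser a s = 1"
proof -
  have "\<bar>mob n * a n\<bar> \<le> 1" for n
    by (rule abs_mob_mult_le[OF a])
  hence "dser (\<lambda>n. mob n * a n) s * dser a s = dser (dconv (\<lambda>n. mob n * a n) a) s"
    using s sgn_multD(3)[OF a] by (intro dser_mult dabs_bounded) auto
  also have "\<dots> = dser (\<lambda>n. if n = 1 then 1 else 0) s"
    by (rule dser_cong) (use mob_conv_self[OF a] in auto)
  also have "\<dots> = (\<Sum>n. if n = 1 then 1 else 0)"
    unfolding dser_def by (rule suminf_cong) auto
  also have "\<dots> = 1" using sums_single[of 1 "\<lambda>_. 1 :: complex"] by (auto simp: sums_iff)
  finally show ?thesis .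
qed

lemma dser_nonzero: "sgn_mult a \<Longrightarrow> Re s > 1 \<Longrightarrow> dser a s \<noteq> 0"
  using dser_mob by fastforce

lemma norm_dser_le:
  assumes "\<And>n. \<bar>a n\<bar> \<le> 1" "Re s > 1"
  shows "cmod (dser a s) \<le> 1 + 1 / (Re s - 1)"
proof -
  have "(\<lambda>n. complex_of_real (a n) * of_nat n powr (-1 - (s - 1))) sums dser a s"
    using dabs_sums[OF dabs_bounded[OF assms]] by simp
  from dirichlet_tail_le[OF _ _ _ this, of 1] assms
  have "cmod (dser a s - of_real (a 1)) \<le> 1 / (Re s - 1)" by simp
  moreover have "cmod (dser a s) \<le> cmod (dser a s - of_real (a 1)) + cmod (of_real (a 1))"
    by (metis diff_add_cancel norm_triangle_ineq)
  ultimately show ?thesis using assms(1)[of 1] by simp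
qed

text \<open>The inverse is again a Dirichlet series with coefficients bounded by 1, so the upper
  bound for such series applies to it.\<close>

lemma norm_dser_ge:
  assumes "sgn_mult a" "Re s > 1"
  shows "cmod (dser a s) \<ge> (Re s - 1) / Re s"
proof -
  have m: "\<bar>mob n * a n\<bar> \<le> 1" for n
    by (rule abs_mob_mult_le[OF assms(1)])
  have "1 = cmod (dser (\<lambda>n. mob n * a n) s) * cmod (dser a s)"
    using dser_mob[OF assms] by (metis norm_mult norm_one)
  also have "\<dots> \<le> (1 + 1 / (Re s - 1)) * cmod (dser a s)"
    by (intro mult_right_mono norm_dser_le m assms) auto
  finally show ?thesis using assms(2) by (simp add: field_simps)
qed

lemma dser_deriv:
  assumes a: "\<And>n. \<bar>a n\<bar> \<le> 1" and s: "Re s > 1"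
  shows "(dser a has_field_derivative - dser (\<lambda>n. a n * ln (real n)) s) (at s)"
proof -
  define S where "S = {s :: complex. Re s > 1}"
  define f where "f = (\<lambda>n s. complex_of_real (a n) * of_nat n powr (-s))"
  define f' where "f' = (\<lambda>n s. - (complex_of_real (a n * ln (real n)) * of_nat n powr (-s)))"
  have "open S" unfolding S_def by (rule open_halfspace_Re_gt)
  have 1: "(f n has_field_derivative f' n x) (at x)" for n x
  proof (cases "n = 0")
    case True thus ?thesis by (simp add: f_def f'_def)
  next
    case False
    hence "Ln (of_nat n) = of_real (ln (real n))" by (metis Ln_of_real of_nat_0_less_iff of_real_of_nat_eq gr0I)
    thus ?thesis unfolding f_def f'_def using False
      by (auto intro!: derivative_eq_intros simp: powr_def)
  qed
  have "\<exists>d h. 0 < d \<and> summable h \<and> range h \<subseteq> \<real>\<^sub>\<ge>\<^sub>0 \<and>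
      (\<forall>\<^sub>F n in sequentially. \<forall>y\<in>ball x d \<inter> S. cmod (f n y) \<le> cmod (h n))" if x: "x \<in> S" for x
  proof -
    define d where "d = (Re x - 1) / 2"
    define h where "h = (\<lambda>n. complex_of_real (real n powr (- (1 + d))))"
    have d: "d > 0" using x by (simp add: d_def S_def)
    have "summable h"
      unfolding h_def summable_complex_of_real using d by (subst summable_real_powr_iff) auto
    moreover have "range h \<subseteq> \<real>\<^sub>\<ge>\<^sub>0" by (auto simp: h_def)
    moreover have "cmod (f n y) \<le> cmod (h n)" if "y \<in> ball x d \<inter> S" for n y
    proof -
      have "\<bar>Re x - Re y\<bar> < d"
        using that abs_Re_le_cmod[of "x - y"] by (auto simp: dist_norm)
      hence "Re x - Re y < d" by linarith
      hence "Re y \<ge> 1 + d" by (simp add: d_def field_simps)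
      hence "real n powr (- Re y) \<le> real n powr (- (1 + d))"
        by (cases "n = 0") (auto intro!: powr_mono)
      moreover have "\<bar>a n\<bar> * real n powr (- Re y) \<le> 1 * real n powr (- Re y)"
        by (intro mult_right_mono a) auto
      ultimately show ?thesis by (simp add: f_def h_def norm_dser_term)
    qed
    ultimately show ?thesis using d by (intro exI[of _ d] exI[of _ h]) auto
  qed
  from series_and_derivative_comparison_complex[OF \<open>open S\<close> 1 this]
  obtain g g' where g: "\<And>x. x \<in> S \<Longrightarrow> ((\<lambda>n. f n x) sums g x) \<and> ((\<lambda>n. f' n x) sums g' x) \<and> (g has_field_derivative g' x) (at x)"
    by blast
  have gd: "g x = dser a x" if "x \<in> S" for x
    using g[OF that] by (auto simp: f_def dser_def sums_iff)
  have sS: "s \<in> S" using s by (simp add: S_def)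
  have "(\<lambda>n. - f' n s) sums (- g' s)" using g[OF sS] by (intro sums_minus) auto
  hence "- g' s = dser (\<lambda>n. a n * ln (real n)) s"
    by (auto simp: f'_def dser_def sums_iff)
  hence g': "g' s = - dser (\<lambda>n. a n * ln (real n)) s" by (metis minus_minus)
  have "(g has_field_derivative g' s) (at s)" using g[OF sS] by blast
  hence "(dser a has_field_derivative g' s) (at s)"
    by (rule has_field_derivative_transform_within_open[OF _ \<open>open S\<close> sS]) (use gd in auto)
  thus ?thesis using g' by simp
qed

lemma abs_mult_mangoldt_le:
  assumes a: "sgn_mult a"
  shows "\<bar>a n * mangoldt n\<bar> \<le> ln (real n)"
proof (cases "n = 0")
  case False
  have "(mangoldt n :: real) \<le> (\<Sum>d | d dvd n. mangoldt d)"
    using False mangoldt_nonneg by (intro member_le_sum) auto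
  also have "\<dots> = ln (real n)" using mangoldt_sum[of n, where 'a = real] False by simp
  finally have "\<bar>a n\<bar> * \<bar>mangoldt n\<bar> \<le> 1 * ln (real n)"
    using mangoldt_nonneg[of n] sgn_multD(3)[OF a] by (intro mult_mono) auto
  thus ?thesis by (simp add: abs_mult)
qed simp

text \<open>Von Mangoldt's identity \<Lambda> * 1 = log, twisted by the completely multiplicative
  \<open>a\<close>. The product form avoids division.\<close>

lemma dser_log_deriv:
  assumes a: "sgn_mult a" and s: "Re s > 1"
  shows "deriv (dser a) s = - dser (\<lambda>n. a n * mangoldt n) s * dser a s"
proof -
  have "dser (\<lambda>n. a n * mangoldt n) s * dser a s = dser (dconv (\<lambda>n. a n * mangoldt n) a) s"
    using s sgn_multD(3)[OF a] abs_mult_mangoldt_le[OF a] by (intro dser_mult dabs_bounded dabs_ln) auto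
  also have "\<dots> = dser (\<lambda>n. a n * ln (real n)) s"
  proof (rule dser_cong)
    fix n :: nat assume n: "n > 0"
    have "dconv (\<lambda>n. a n * mangoldt n) a n = (\<Sum>d | d dvd n. a n * mangoldt d)"
      unfolding dconv_def
    proof (rule sum.cong)
      fix d assume "d \<in> {d. d dvd n}"
      then obtain e where e: "n = d * e" by auto
      hence "d > 0" "e > 0" using n by auto
      thus "a d * mangoldt d * a (n div d) = a n * mangoldt d"
        using sgn_multD(2)[OF a, of d e] e by simp
    qed auto
    also have "\<dots> = a n * (\<Sum>d | d dvd n. mangoldt d)" by (simp add: sum_distrib_left)
    also have "\<dots> = a n * ln (real n)" using mangoldt_sum[of n, where 'a = real] n by simp
    finally show "dconv (\<lambda>n. a n * mangoldt n) a n = a n * ln (real n)" .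
  qed
  finally show ?thesis
    using DERIV_imp_deriv[OF dser_deriv[OF sgn_multD(3)[OF a] s]] by simp
qed

text \<open>The inequality \<open>3 + 4 cos \<theta> + cos 2\<theta> \<ge> 0\<close>, with \<open>a n cos (t log n)\<close> in place of the cosine.\<close>

lemma log_deriv_341:
  assumes a: "sgn_mult a" and \<sigma>: "\<sigma> > 1"
  shows "0 \<le> 3 * Re (- deriv (dser (\<lambda>_. 1)) (of_real \<sigma>) / dser (\<lambda>_. 1) (of_real \<sigma>))
      + 4 * Re (- deriv (dser a) (Complex \<sigma> t) / dser a (Complex \<sigma> t))
      + Re (- deriv (dser (\<lambda>n. (a n)\<^sup>2)) (Complex \<sigma> (2 * t)) / dser (\<lambda>n. (a n)\<^sup>2) (Complex \<sigma> (2 * t)))"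
proof -
  have dab: "dabs (\<lambda>n. b n * mangoldt n) s" if "sgn_mult b" "Re s > 1" for b s
    using that abs_mult_mangoldt_le[OF that(1)] by (intro dabs_ln) auto
  have L: "- deriv (dser b) s / dser b s = dser (\<lambda>n. b n * mangoldt n) s" if "sgn_mult b" "Re s > 1" for b s
    using dser_log_deriv[OF that] dser_nonzero[OF that] by simp
  have S: "(\<lambda>n. b n * mangoldt n * (real n powr (- \<sigma>) * cos (u * ln (real n)))) sums Re (dser (\<lambda>n. b n * mangoldt n) (Complex \<sigma> u))"
    if "sgn_mult b" for b u
  proof -
    have "(\<lambda>n. Re (of_real (b n * mangoldt n) * of_nat n powr (- Complex \<sigma> u))) sums Re (dser (\<lambda>n. b n * mangoldt n) (Complex \<sigma> u))"
      using dabs_sums[OF dab[OF that]] \<sigma> by (intro sums_Re) auto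
    moreover have "Re (of_real (b n * mangoldt n) * of_nat n powr (- Complex \<sigma> u))
       = b n * mangoldt n * (real n powr (- \<sigma>) * cos (u * ln (real n)))" for n
    proof (cases "n = 0")
      case False
      hence "Ln (of_nat n) = of_real (ln (real n))" by (metis Ln_of_real of_nat_0_less_iff of_real_of_nat_eq gr0I)
      thus ?thesis using False by (simp add: powr_def Re_exp)
    qed simp
    ultimately show ?thesis by (simp only:)
  qed
  have "Complex \<sigma> 0 = of_real \<sigma>" by (simp add: complex_eq_iff)
  with S[OF sgn_mult_one, of 0]
  have S1: "(\<lambda>n. 1 * mangoldt n * (real n powr (- \<sigma>) * 1)) sums Re (dser (\<lambda>n. 1 * mangoldt n) (of_real \<sigma>))"
    by simp
  have main: "(\<lambda>n. 3 * (1 * mangoldt n * (real n powr (- \<sigma>) * 1)) + 4 * (a n * mangoldt n * (real n powr (- \<sigma>) * cos (t * ln (real n))))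
      + (a n)\<^sup>2 * mangoldt n * (real n powr (- \<sigma>) * cos (2 * t * ln (real n)))) sums
     (3 * Re (dser (\<lambda>n. 1 * mangoldt n) (of_real \<sigma>)) + 4 * Re (dser (\<lambda>n. a n * mangoldt n) (Complex \<sigma> t))
      + Re (dser (\<lambda>n. (a n)\<^sup>2 * mangoldt n) (Complex \<sigma> (2 * t))))" (is "?f sums ?S")
    by (intro sums_add sums_mult S1 S a sgn_mult_square)
  have "0 \<le> ?f n" for n
  proof -
    define c where "c = cos (t * ln (real n))"
    have c2: "cos (2 * t * ln (real n)) = 2 * c\<^sup>2 - 1"
      unfolding c_def using cos_double_cos[of "t * ln (real n)"] by (simp add: mult.assoc)
    have "0 \<le> 3 + 4 * a n * c + (a n)\<^sup>2 * (2 * c\<^sup>2 - 1)"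
    proof -
      \<comment> \<open>The usual square 2(1 + cos \<theta>)^2 with an extra nonnegative term 1 -
        a(n)^2, which is positive where the character vanishes.\<close>
      have "3 + 4 * a n * c + (a n)\<^sup>2 * (2 * c\<^sup>2 - 1) = 2 * (1 + a n * c)\<^sup>2 + (1 - (a n)\<^sup>2)"
        by (simp add: power2_eq_square algebra_simps)
      moreover have "(a n)\<^sup>2 \<le> 1" using sgn_multD(3)[OF a, of n] by (simp add: abs_square_le_1)
      ultimately show ?thesis by (simp only:) simp
    qed
    hence "0 \<le> mangoldt n * real n powr (- \<sigma>) * (3 + 4 * a n * c + (a n)\<^sup>2 * (2 * c\<^sup>2 - 1))"
      using mangoldt_nonneg[of n] by (intro mult_nonneg_nonneg) auto
    also have "\<dots> = ?f n"
      unfolding c2 c_def[symmetric] by (simp only: ring_distribs mult_ac mult_1_left mult_1_right)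
    finally show ?thesis .
  qed
  from sums_le[OF this sums_zero main] have nn: "0 \<le> ?S" .
  have "- deriv (dser (\<lambda>_. 1)) (of_real \<sigma>) / dser (\<lambda>_. 1) (of_real \<sigma>) = dser (\<lambda>n. 1 * mangoldt n) (of_real \<sigma>)"
    using \<sigma> by (intro L sgn_mult_one) simp
  moreover have "- deriv (dser a) (Complex \<sigma> t) / dser a (Complex \<sigma> t) = dser (\<lambda>n. a n * mangoldt n) (Complex \<sigma> t)"
    using \<sigma> by (intro L a) simp
  moreover have "- deriv (dser (\<lambda>n. (a n)\<^sup>2)) (Complex \<sigma> (2 * t)) / dser (\<lambda>n. (a n)\<^sup>2) (Complex \<sigma> (2 * t))
      = dser (\<lambda>n. (a n)\<^sup>2 * mangoldt n) (Complex \<sigma> (2 * t))"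
    using \<sigma> by (intro L sgn_mult_square a) simp
  ultimately show ?thesis using nn by (simp only:)
qed

subsection \<open>Continuation to the half-plane of positive real part\<close>

text \<open>The common frame of the continuations below: terms gaining one power of n over n^(-s)
  converge locally uniformly for Re s > 0, at the price of a polynomial in |s|.\<close>

lemma holomorphic_series_right_half_plane:
  fixes f :: "nat \<Rightarrow> complex \<Rightarrow> complex"
  assumes hol: "\<And>n. f n holomorphic_on {s. Re s > 0}"
    and bound: "\<And>n s. Re s > 0 \<Longrightarrow> cmod (f n s) \<le> C * (1 + cmod s)\<^sup>2 * real (Suc n) powr (- 1 - Re s)"
    and C: "C \<ge> 0"
  obtains F where "F holomorphic_on {s. Re s > 0}" "\<And>s. Re s > 0 \<Longrightarrow> (\<lambda>n. f n s) sums F s"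
    "\<And>s. Re s \<ge> 1/2 \<Longrightarrow> cmod (F s) \<le> 3 * C * (1 + cmod s)\<^sup>2"
proof -
  define S where "S = {s :: complex. Re s > 0}"
  have "open S" unfolding S_def by (rule open_halfspace_Re_gt)
  have smb: "summable (\<lambda>n. real (Suc n) powr (- 1 - e))" if "e > 0" for e
    using that summable_Suc_iff[of "\<lambda>n. real n powr (- 1 - e)"] by (subst (asm) summable_real_powr_iff) auto
  have 1: "(f n has_field_derivative deriv (f n) x) (at x)" if "x \<in> S" for n x
    using holomorphic_derivI[OF hol _ that[unfolded S_def]] \<open>open S\<close> by (simp add: S_def)
  have "\<exists>d h. 0 < d \<and> summable h \<and> range h \<subseteq> \<real>\<^sub>\<ge>\<^sub>0 \<and>
      (\<forall>\<^sub>F n in sequentially. \<forall>y\<in>ball x d \<inter> S. cmod (f n y) \<le> cmod (h n))" if x: "x \<in> S" for x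
  proof -
    define d where "d = Re x / 2"
    define M where "M = C * (1 + (cmod x + d))\<^sup>2"
    define h where "h = (\<lambda>n. complex_of_real (M * real (Suc n) powr (- 1 - d)))"
    have d: "d > 0" using x by (simp add: d_def S_def)
    have M: "M \<ge> 0" using C by (simp add: M_def)
    have "summable h"
      unfolding h_def summable_complex_of_real using smb[OF d] by (rule summable_mult)
    moreover have "range h \<subseteq> \<real>\<^sub>\<ge>\<^sub>0" using M by (auto simp: h_def simp flip: of_real_mult)
    moreover have "cmod (f n y) \<le> cmod (h n)" if y: "y \<in> ball x d \<inter> S" for n y
    proof -
      have "cmod (x - y) < d" using y by (auto simp: dist_norm)
      hence "Re x - Re y < d" using abs_Re_le_cmod[of "x - y"] by (simp; linarith)
      hence "Re y \<ge> d" by (simp add: d_def field_simps)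
      hence p: "real (Suc n) powr (- 1 - Re y) \<le> real (Suc n) powr (- 1 - d)"
        by (intro powr_mono) auto
      have "cmod y \<le> cmod x + d" using \<open>cmod (x - y) < d\<close> norm_triangle_ineq3[of x y] by linarith
      hence "(1 + cmod y)\<^sup>2 \<le> (1 + (cmod x + d))\<^sup>2" by (intro power_mono) auto
      hence "C * (1 + cmod y)\<^sup>2 \<le> M" unfolding M_def using C by (rule mult_left_mono)
      hence "C * (1 + cmod y)\<^sup>2 * real (Suc n) powr (- 1 - Re y) \<le> M * real (Suc n) powr (- 1 - d)"
        using p M by (intro mult_mono) auto
      moreover have "cmod (f n y) \<le> C * (1 + cmod y)\<^sup>2 * real (Suc n) powr (- 1 - Re y)"
        using y by (intro bound) (auto simp: S_def)
      moreover have "cmod (h n) = M * real (Suc n) powr (- 1 - d)"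
        unfolding h_def norm_of_real using M by (intro abs_of_nonneg) auto
      ultimately show ?thesis by linarith
    qed
    ultimately show ?thesis using d by (intro exI[of _ d] exI[of _ h]) auto
  qed
  from series_and_derivative_comparison_complex[OF \<open>open S\<close> 1 this]
  obtain g g' where g: "\<And>x. x \<in> S \<Longrightarrow> ((\<lambda>n. f n x) sums g x) \<and> (g has_field_derivative g' x) (at x)"
    by blast
  show thesis
  proof (rule that[of g])
    show "g holomorphic_on {s. Re s > 0}"
      using g \<open>open S\<close> by (auto simp: holomorphic_on_open S_def)
    show sums: "(\<lambda>n. f n s) sums g s" if "Re s > 0" for s
      using g[of s] that by (simp add: S_def)
    show "cmod (g s) \<le> 3 * C * (1 + cmod s)\<^sup>2" if s: "Re s \<ge> 1/2" for s
    proof -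
      define M where "M = C * (1 + cmod s)\<^sup>2"
      have M: "M \<ge> 0" using C by (simp add: M_def)
      have ss: "summable (\<lambda>n. real (Suc n) powr (- 1 - 1/2))" by (rule smb) auto
      \<comment> \<open>The sum is the zeta series at 3/2, and \<open>norm_dser_le\<close> gives 1 +
        1/(1/2) = 3.\<close>
      have le3: "(\<Sum>n. real (Suc n) powr (- 1 - 1/2)) \<le> 3"
      proof -
        have d: "dabs (\<lambda>_. 1) (3/2)" by (rule dabs_bounded) auto
        have "(\<lambda>n. complex_of_real (1 * real (Suc n) powr (- 1 - 1/2))) sums (dser (\<lambda>_. 1) (3/2))"
        proof -
          have "(\<lambda>n. complex_of_real 1 * of_nat (Suc n) powr (- (3/2))) sums (dser (\<lambda>_. 1) (3/2))"
            using dabs_sums[OF d] by (subst sums_Suc_iff) simp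
          moreover have "complex_of_real 1 * of_nat (Suc n) powr (- (3/2)) = complex_of_real (1 * real (Suc n) powr (- 1 - 1/2))" for n
            using powr_of_real[of "real (Suc n)" "-3/2"] by simp
          ultimately show ?thesis by (simp only:)
        qed
        hence "(\<lambda>n. complex_of_real (real (Suc n) powr (- 1 - 1/2))) sums (dser (\<lambda>_. 1) (3/2))" by simp
        moreover have "(\<lambda>n. complex_of_real (real (Suc n) powr (- 1 - 1/2))) sums complex_of_real (\<Sum>n. real (Suc n) powr (- 1 - 1/2))"
          using ss by (intro sums_of_real summable_sums)
        ultimately have eq: "complex_of_real (\<Sum>n. real (Suc n) powr (- 1 - 1/2)) = dser (\<lambda>_. 1) (3/2)"
          by (rule sums_unique2[symmetric])
        have "cmod (complex_of_real (\<Sum>n. real (Suc n) powr (- 1 - 1/2))) \<le> 3"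
          unfolding eq using norm_dser_le[of "\<lambda>_. 1" "3/2"] by simp
        thus ?thesis by simp
      qed
      have bb: "cmod (f n s) \<le> M * real (Suc n) powr (- 1 - 1/2)" for n
      proof -
        have "real (Suc n) powr (- 1 - Re s) \<le> real (Suc n) powr (- 1 - 1/2)"
          using s by (intro powr_mono) auto
        hence "M * real (Suc n) powr (- 1 - Re s) \<le> M * real (Suc n) powr (- 1 - 1/2)"
          using M by (intro mult_left_mono) auto
        thus ?thesis using bound[of s n] s by (simp add: M_def)
      qed
      have "cmod (g s) \<le> (\<Sum>n. M * real (Suc n) powr (- 1 - 1/2))"
        by (rule norm_sums_le[OF sums summable_sums[OF summable_mult[OF ss]]]) (use s bb in auto)
      also have "\<dots> = M * (\<Sum>n. real (Suc n) powr (- 1 - 1/2))" using ss by (rule suminf_mult)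
      also have "\<dots> \<le> M * 3" using le3 M by (rule mult_left_mono)
      finally show ?thesis by (simp add: M_def mult_ac)
    qed
  qed
qed

lemma norm_powr_diff_le:
  assumes s: "Re s > 0" and n: "n \<ge> 1" and t: "0 \<le> t" "t \<le> 1"
  shows "cmod (of_real n powr (-s) - of_real (n + t) powr (-s)) \<le> cmod s * n powr (- 1 - Re s)"
proof -
  have pos: "\<exists>u. z = of_real u \<and> u \<ge> n" if "z \<in> closed_segment (of_real n) (of_real (n + t) :: complex)" for z
    using that t unfolding closed_segment_of_real by (auto simp: closed_segment_eq_real_ivl)
  have "cmod (of_real n powr (-s) - of_real (n + t) powr (-s))
      \<le> (cmod s * n powr (- 1 - Re s)) * cmod (of_real n - of_real (n + t))"
  proof (rule field_differentiable_bound[where S = "closed_segment (of_real n) (of_real (n + t))"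
        and f' = "\<lambda>z. - s * z powr (- s - 1)"])
    fix z :: complex assume "z \<in> closed_segment (of_real n) (of_real (n + t))"
    then obtain u where u: "z = of_real u" "u \<ge> n" using pos by blast
    have "z \<notin> \<real>\<^sub>\<le>\<^sub>0" using u n by (auto simp: complex_nonpos_Reals_iff)
    thus "((\<lambda>z. z powr - s) has_field_derivative - s * z powr (- s - 1)) (at z within closed_segment (of_real n) (of_real (n + t)))"
      by (auto intro!: derivative_eq_intros has_field_derivative_at_within[OF has_field_derivative_powr])
    have e: "- 1 - Re s = - Re s - 1" by simp
    have "cmod (z powr (- s - 1)) = u powr (- Re s - 1)"
      using u n by (subst norm_powr_real_powr) auto
    also have "\<dots> \<le> n powr (- Re s - 1)" using u n s by (intro powr_mono2') auto
    finally show "cmod (- s * z powr (- s - 1)) \<le> cmod s * n powr (- 1 - Re s)"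
      unfolding norm_mult e by (simp add: mult_left_mono)
  qed auto
  also have "cmod (of_real n - of_real (n + t)) \<le> 1" using t by (simp flip: of_real_diff)
  hence "(cmod s * n powr (- 1 - Re s)) * cmod (of_real n - of_real (n + t)) \<le> (cmod s * n powr (- 1 - Re s)) * 1"
    by (intro mult_left_mono) auto
  finally show ?thesis by simp
qed

text \<open>The two powers with exponent 1 - s form minus the integral of (s - 1) u^(-s) over
  [n, n+1]. Comparing the integrand with its value at n gains a power of n, and the factor s - 1
  removes the pole.\<close>

lemma zeta_term_bound:
  assumes s: "Re s > 0" and n: "n \<ge> 1"
  shows "cmod ((s - 1) * of_real n powr (-s) + of_real (n + 1) powr (1 - s) - of_real n powr (1 - s))
    \<le> (1 + cmod s)\<^sup>2 * n powr (- 1 - Re s)"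
proof -
  \<comment> \<open>The derivative of \<open>\<phi>\<close> is (s - 1)(n^(-s) - z^(-s)), so its
    increment over [n, n+1] is the quantity to be bounded.\<close>
  define \<phi> where "\<phi> = (\<lambda>z. (s - 1) * (z - of_real n) * of_real n powr (-s) + z powr (1 - s))"
  define B where "B = cmod (s - 1) * (cmod s * n powr (- 1 - Re s))"
  have "cmod (\<phi> (of_real (n + 1)) - \<phi> (of_real n)) \<le> B * cmod (of_real (n + 1) - of_real n :: complex)"
  proof (rule field_differentiable_bound[where S = "closed_segment (of_real n) (of_real (n + 1))"
        and f' = "\<lambda>z. (s - 1) * (of_real n powr (-s) - z powr (- s))"])
    fix z :: complex assume "z \<in> closed_segment (of_real n) (of_real (n + 1))"
    then obtain u where u: "z = of_real u" "u \<ge> n" "u \<le> n + 1"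
      unfolding closed_segment_of_real by (auto simp: closed_segment_eq_real_ivl)
    have "z \<notin> \<real>\<^sub>\<le>\<^sub>0" using u n by (auto simp: complex_nonpos_Reals_iff)
    hence pw: "((\<lambda>z. z powr (1 - s)) has_field_derivative (1 - s) * z powr (1 - s - 1)) (at z within closed_segment (of_real n) (of_real (n + 1)))"
      by (intro has_field_derivative_at_within[OF has_field_derivative_powr])
    show "(\<phi> has_field_derivative (s - 1) * (of_real n powr (-s) - z powr (- s))) (at z within closed_segment (of_real n) (of_real (n + 1)))"
      unfolding \<phi>_def by (rule derivative_eq_intros refl pw)+ (simp add: algebra_simps)
    show "cmod ((s - 1) * (of_real n powr (-s) - z powr (- s))) \<le> B"
      unfolding norm_mult B_def using norm_powr_diff_le[OF s n, of "u - n"] u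
      by (intro mult_left_mono) auto
  qed auto
  also have "\<phi> (of_real (n + 1)) - \<phi> (of_real n) = (s - 1) * of_real n powr (-s) + of_real (n + 1) powr (1 - s) - of_real n powr (1 - s)"
    by (simp add: \<phi>_def algebra_simps)
  also have "cmod (of_real (n + 1) - of_real n :: complex) = 1" by simp
  also have "B * 1 \<le> (1 + cmod s)\<^sup>2 * n powr (- 1 - Re s)"
  proof -
    have "cmod (s - 1) * cmod s \<le> (1 + cmod s) * (1 + cmod s)"
      using norm_triangle_ineq4[of s 1] by (intro mult_mono) auto
    hence "cmod (s - 1) * cmod s * n powr (- 1 - Re s) \<le> (1 + cmod s) * (1 + cmod s) * n powr (- 1 - Re s)"
      by (rule mult_right_mono) auto
    thus ?thesis by (simp add: B_def power2_eq_square mult_ac)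
  qed
  finally show ?thesis .
qed

text \<open>\<open>H\<close> is the continuation of (s - 1)^d L(s), where \<open>d\<close> is 0 or
  1, the order of the pole at 1. The last clause says that L(1) or the residue is nonzero. The
  exponent 3 is generous, because only the logarithm of the bound matters later. With this form,
  zeta, L(s, \<chi>) and L(s, \<chi>^2) share all further arguments.\<close>

definition continuation :: "(nat \<Rightarrow> real) \<Rightarrow> nat \<Rightarrow> (complex \<Rightarrow> complex) \<Rightarrow> bool" where
  "continuation a d H \<longleftrightarrow> d \<le> 1 \<and> H holomorphic_on {s. Re s > 0} \<and>
     (\<exists>K>0. \<forall>s. Re s \<ge> 1/2 \<longrightarrow> cmod (H s) \<le> K * (1 + cmod s) ^ 3) \<and>
     (\<forall>s. Re s > 1 \<longrightarrow> H s = (s - 1) ^ d * dser a s) \<and> H 1 \<noteq> 0"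

text \<open>Adding up the differences of \<open>zeta_term_bound\<close>, the powers with exponent 1
  - s telescope to -1, and (s - 1) \<zeta>(s) - 1 remains. At s = 1 every term is zero.\<close>

lemma zeta_continuation:
  obtains Z where "Z holomorphic_on {s. Re s > 0}" "\<And>s. Re s \<ge> 1/2 \<Longrightarrow> cmod (Z s) \<le> 4 * (1 + cmod s)\<^sup>2"
    "\<And>s. Re s > 1 \<Longrightarrow> Z s = (s - 1) * dser (\<lambda>_. 1) s" "Z 1 = 1"
proof -
  define f where "f = (\<lambda>n s. (s - 1) * of_real (real (Suc n)) powr (-s)
    + of_real (real (Suc n) + 1) powr (1 - s) - of_real (real (Suc n)) powr (1 - s) :: complex)"
  obtain F where F: "F holomorphic_on {s. Re s > 0}" "\<And>s. Re s > 0 \<Longrightarrow> (\<lambda>n. f n s) sums F s"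
    "\<And>s. Re s \<ge> 1/2 \<Longrightarrow> cmod (F s) \<le> 3 * 1 * (1 + cmod s)\<^sup>2"
  proof (rule holomorphic_series_right_half_plane[of f 1])
    show "f n holomorphic_on {s. Re s > 0}" for n
      unfolding f_def by (intro holomorphic_intros) (auto simp flip: of_nat_Suc)
    show "cmod (f n s) \<le> 1 * (1 + cmod s)\<^sup>2 * real (Suc n) powr (- 1 - Re s)" if "Re s > 0" for n s
      unfolding f_def using zeta_term_bound[OF that, of "real (Suc n)"] by simp
  qed (use that in auto)
  show thesis
  proof (rule that[of "\<lambda>s. 1 + F s"])
    show "(\<lambda>s. 1 + F s) holomorphic_on {s. Re s > 0}" by (intro holomorphic_intros F)
    show "cmod (1 + F s) \<le> 4 * (1 + cmod s)\<^sup>2" if "Re s \<ge> 1/2" for s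
    proof -
      have "1 \<le> (1 + cmod s)\<^sup>2" by (simp add: one_le_power)
      thus ?thesis using F(3)[OF that] norm_triangle_ineq[of 1 "F s"] unfolding norm_one by linarith
    qed
    have "complex_of_real (real (Suc n) + 1) \<noteq> 0" for n by (simp only: of_real_eq_0_iff)
    hence "f n 1 = 0" for n by (simp add: f_def del: of_real_add of_real_of_nat_eq of_nat_Suc)
    hence "(\<lambda>n. 0) sums F 1" using F(2)[of 1] by simp
    hence "F 1 = 0" by (metis sums_unique2 sums_zero)
    thus "1 + F 1 = 1" by simp
    fix s :: complex assume s: "Re s > 1"
    have "(\<lambda>n. of_real 1 * of_nat (Suc n) powr (-s)) sums dser (\<lambda>_. 1) s"
      using dabs_sums[OF dabs_bounded, of "\<lambda>_. 1" s] s by (subst sums_Suc_iff) simp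
    hence 1: "(\<lambda>n. (s - 1) * of_nat (Suc n) powr (-s)) sums ((s - 1) * dser (\<lambda>_. 1) s)"
      by (intro sums_mult) simp
    have "(\<lambda>n. real n powr (1 - Re s)) \<longlonglongrightarrow> 0" using s by real_asymp
    hence "(\<lambda>n. cmod (of_nat (Suc n) powr (1 - s))) \<longlonglongrightarrow> 0"
      by (subst norm_of_nat_powr) (auto dest: LIMSEQ_Suc)
    hence "(\<lambda>n. complex_of_nat (Suc n) powr (1 - s)) \<longlonglongrightarrow> 0" by (rule tendsto_norm_zero_cancel)
    from telescope_sums[OF this]
    have "(\<lambda>n. of_nat (Suc (Suc n)) powr (1 - s) - of_nat (Suc n) powr (1 - s)) sums (0 - 1 :: complex)" by simp
    from sums_add[OF 1 this] have "(\<lambda>n. f n s) sums ((s - 1) * dser (\<lambda>_. 1) s - 1)"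
      by (simp add: f_def add_ac add_diff_eq)
    thus "1 + F s = (s - 1) * dser (\<lambda>_. 1) s"
      using F(2)[of s] s sums_unique2 by fastforce
  qed
qed

text \<open>Summation by parts with bounded summatory function \<open>E\<close>. The last clause
  records the value at 1 in the summed form, which \<open>continuation_entire\<close> converts back
  into \<Sum> a(n)/n.\<close>

lemma summation_continuation:
  assumes E: "\<And>n. \<bar>E n\<bar> \<le> C" "E 0 = 0"
  obtains T where "T holomorphic_on {s. Re s > 0}" "\<And>s. Re s \<ge> 1/2 \<Longrightarrow> cmod (T s) \<le> 3 * C * (1 + cmod s)\<^sup>2"
    "\<And>s. Re s > 1 \<Longrightarrow> (\<lambda>n. of_real (E (Suc n) - E n) * of_nat (Suc n) powr (-s)) sums T s"
    "(\<lambda>n. of_real (E (Suc n)) * (1 / of_nat (Suc n) - 1 / of_nat (Suc (Suc n)))) sums T 1"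
proof -
  have C: "C \<ge> 0" using E(1)[of 0] by linarith
  define f where "f = (\<lambda>n s. of_real (E (Suc n)) * (of_real (real (Suc n)) powr (-s) - of_real (real (Suc n) + 1) powr (-s)) :: complex)"
  obtain F where F: "F holomorphic_on {s. Re s > 0}" "\<And>s. Re s > 0 \<Longrightarrow> (\<lambda>n. f n s) sums F s"
    "\<And>s. Re s \<ge> 1/2 \<Longrightarrow> cmod (F s) \<le> 3 * C * (1 + cmod s)\<^sup>2"
  proof (rule holomorphic_series_right_half_plane[of f C])
    show "f n holomorphic_on {s. Re s > 0}" for n
      unfolding f_def by (intro holomorphic_intros) (auto simp flip: of_nat_Suc)
    show "cmod (f n s) \<le> C * (1 + cmod s)\<^sup>2 * real (Suc n) powr (- 1 - Re s)" if "Re s > 0" for n s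
    proof -
      have "cmod s * 1 \<le> (1 + cmod s) * (1 + cmod s)" by (intro mult_mono) auto
      hence s2: "cmod s \<le> (1 + cmod s)\<^sup>2" by (simp add: power2_eq_square)
      have "cmod (f n s) \<le> C * (cmod s * real (Suc n) powr (- 1 - Re s))"
        unfolding f_def norm_mult norm_of_real using E(1)[of "Suc n"] C norm_powr_diff_le[OF that, of "real (Suc n)" 1]
        by (intro mult_mono) auto
      also have "\<dots> \<le> C * ((1 + cmod s)\<^sup>2 * real (Suc n) powr (- 1 - Re s))"
        using s2 C by (intro mult_left_mono mult_right_mono) auto
      finally show ?thesis by (simp add: mult_ac)
    qed
  qed (use that C in auto)
  show thesis
  proof (rule that[OF F(1,3)])
    have "(\<lambda>n. f n 1) sums F 1" by (rule F(2)) simp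
    thus "(\<lambda>n. of_real (E (Suc n)) * (1 / of_nat (Suc n) - 1 / of_nat (Suc (Suc n)))) sums F 1"
      by (simp add: f_def powr_minus_divide add_ac)
    fix s :: complex assume s: "Re s > 1"
    define g where "g = (\<lambda>n. of_real (E n) * of_nat (Suc n) powr (-s) :: complex)"
    have "(\<lambda>n. cmod (g n)) \<longlonglongrightarrow> 0"
    proof (rule tendsto_sandwich[of "\<lambda>_. 0" _ _ "\<lambda>n. C * real (Suc n) powr (- Re s)"])
      have "(\<lambda>n. real n powr (- Re s)) \<longlonglongrightarrow> 0" using s by real_asymp
      from LIMSEQ_Suc[OF this] show "(\<lambda>n. C * real (Suc n) powr (- Re s)) \<longlonglongrightarrow> 0"
        by (rule tendsto_mult_right_zero)
      show "\<forall>\<^sub>F n in sequentially. cmod (g n) \<le> C * real (Suc n) powr (- Re s)"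
        unfolding g_def norm_mult using E
        by (intro always_eventually allI) (subst norm_of_nat_powr, auto intro!: mult_right_mono)
    qed auto
    hence "g \<longlonglongrightarrow> 0" by (rule tendsto_norm_zero_cancel)
    from telescope_sums[OF this] have "(\<lambda>n. g (Suc n) - g n) sums 0" by (simp add: g_def E)
    moreover have "(\<lambda>n. f n s) sums F s" using s by (intro F) auto
    ultimately have "(\<lambda>n. f n s + (g (Suc n) - g n)) sums F s" using sums_add by fastforce
    moreover have "f n s + (g (Suc n) - g n) = of_real (E (Suc n) - E n) * of_nat (Suc n) powr (-s)" for n
      by (simp add: f_def g_def algebra_simps)
    ultimately show "(\<lambda>n. of_real (E (Suc n) - E n) * of_nat (Suc n) powr (-s)) sums F s" by simp
  qed
qed

lemma dser_Suc_sums: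
  assumes "\<And>n. \<bar>a n\<bar> \<le> 1" "Re s > 1"
  shows "(\<lambda>n. of_real (a (Suc n)) * of_nat (Suc n) powr (-s)) sums dser a s"
  using dabs_sums[OF dabs_bounded[OF assms]] by (subst sums_Suc_iff) simp

lemma cube_bound:
  assumes "u \<le> M * (1 + cmod s)\<^sup>2" "M \<ge> 0"
  shows "u \<le> M * (1 + cmod s) ^ 3"
proof -
  have "(1 + cmod s)\<^sup>2 \<le> (1 + cmod s) ^ 3" by (intro power_increasing) auto
  thus ?thesis using assms mult_left_mono order_trans by blast
qed

text \<open>Coefficients of mean value \<kappa> are \<kappa> plus the increments of a bounded
  \<open>E\<close>, so their series is \<kappa> \<zeta>(s) plus a function holomorphic for Re s >
  0.\<close>

lemma continuation_pole:
  assumes a: "\<And>n. \<bar>a n\<bar> \<le> 1" and \<kappa>: "\<kappa> > 0"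
    and C: "\<And>N. \<bar>(\<Sum>n=1..N. a n) - \<kappa> * real N\<bar> \<le> C"
  shows "\<exists>H. continuation a 1 H"
proof -
  define E where "E = (\<lambda>N. (\<Sum>n=1..N. a n) - \<kappa> * real N)"
  have C0: "C \<ge> 0" using C[of 0] by simp
  obtain Z where Z: "Z holomorphic_on {s. Re s > 0}" "\<And>s. Re s \<ge> 1/2 \<Longrightarrow> cmod (Z s) \<le> 4 * (1 + cmod s)\<^sup>2"
    "\<And>s. Re s > 1 \<Longrightarrow> Z s = (s - 1) * dser (\<lambda>_. 1) s" "Z 1 = 1" by (rule zeta_continuation) blast
  obtain T where T: "T holomorphic_on {s. Re s > 0}" "\<And>s. Re s \<ge> 1/2 \<Longrightarrow> cmod (T s) \<le> 3 * C * (1 + cmod s)\<^sup>2"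
    "\<And>s. Re s > 1 \<Longrightarrow> (\<lambda>n. of_real (E (Suc n) - E n) * of_nat (Suc n) powr (-s)) sums T s"
    by (rule summation_continuation[of E C]) (use C in \<open>auto simp: E_def\<close>)
  define H where "H = (\<lambda>s. of_real \<kappa> * Z s + (s - 1) * T s)"
  have hol: "H holomorphic_on {s. Re s > 0}" unfolding H_def by (intro holomorphic_intros Z T)
  have bd: "cmod (H s) \<le> (4 * \<kappa> + 3 * C) * (1 + cmod s) ^ 3" if s: "Re s \<ge> 1/2" for s
  proof -
    have "cmod (s - 1) * cmod (T s) \<le> (1 + cmod s) * (3 * C * (1 + cmod s)\<^sup>2)"
      using T(2)[OF s] norm_triangle_ineq4[of s 1] by (intro mult_mono) auto
    also have "\<dots> = 3 * C * (1 + cmod s) ^ 3" by (simp add: power2_eq_square power3_eq_cube)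
    finally have 1: "cmod (s - 1) * cmod (T s) \<le> 3 * C * (1 + cmod s) ^ 3" .
    have "cmod (Z s) \<le> 4 * (1 + cmod s) ^ 3" by (rule cube_bound[OF Z(2)[OF s]]) auto
    hence "\<kappa> * cmod (Z s) \<le> \<kappa> * (4 * (1 + cmod s) ^ 3)" using \<kappa> by (intro mult_left_mono) auto
    moreover have "cmod (H s) \<le> \<kappa> * cmod (Z s) + cmod (s - 1) * cmod (T s)"
      unfolding H_def using \<kappa> norm_triangle_ineq[of "of_real \<kappa> * Z s" "(s - 1) * T s"] by (simp add: norm_mult)
    ultimately show ?thesis using 1 by (simp add: algebra_simps)
  qed
  have eq: "H s = (s - 1) ^ 1 * dser a s" if s: "Re s > 1" for s
  proof -
    have "(\<lambda>n. of_real \<kappa> * (of_real 1 * of_nat (Suc n) powr (-s)) + of_real (E (Suc n) - E n) * of_nat (Suc n) powr (-s))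
       sums (of_real \<kappa> * dser (\<lambda>_. 1) s + T s)"
      by (intro sums_add sums_mult dser_Suc_sums T s) simp
    moreover have "of_real \<kappa> * (of_real 1 * of_nat (Suc n) powr (-s)) + of_real (E (Suc n) - E n) * of_nat (Suc n) powr (-s)
        = of_real (a (Suc n)) * of_nat (Suc n) powr (-s)" for n
      by (simp add: E_def algebra_simps)
    ultimately have "(\<lambda>n. of_real (a (Suc n)) * of_nat (Suc n) powr (-s)) sums (of_real \<kappa> * dser (\<lambda>_. 1) s + T s)"
      by (simp only:)
    hence "dser a s = of_real \<kappa> * dser (\<lambda>_. 1) s + T s"
      by (rule sums_unique2[OF dser_Suc_sums[OF a s]])
    thus ?thesis by (simp add: H_def Z(3)[OF s] algebra_simps)
  qed
  have "H 1 \<noteq> 0" using \<kappa> Z(4) by (simp add: H_def)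
  moreover have "4 * \<kappa> + 3 * C > 0" using \<kappa> C0 by simp
  ultimately have "continuation a 1 H" unfolding continuation_def using hol bd eq by (intro conjI exI[of _ "4 * \<kappa> + 3 * C"]) auto
  thus ?thesis by blast
qed

section \<open>Divisor sums of real characters and the nonvanishing of L(1, \<chi>)\<close>

lemma sum_real_char_prime_power:
  assumes a: "sgn_mult a" and p: "prime p" "\<not> p dvd m" and m: "m > 0"
  shows "(\<Sum>d | d dvd p ^ j * m. a d) = (\<Sum>i\<le>j. a p ^ i) * (\<Sum>d | d dvd m. a d)"
proof -
  have p0: "p > 0" using p by (simp add: prime_gt_0_nat)
  have ap: "a (p ^ i) = a p ^ i" for i
    by (induction i) (use sgn_multD(1,2)[OF a] p0 in auto)
  have img: "{d. d dvd p ^ j * m} = (\<lambda>(i,e). p ^ i * e) ` ({..j} \<times> {e. e dvd m})"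
  proof (intro equalityI subsetI)
    fix d assume "d \<in> {d. d dvd p ^ j * m}"
    then obtain y z where "d = y * z" "y dvd p ^ j" "z dvd m" using division_decomp by blast
    moreover from this obtain i where "i \<le> j" "y = p ^ i"
      using p(1) divides_primepow_nat[of p y j] by auto
    ultimately show "d \<in> (\<lambda>(i,e). p ^ i * e) ` ({..j} \<times> {e. e dvd m})" by force
  qed (auto intro!: mult_dvd_mono le_imp_power_dvd)
  have inj: "inj_on (\<lambda>(i,e). p ^ i * e) ({..j} \<times> {e. e dvd m})"
  proof (rule inj_onI, clarsimp)
    fix i e i' e' assume *: "e dvd m" "e' dvd m" "p ^ i * e = p ^ i' * e'"
    have e: "\<not> p dvd e" "\<not> p dvd e'" "e \<noteq> 0" "e' \<noteq> 0"
      using * p m by (auto intro: dvd_trans)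
    have "multiplicity p (p ^ i * e) = i" "multiplicity p (p ^ i' * e') = i'"
      using e p(1) by (auto simp: prime_elem_multiplicity_mult_distrib not_dvd_imp_multiplicity_0)
    with * have "i = i'" by simp
    thus "i = i' \<and> e = e'" using * p0 by simp
  qed
  have "(\<Sum>d | d dvd p ^ j * m. a d) = (\<Sum>(i,e)\<in>{..j} \<times> {e. e dvd m}. a (p ^ i * e))"
    unfolding img by (subst sum.reindex[OF inj]) (simp add: case_prod_unfold)
  also have "\<dots> = (\<Sum>(i,e)\<in>{..j} \<times> {e. e dvd m}. a p ^ i * a e)"
  proof (rule sum.cong)
    fix x assume "x \<in> {..j} \<times> {e. e dvd m}"
    then obtain i e where x: "x = (i, e)" "e > 0" using m by (auto intro: Nat.gr0I)
    have "a (p ^ i * e) = a (p ^ i) * a e" using x p0 by (intro sgn_multD(2)[OF a]) auto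
    thus "(case x of (i, e) \<Rightarrow> a (p ^ i * e)) = (case x of (i, e) \<Rightarrow> a p ^ i * a e)"
      using x ap by simp
  qed auto
  also have "\<dots> = (\<Sum>i\<le>j. a p ^ i) * (\<Sum>d | d dvd m. a d)"
    by (simp add: sum_product sum.cartesian_product)
  finally show ?thesis .
qed

lemma prime_power_split:
  assumes "n > (1::nat)"
  obtains p j m where "prime p" "j > 0" "\<not> p dvd m" "m > 0" "n = p ^ j * m" "m < n"
proof -
  obtain p where p: "prime p" "p dvd n" using prime_factor_nat[of n] assms by auto
  have n0: "n \<noteq> 0" "\<not> is_unit p" using assms p by auto
  obtain m where m: "n = p ^ multiplicity p n * m" "\<not> p dvd m"
    using multiplicity_decompose'[OF n0] by blast
  have j: "multiplicity p n > 0" using p assms by (simp add: prime_multiplicity_gt_zero_iff)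
  have m0: "m > 0" using m assms by (auto intro: Nat.gr0I)
  have "p ^ multiplicity p n > 1" using one_less_power[OF prime_gt_1_nat[OF p(1)] j] .
  hence "1 * m < p ^ multiplicity p n * m" using m0 by (intro mult_strict_right_mono)
  hence "m < n" using m by simp
  thus thesis using that[of p "multiplicity p n" m] p j m m0 by blast
qed

lemma sum_real_char_nonneg:
  assumes a: "sgn_mult a" and n: "n > 0"
  shows "(\<Sum>d | d dvd n. a d) \<ge> 0"
  using n
proof (induction n rule: less_induct)
  case (less n)
  show ?case
  proof (cases "n = 1")
    case True thus ?thesis using sgn_multD(1)[OF a] by simp
  next
    case False
    then obtain p j m where pm: "prime p" "j > 0" "\<not> p dvd m" "m > 0" "n = p ^ j * m" "m < n"
      using prime_power_split[of n] less.prems by auto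
    have "(\<Sum>i\<le>j. a p ^ i) \<ge> 0"
    proof -
      have "a p = -1 \<or> a p \<ge> 0" using sgn_multD(4)[OF a, of p] by auto
      moreover have "(\<Sum>i\<le>j. (-1 :: real) ^ i) = (if even j then 1 else 0)" by (induction j) auto
      ultimately show ?thesis by (auto intro: sum_nonneg)
    qed
    thus ?thesis using less.IH[OF pm(6,4)] sum_real_char_prime_power[OF a pm(1,3,4), of j]
      by (simp add: pm(5))
  qed
qed

lemma sum_real_char_square:
  assumes a: "sgn_mult a" and n: "n > 0"
  shows "(\<Sum>d | d dvd n\<^sup>2. a d) \<ge> 1"
  using n
proof (induction n rule: less_induct)
  case (less n)
  show ?case
  proof (cases "n = 1")
    case True thus ?thesis using sgn_multD(1)[OF a] by simp
  next
    case False
    then obtain p j m where pm: "prime p" "j > 0" "\<not> p dvd m" "m > 0" "n = p ^ j * m" "m < n"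
      using prime_power_split[of n] less.prems by auto
    have "(\<Sum>i\<le>2 * j. a p ^ i) \<ge> 1"
    proof -
      \<comment> \<open>An odd power is paired with the even power after it: for a(p) = -1 each pair
        cancels, and otherwise nothing is negative.\<close>
      have "(\<Sum>i\<le>2 * j. a p ^ i) = 1 + (\<Sum>i<j. a p ^ (2 * i + 1) + a p ^ (2 * i + 2))"
        by (induction j) (auto simp: algebra_simps)
      moreover have "a p ^ (2 * i + 1) + a p ^ (2 * i + 2) \<ge> 0" for i
        using sgn_multD(4)[OF a, of p] by auto
      hence "(\<Sum>i<j. a p ^ (2 * i + 1) + a p ^ (2 * i + 2)) \<ge> 0" by (intro sum_nonneg) auto
      ultimately show ?thesis by linarith
    qed
    moreover have "n\<^sup>2 = p ^ (2 * j) * m\<^sup>2" by (simp add: pm(5) power_mult_distrib power_mult mult.commute)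
    moreover have "\<not> p dvd m\<^sup>2" using pm by (simp add: prime_dvd_power_iff)
    ultimately show ?thesis
      using less.IH[OF pm(6,4)] sum_real_char_prime_power[OF a pm(1) _ _, of "m\<^sup>2" "2 * j"] pm(4)
        mult_mono[of 1 "\<Sum>i\<le>2 * j. a p ^ i" 1 "\<Sum>d | d dvd m\<^sup>2. a d"] by simp
  qed
qed

text \<open>Monsky's proof that \<open>L(1, \<chi>) \<noteq> 0\<close>: if the sum vanished, the Lambert series
  \<open>\<Sum> a(n) x^n / (1 - x^n)\<close> would stay bounded as \<open>x\<close> tends to 1, while its power series
  coefficients are nonnegative and at least 1 at squares.\<close>

lemma geometric_sum_ge:
  fixes y :: real assumes "0 \<le> y"
  shows "(\<Sum>i<n. y ^ (2 * i)) \<ge> real n * y ^ (n - 1)"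
proof -
  have "(\<Sum>i<n. y ^ (2 * i)) = (\<Sum>i<n. y ^ (2 * (n - Suc i)))"
    using sum.nat_diff_reindex[of "\<lambda>i. y ^ (2 * i)" n] by simp
  \<comment> \<open>The exponents are paired symmetrically, and the arithmetic-geometric mean
    inequality is applied to each pair.\<close>
  hence "2 * (\<Sum>i<n. y ^ (2 * i)) = (\<Sum>i<n. y ^ (2 * i) + y ^ (2 * (n - Suc i)))"
    by (simp add: sum.distrib)
  also have "\<dots> \<ge> (\<Sum>i<n. 2 * y ^ (n - 1))"
  proof (rule sum_mono)
    fix i assume i: "i \<in> {..<n}"
    have "y ^ (n - 1) = y ^ i * y ^ (n - Suc i)" using i by (simp flip: power_add)
    moreover have "2 * (y ^ i * y ^ (n - Suc i)) \<le> (y ^ i)\<^sup>2 + (y ^ (n - Suc i))\<^sup>2"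
      using sum_squares_bound[of "y ^ i" "y ^ (n - Suc i)"] by (simp add: mult_ac)
    ultimately show "2 * y ^ (n - 1) \<le> y ^ (2 * i) + y ^ (2 * (n - Suc i))"
      by (simp add: power_mult[symmetric] mult.commute[of _ 2])
  qed
  finally show ?thesis by simp
qed

lemma Abel_bound:
  fixes a b :: "nat \<Rightarrow> real"
  assumes A: "\<And>n. \<bar>\<Sum>i=1..n. a i\<bar> \<le> C" and dec: "\<And>n. n \<ge> 1 \<Longrightarrow> b (Suc n) \<le> b n" and nn: "\<And>n. n \<ge> 1 \<Longrightarrow> b n \<ge> 0"
    and N: "N \<ge> 1"
  shows "\<bar>\<Sum>n=1..N. a n * b n\<bar> \<le> C * b 1"
proof -
  define A' where "A' = (\<lambda>n. \<Sum>i=1..n. a i)"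
  have eq: "(\<Sum>n=1..N. a n * b n) = A' N * b N + (\<Sum>n=1..<N. A' n * (b n - b (Suc n)))"
    using N by (induction N rule: dec_induct) (simp_all add: A'_def algebra_simps)
  have tel: "(\<Sum>n=1..<N. C * (b n - b (Suc n))) = C * (b 1 - b N)"
    using N by (induction N rule: dec_induct) (simp_all add: algebra_simps)
  have "\<bar>\<Sum>n=1..<N. A' n * (b n - b (Suc n))\<bar> \<le> (\<Sum>n=1..<N. C * (b n - b (Suc n)))"
  proof (rule order_trans[OF sum_abs sum_mono])
    fix n assume "n \<in> {1..<N}"
    thus "\<bar>A' n * (b n - b (Suc n))\<bar> \<le> C * (b n - b (Suc n))"
      using A[of n] dec[of n] unfolding A'_def abs_mult by (intro mult_mono) auto
  qed
  moreover have "\<bar>A' N * b N\<bar> \<le> C * b N"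
    using A[of N] nn[OF N] unfolding A'_def abs_mult by (intro mult_mono) auto
  ultimately have "\<bar>\<Sum>n=1..N. a n * b n\<bar> \<le> C * b N + C * (b 1 - b N)"
    unfolding eq tel by linarith
  thus ?thesis by (simp add: algebra_simps)
qed

text \<open>Multiplied by 1 - x, the Lambert terms differ from 1/n by \<open>b n\<close>, and \<Sum>
  a(n)/n is 0 by assumption. As \<open>b\<close> is nonnegative and decreasing, Abel summation
  bounds the rest by C b(1) = C(1 - x), whose factor 1 - x cancels.\<close>

lemma Lambert_bound:
  fixes x :: real
  assumes a: "sgn_mult a" and C: "\<And>n. \<bar>\<Sum>i=1..n. a i\<bar> \<le> C"
    and L: "(\<lambda>n. a (Suc n) / real (Suc n)) sums 0" and x: "0 < x" "x < 1"
  shows "(\<Sum>m=1..M. x ^ (m\<^sup>2)) \<le> C"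
proof -
  define S where "S = (\<lambda>n. \<Sum>i<n. x ^ i)"
  define b where "b = (\<lambda>n. 1 / real n - x ^ n / S n)"
  have S: "S n = (1 - x ^ n) / (1 - x)" for n
    using x by (simp add: S_def sum_gp_strict)
  have xn: "x ^ n < 1" if "n \<ge> 1" for n using x that by (simp add: power_less_one_iff)
  have Spos: "S n > 0" if "n \<ge> 1" for n using xn[OF that] x by (simp add: S)
  \<comment> \<open>A square root of x, so that the bound S(n) \<ge> n x^((n-1)/2) can be written
    with natural exponents. This bound is what makes \<open>b\<close> nonnegative and
    decreasing.\<close>
  define y where "y = sqrt x"
  have y: "0 < y" "y < 1" "y\<^sup>2 = x" using x by (simp_all add: y_def)
  have Sge: "S n \<ge> real n * y ^ (n - 1)" for n
    using geometric_sum_ge[of y n] y by (simp add: S_def power_mult)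
  have nn: "b n \<ge> 0" if n: "n \<ge> 1" for n
  proof -
    have "y ^ (2 * n) \<le> y ^ (n - 1)" using y by (intro power_decreasing) auto
    hence "real n * x ^ n \<le> real n * y ^ (n - 1)" using y by (intro mult_left_mono) (auto simp: power_mult)
    hence "real n * x ^ n \<le> S n" using Sge[of n] by linarith
    thus ?thesis using Spos[OF n] n by (simp add: b_def field_simps)
  qed
  have dec: "b (Suc n) \<le> b n" if n: "n \<ge> 1" for n
  proof -
    have pos: "S n > 0" "S (Suc n) > 0" using Spos n by auto
    have "(real n * y ^ (n - 1)) * (real (Suc n) * y ^ n) \<le> S n * S (Suc n)"
      using Sge[of n] Sge[of "Suc n"] y pos by (intro mult_mono) auto
    moreover have "(real n * y ^ (n - 1)) * (real (Suc n) * y ^ n) = (real n * real (Suc n)) * y ^ (2 * n - 1)"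
    proof -
      have "y ^ (n - 1) * y ^ n = y ^ (n - 1 + n)" by (rule power_add[symmetric])
      also have "n - 1 + n = 2 * n - 1" using n by simp
      finally show ?thesis by (simp only: mult_ac)
    qed
    moreover have "y ^ (2 * n) \<le> y ^ (2 * n - 1)" using y by (intro power_decreasing) auto
    hence "(real n * real (Suc n)) * x ^ n \<le> (real n * real (Suc n)) * y ^ (2 * n - 1)"
      using y by (intro mult_left_mono) (auto simp: power_mult)
    ultimately have le: "(real n * real (Suc n)) * x ^ n \<le> S n * S (Suc n)" by linarith
    have S1: "S (Suc n) = 1 + x * S n" using x by (simp add: S field_simps)
    have "x ^ n / S n - x ^ Suc n / S (Suc n) = x ^ n * (S (Suc n) - x * S n) / (S n * S (Suc n))"
      using pos by (simp add: field_simps)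
    also have "\<dots> = x ^ n / (S n * S (Suc n))" by (simp add: S1)
    also have "\<dots> \<le> 1 / (real n * real (Suc n))"
    proof -
      have Q: "real n * real (Suc n) > 0" using n by simp
      have "x ^ n \<le> (S n * S (Suc n)) / (real n * real (Suc n))"
        using le by (subst pos_le_divide_eq[OF Q]) (simp only: mult.commute)
      hence "x ^ n / (S n * S (Suc n)) \<le> (S n * S (Suc n)) / (real n * real (Suc n)) / (S n * S (Suc n))"
        using pos by (intro divide_right_mono) auto
      also have "\<dots> = 1 / (real n * real (Suc n))" using pos by simp
      finally show ?thesis .
    qed
    also have "\<dots> = 1 / real n - 1 / real (Suc n)" using n by (simp add: field_simps)
    finally show ?thesis by (simp add: b_def)
  qed
  have b1: "b 1 = 1 - x" by (simp add: b_def S_def)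
  have Abel: "\<bar>\<Sum>n=1..N. a n * b n\<bar> \<le> C * (1 - x)" if "N \<ge> 1" for N
    using Abel_bound[of a C b N] C dec nn that b1 by simp
  define Lam where "Lam = (\<lambda>N. \<Sum>n=1..N. a n * (x ^ n / (1 - x ^ n)))"
  have Lam: "Lam N \<le> (\<Sum>n=1..N. a n / real n) / (1 - x) + C" if N: "N \<ge> 1" for N
  proof -
    have "Lam N * (1 - x) = (\<Sum>n=1..N. a n / real n - a n * b n)"
      unfolding Lam_def sum_distrib_right
    proof (rule sum.cong)
      fix n assume n: "n \<in> {1..N}"
      thus "a n * (x ^ n / (1 - x ^ n)) * (1 - x) = a n / real n - a n * b n"
        using xn[of n] x by (simp add: b_def S field_simps)
    qed auto
    also have "\<dots> = (\<Sum>n=1..N. a n / real n) - (\<Sum>n=1..N. a n * b n)" by (rule sum_subtractf)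
    also have "\<dots> \<le> (\<Sum>n=1..N. a n / real n) + C * (1 - x)" using Abel[OF N] by linarith
    finally show ?thesis using x by (simp add: field_simps)
  qed
  define R where "R = (\<lambda>N. \<Sum>k=1..N. (\<Sum>d | d dvd k. a d) * x ^ k)"
  have R1: "R N = (\<Sum>n=1..N. a n * (\<Sum>j=1..N div n. x ^ (n * j)))" for N
  proof -
    have R0: "R N = (\<Sum>(k,d)\<in>(SIGMA k:{1..N}. {d. d dvd k}). a d * x ^ k)"
      unfolding R_def sum_distrib_right by (subst sum.Sigma) auto
    have le1: "b \<le> N" if "b * k \<le> N" "0 < k" for b k :: nat
    proof -
      have "b \<le> b * k" using that(2) by (cases k) auto
      also note that(1)
      finally show ?thesis .
    qed
    have "(\<Sum>(k,d)\<in>(SIGMA k:{1..N}. {d. d dvd k}). a d * x ^ k)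
        = (\<Sum>(n,j)\<in>(SIGMA n:{1..N}. {1..N div n}). a n * x ^ (n * j))"
      by (rule sum.reindex_bij_witness[of _ "\<lambda>(n,j). (n * j, n)" "\<lambda>(k,d). (d, k div d)"])
         (auto simp: div_le_mono div_greater_zero_iff less_eq_div_iff_mult_less_eq Suc_le_eq mult.commute dvd_imp_le
           dest: le1 intro: Nat.gr0I elim!: dvdE)
    also have "\<dots> = (\<Sum>n=1..N. a n * (\<Sum>j=1..N div n. x ^ (n * j)))"
      unfolding sum_distrib_left by (subst sum.Sigma) auto
    finally show ?thesis using R0 by simp
  qed
  \<comment> \<open>Truncating the geometric series of \<open>a n\<close> at \<open>N div n\<close>
    costs at most x^N / (1 - x), hence N x^N / (1 - x) in total, which tends to 0 for fixed
    x.\<close>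
  have RLam: "R N \<le> Lam N + real N * x ^ N / (1 - x)" for N
  proof -
    have "R N - Lam N = (\<Sum>n=1..N. a n * ((\<Sum>j=1..N div n. x ^ (n * j)) - x ^ n / (1 - x ^ n)))"
      unfolding R1 Lam_def by (simp add: sum_subtractf right_diff_distrib)
    also have "\<dots> \<le> (\<Sum>n=1..N. x ^ N / (1 - x))"
    proof (rule sum_mono)
      fix n assume n: "n \<in> {1..N}"
      define J where "J = N div n"
      have q: "x ^ n < 1" "0 < x ^ n" using xn[of n] n x by auto
      have "(\<Sum>j=1..J. (x ^ n) ^ j) = (x ^ n - (x ^ n) ^ Suc J) / (1 - x ^ n)"
        using q sum_gp[of "x ^ n" 1 J] by (cases "J = 0") auto
      hence "(\<Sum>j=1..J. x ^ (n * j)) - x ^ n / (1 - x ^ n) = - ((x ^ n) ^ Suc J / (1 - x ^ n))"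
        using q by (simp add: power_mult diff_divide_distrib)
      hence "\<bar>(\<Sum>j=1..J. x ^ (n * j)) - x ^ n / (1 - x ^ n)\<bar> = x ^ (n * Suc J) / (1 - x ^ n)"
        using q by (simp add: power_mult power_add)
      also have "\<dots> \<le> x ^ N / (1 - x)"
      proof (rule frac_le)
        have "N < n * Suc J" using n dividend_less_times_div[of n N] by (simp add: J_def)
        thus "x ^ (n * Suc J) \<le> x ^ N" using x by (intro power_decreasing) auto
        have "x ^ n \<le> x ^ 1" using x n by (intro power_decreasing) auto
        thus "1 - x \<le> 1 - x ^ n" by simp
      qed (use x in auto)
      finally have "\<bar>(\<Sum>j=1..J. x ^ (n * j)) - x ^ n / (1 - x ^ n)\<bar> \<le> x ^ N / (1 - x)" .
      hence "\<bar>a n * ((\<Sum>j=1..J. x ^ (n * j)) - x ^ n / (1 - x ^ n))\<bar> \<le> 1 * (x ^ N / (1 - x))"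
        unfolding abs_mult using sgn_multD(3)[OF a] by (intro mult_mono) auto
      thus "a n * ((\<Sum>j=1..N div n. x ^ (n * j)) - x ^ n / (1 - x ^ n)) \<le> x ^ N / (1 - x)"
        by (simp add: J_def)
    qed
    finally show ?thesis by simp
  qed
  have sq: "(\<Sum>m=1..M. x ^ (m\<^sup>2)) \<le> R N" if N: "N \<ge> M\<^sup>2" for N
  proof -
    have inj: "inj_on (\<lambda>m::nat. m\<^sup>2) {1..M}" by (auto simp: inj_on_def)
    have "(\<Sum>m=1..M. x ^ (m\<^sup>2)) = (\<Sum>k\<in>(\<lambda>m. m\<^sup>2) ` {1..M}. x ^ k)"
      using inj by (simp add: sum.reindex)
    also have "\<dots> \<le> (\<Sum>k\<in>(\<lambda>m. m\<^sup>2) ` {1..M}. (\<Sum>d | d dvd k. a d) * x ^ k)"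
    proof (rule sum_mono)
      fix k assume "k \<in> (\<lambda>m. m\<^sup>2) ` {1..M}"
      then obtain m where "k = m\<^sup>2" "m > 0" by auto
      hence "(\<Sum>d | d dvd k. a d) \<ge> 1" using sum_real_char_square[OF a] by simp
      thus "x ^ k \<le> (\<Sum>d | d dvd k. a d) * x ^ k" using x by simp
    qed
    also have "\<dots> \<le> R N"
      unfolding R_def
    proof (rule sum_mono2)
      show "(\<lambda>m. m\<^sup>2) ` {1..M} \<subseteq> {1..N}"
      proof
        fix k assume "k \<in> (\<lambda>m. m\<^sup>2) ` {1..M}"
        then obtain m where m: "k = m\<^sup>2" "Suc 0 \<le> m" "m \<le> M" by auto
        have "m\<^sup>2 \<le> M\<^sup>2" using m by (intro power_mono) auto
        also note N
        finally show "k \<in> {1..N}" using m by (auto simp: Suc_le_eq)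
      qed
    qed (use sum_real_char_nonneg[OF a] x in auto)
    finally show ?thesis .
  qed
  have lim: "(\<lambda>N. (\<Sum>n=1..N. a n / real n) / (1 - x) + C + real N * x ^ N / (1 - x)) \<longlonglongrightarrow> 0 / (1 - x) + C + 0 / (1 - x)"
  proof (intro tendsto_intros)
    have "(\<lambda>N. \<Sum>n<N. a (Suc n) / real (Suc n)) \<longlonglongrightarrow> 0" using L by (simp add: sums_def)
    moreover have "(\<Sum>n<N. a (Suc n) / real (Suc n)) = (\<Sum>n=1..N. a n / real n)" for N
      by (induction N) auto
    ultimately show "(\<lambda>N. \<Sum>n=1..N. a n / real n) \<longlonglongrightarrow> 0" by simp
    show "(\<lambda>N. real N * x ^ N) \<longlonglongrightarrow> 0" using x by (intro powser_times_n_limit_0) auto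
  qed (use x in auto)
  have "(\<Sum>m=1..M. x ^ (m\<^sup>2)) \<le> 0 / (1 - x) + C + 0 / (1 - x)"
  proof (rule LIMSEQ_le_const[OF lim], intro exI allI impI)
    fix N assume "max 1 (M\<^sup>2) \<le> N"
    thus "(\<Sum>m=1..M. x ^ (m\<^sup>2)) \<le> (\<Sum>n=1..N. a n / real n) / (1 - x) + C + real N * x ^ N / (1 - x)"
      using sq[of N] RLam[of N] Lam[of N] by simp
  qed
  thus ?thesis by simp
qed

lemma L_one_nonzero:
  assumes a: "sgn_mult a" and C: "\<And>n. \<bar>\<Sum>i=1..n. a i\<bar> \<le> C"
  shows "\<not> (\<lambda>n. a (Suc n) / real (Suc n)) sums 0"
proof
  assume L: "(\<lambda>n. a (Suc n) / real (Suc n)) sums 0"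
  obtain M :: nat where M: "real M > max 1 (2 * C)" using reals_Archimedean2 by blast
  \<comment> \<open>Chosen so that x^(M^2) = 1/2. Each of the first M squares then contributes at
    least 1/2, and M/2 exceeds \<open>C\<close>.\<close>
  define x where "x = root (M\<^sup>2) (1/2)"
  have M0: "M\<^sup>2 > 0" using M by auto
  have x: "0 < x" "x < 1" using M0 by (auto simp: x_def)
  have xM: "x ^ (M\<^sup>2) = 1/2" unfolding x_def using M0 by (intro real_root_pow_pos) auto
  have "real M * (1/2) = (\<Sum>m=1..M. x ^ (M\<^sup>2))" by (simp add: xM)
  also have "\<dots> \<le> (\<Sum>m=1..M. x ^ (m\<^sup>2))"
    using x by (intro sum_mono power_decreasing power_mono) auto
  also have "\<dots> \<le> C" by (rule Lambert_bound[OF a C L x])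
  finally show False using M by simp
qed

lemma continuation_entire:
  assumes a: "sgn_mult a" and C: "\<And>n. \<bar>\<Sum>i=1..n. a i\<bar> \<le> C"
  shows "\<exists>H. continuation a 0 H"
proof -
  define E where "E = (\<lambda>N. (\<Sum>n=1..N. a n))"
  have C0: "C \<ge> 0" using C[of 0] by simp
  obtain T where T: "T holomorphic_on {s. Re s > 0}" "\<And>s. Re s \<ge> 1/2 \<Longrightarrow> cmod (T s) \<le> 3 * C * (1 + cmod s)\<^sup>2"
    "\<And>s. Re s > 1 \<Longrightarrow> (\<lambda>n. of_real (E (Suc n) - E n) * of_nat (Suc n) powr (-s)) sums T s"
    "(\<lambda>n. of_real (E (Suc n)) * (1 / of_nat (Suc n) - 1 / of_nat (Suc (Suc n)))) sums T 1"
    by (rule summation_continuation[of E C]) (use C in \<open>auto simp: E_def\<close>)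
  have bd: "cmod (T s) \<le> (3 * C + 1) * (1 + cmod s) ^ 3" if s: "Re s \<ge> 1/2" for s
  proof -
    have "cmod (T s) \<le> 3 * C * (1 + cmod s) ^ 3" by (rule cube_bound[OF T(2)[OF s]]) (use C0 in auto)
    also have "\<dots> \<le> (3 * C + 1) * (1 + cmod s) ^ 3" by (intro mult_right_mono) auto
    finally show ?thesis .
  qed
  have eq: "T s = (s - 1) ^ 0 * dser a s" if s: "Re s > 1" for s
  proof -
    have "T s = dser a s"
      by (rule sums_unique2[OF T(3)[OF s]])
         (use dser_Suc_sums[OF sgn_multD(3)[OF a] s] in \<open>simp add: E_def\<close>)
    thus ?thesis by simp
  qed
  have "T 1 \<noteq> 0"
  proof
    assume T0: "T 1 = 0"
    \<comment> \<open>Adding the increments of this null sequence, whose sum is 0, undoes the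
      summation by parts and turns the series for \<open>T 1\<close> into \<Sum> a(n)/n.\<close>
    define g where "g = (\<lambda>n. E n / real (Suc n))"
    have "g \<longlonglongrightarrow> 0"
    proof (rule tendsto_rabs_zero_cancel, rule tendsto_sandwich[of "\<lambda>_. 0" _ _ "\<lambda>n. C / real (Suc n)"])
      show "\<forall>\<^sub>F n in sequentially. \<bar>g n\<bar> \<le> C / real (Suc n)"
        using C by (intro always_eventually allI) (auto simp: g_def E_def intro!: divide_right_mono)
      show "(\<lambda>n. C / real (Suc n)) \<longlonglongrightarrow> 0" by real_asymp
    qed auto
    from telescope_sums[OF this] have "(\<lambda>n. g (Suc n) - g n) sums 0" by (simp add: g_def E_def)
    moreover have "(\<lambda>n. Re (of_real (E (Suc n)) * (1 / of_nat (Suc n) - 1 / of_nat (Suc (Suc n))))) sums Re 0"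
      using T(4) unfolding T0 by (rule sums_Re)
    hence "(\<lambda>n. E (Suc n) * (1 / real (Suc n) - 1 / real (Suc (Suc n)))) sums 0"
      by (simp del: of_nat_Suc add: Re_divide_of_nat)
    ultimately have "(\<lambda>n. E (Suc n) * (1 / real (Suc n) - 1 / real (Suc (Suc n))) + (g (Suc n) - g n)) sums 0"
      using sums_add by fastforce
    moreover have "E (Suc n) * (1 / real (Suc n) - 1 / real (Suc (Suc n))) + (g (Suc n) - g n) = a (Suc n) / real (Suc n)" for n
      by (simp add: g_def E_def algebra_simps add_divide_distrib diff_divide_distrib del: of_nat_Suc)
    ultimately have "(\<lambda>n. a (Suc n) / real (Suc n)) sums 0" by (simp only:)
    thus False using L_one_nonzero[OF a C] by blast
  qed
  moreover have "3 * C + 1 > 0" using C0 by simp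
  ultimately have "continuation a 0 T"
    unfolding continuation_def using T(1) bd eq by (intro conjI exI[of _ "3 * C + 1"]) auto
  thus ?thesis by blast
qed

subsection \<open>The zero-free region\<close>

text \<open>The shift by 3 > e makes \<open>ell\<close> at least 1 everywhere, including t =
  0.\<close>

definition ell :: "real \<Rightarrow> real" where "ell t = ln (\<bar>t\<bar> + 3)"

lemma ell_ge_1: "ell t \<ge> 1"
proof -
  have "exp 1 \<le> \<bar>t\<bar> + 3" using exp_le by linarith
  hence "ln (exp 1) \<le> ln (\<bar>t\<bar> + 3)" by (subst ln_le_cancel_iff) auto
  thus ?thesis by (simp add: ell_def)
qed

lemma exp_ell: "exp (ell t) = \<bar>t\<bar> + 3"
  by (simp add: ell_def)

lemma ell_mono: "\<bar>t\<bar> \<le> \<bar>u\<bar> \<Longrightarrow> ell t \<le> ell u"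
  by (simp add: ell_def)

lemma ell_double:
  assumes "\<bar>u\<bar> \<le> 2 * \<bar>t\<bar> + 1" shows "ell u \<le> 2 * ell t"
proof -
  have "\<bar>u\<bar> + 3 \<le> (\<bar>t\<bar> + 3)\<^sup>2"
  proof -
    have "(\<bar>t\<bar> + 3)\<^sup>2 = \<bar>t\<bar>\<^sup>2 + 6 * \<bar>t\<bar> + 9" by (simp add: power2_eq_square algebra_simps)
    thus ?thesis using assms zero_le_power2[of "\<bar>t\<bar>"] abs_ge_zero[of t] by linarith
  qed
  hence "ell u \<le> ln ((\<bar>t\<bar> + 3)\<^sup>2)" by (simp add: ell_def)
  also have "\<dots> = 2 * ell t" unfolding ell_def by (subst ln_realpow) auto
  finally show ?thesis .
qed

lemma continuation_eq:
  assumes "continuation b d H" "Re s > 1"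
  shows "H s = (s - 1) ^ d * dser b s"
  using assms by (auto simp: continuation_def)

lemma continuation_nonzero:
  assumes "continuation b d H" "sgn_mult b" "Re s > 1"
  shows "H s \<noteq> 0"
  using continuation_eq[OF assms(1,3)] dser_nonzero[OF assms(2,3)] assms(3) by auto

lemma continuation_log_deriv:
  assumes H: "continuation b d H" and b: "sgn_mult b" and s: "Re s > 1"
  shows "deriv (dser b) s / dser b s = deriv H s / H s - of_nat d / (s - 1)"
proof -
  have s1: "s - 1 \<noteq> 0" using s by auto
  define S where "S = {s :: complex. Re s > 1}"
  have S: "open S" "s \<in> S" unfolding S_def using s by (auto intro: open_halfspace_Re_gt)
  have db: "(dser b has_field_derivative deriv (dser b) s) (at s)"
    using dser_deriv[of b s, OF sgn_multD(3)[OF b] s] by (simp add: DERIV_imp_deriv)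
  have "d = 0 \<or> d = 1" using H by (auto simp: continuation_def)
  thus ?thesis
  proof
    assume d: "d = 0"
    have "(H has_field_derivative deriv (dser b) s) (at s)"
      by (rule has_field_derivative_transform_within_open[OF db S]) (use continuation_eq[OF H] d in \<open>auto simp: S_def\<close>)
    thus ?thesis using d continuation_eq[OF H s] by (simp add: DERIV_imp_deriv)
  next
    assume d: "d = 1"
    have "((\<lambda>s. (s - 1) * dser b s) has_field_derivative (dser b s + (s - 1) * deriv (dser b) s)) (at s)"
      by (rule derivative_eq_intros refl db)+ simp
    hence "(H has_field_derivative (dser b s + (s - 1) * deriv (dser b) s)) (at s)"
      by (rule has_field_derivative_transform_within_open[OF _ S]) (use continuation_eq[OF H] d in \<open>auto simp: S_def\<close>)
    hence dH: "deriv H s = dser b s + (s - 1) * deriv (dser b) s" by (rule DERIV_imp_deriv)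
    have HL: "H s = (s - 1) * dser b s" using continuation_eq[OF H s] d by simp
    have fr: "L' / L = (L + w * L') / (w * L) - 1 / w" if "w \<noteq> 0" "L \<noteq> 0" for w L L' :: complex
      using that by (simp add: field_simps)
    show ?thesis
      unfolding dH HL using fr[OF s1 dser_nonzero[OF b s], of "deriv (dser b) s"] d by (simp only: of_nat_1)
  qed
qed

lemma continuation_upper:
  assumes H: "continuation b d H"
  obtains K where "K > 0" "\<And>z t. Re z \<ge> 1/2 \<Longrightarrow> cmod z \<le> \<bar>t\<bar> + 5/2 \<Longrightarrow> cmod (H z) < K * (\<bar>t\<bar> + 3) ^ 3"
proof -
  obtain K where K: "K > 0" "\<And>s. Re s \<ge> 1/2 \<Longrightarrow> cmod (H s) \<le> K * (1 + cmod s) ^ 3"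
    using H by (auto simp: continuation_def)
  show thesis
  proof (rule that[of "9 * K"])
    fix z t assume z: "Re z \<ge> 1/2" "cmod z \<le> \<bar>t\<bar> + 5/2"
    have "(1 + cmod z) ^ 3 \<le> (2 * (\<bar>t\<bar> + 3)) ^ 3" using z by (intro power_mono) auto
    hence "K * (1 + cmod z) ^ 3 \<le> K * (2 * (\<bar>t\<bar> + 3)) ^ 3" using K(1) by (intro mult_left_mono) auto
    hence "cmod (H z) \<le> K * (2 * (\<bar>t\<bar> + 3)) ^ 3" using K(2)[OF z(1)] by linarith
    also have "\<dots> = 8 * K * (\<bar>t\<bar> + 3) ^ 3" by (simp only: power_mult_distrib) simp
    also have "\<dots> < 9 * K * (\<bar>t\<bar> + 3) ^ 3" using K(1) by (intro mult_strict_right_mono) auto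
    finally show "cmod (H z) < 9 * K * (\<bar>t\<bar> + 3) ^ 3" .
  qed (use K in auto)
qed

text \<open>One factor \<sigma> - 1 is the price of (s - 1)^d for d = 1; the other comes from
  \<open>norm_dser_ge\<close>, where the denominator is at most 2.\<close>

lemma continuation_lower:
  assumes H: "continuation b d H" and b: "sgn_mult b" and \<sigma>: "1 < \<sigma>" "\<sigma> \<le> 2"
  shows "cmod (H (Complex \<sigma> t)) \<ge> (\<sigma> - 1)\<^sup>2 / 2"
proof -
  define s where "s = Complex \<sigma> t"
  have s: "Re s = \<sigma>" by (simp add: s_def)
  have "\<sigma> - 1 \<le> cmod (s - 1)" using abs_Re_le_cmod[of "s - 1"] s \<sigma> by simp
  hence "(\<sigma> - 1) ^ d \<le> cmod (s - 1) ^ d" using \<sigma> by (intro power_mono) auto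
  moreover have "(\<sigma> - 1) ^ 1 \<le> (\<sigma> - 1) ^ d"
    using H \<sigma> by (intro power_decreasing) (auto simp: continuation_def)
  ultimately have 1: "\<sigma> - 1 \<le> cmod (s - 1) ^ d" by simp
  have "(\<sigma> - 1) / 2 \<le> (\<sigma> - 1) / \<sigma>" using \<sigma> by (intro divide_left_mono) auto
  also have "\<dots> \<le> cmod (dser b s)" using norm_dser_ge[OF b, of s] s \<sigma> by simp
  finally have "(\<sigma> - 1) * ((\<sigma> - 1) / 2) \<le> cmod (s - 1) ^ d * cmod (dser b s)"
    using 1 \<sigma> by (intro mult_mono) auto
  also have "\<dots> = cmod (H s)" using continuation_eq[OF H, of s] s \<sigma> by (simp add: norm_mult norm_power)
  finally show ?thesis by (simp add: s_def power2_eq_square)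
qed

lemma ln_ratio_bound:
  assumes K: "K > 0" and h: "h \<ge> x\<^sup>2 / 2" and x: "0 < x" "x \<le> 1"
  shows "ln (K * (\<bar>t\<bar> + 3) ^ 3 / h) \<le> \<bar>ln (2 * K)\<bar> + 3 * ell t + 2 * ln (1 / x)"
proof -
  have h0: "h > 0" using h x by (smt (verit) half_gt_zero zero_less_power)
  have "K * (\<bar>t\<bar> + 3) ^ 3 / h \<le> K * (\<bar>t\<bar> + 3) ^ 3 / (x\<^sup>2 / 2)"
    using h h0 x K by (intro divide_left_mono) auto
  hence "ln (K * (\<bar>t\<bar> + 3) ^ 3 / h) \<le> ln (K * (\<bar>t\<bar> + 3) ^ 3 / (x\<^sup>2 / 2))"
    using K h0 x by (subst ln_le_cancel_iff) auto
  also have "K * (\<bar>t\<bar> + 3) ^ 3 / (x\<^sup>2 / 2) = (2 * K) * (\<bar>t\<bar> + 3) ^ 3 * (1 / x)\<^sup>2"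
    by (simp add: power_divide)
  also have "ln \<dots> = ln (2 * K) + ln ((\<bar>t\<bar> + 3) ^ 3) + ln ((1 / x)\<^sup>2)"
    using K x by (subst ln_mult_pos; simp add: ln_mult_pos)
  also have "ln ((\<bar>t\<bar> + 3) ^ 3) = 3 * ell t" unfolding ell_def by (subst ln_realpow) auto
  also have "ln ((1 / x)\<^sup>2) = 2 * ln (1 / x)" using x by (subst ln_realpow) auto
  finally show ?thesis by linarith
qed

text \<open>Applies the disc estimates with radius 1/2 around \<sigma> + it. The disc stays in Re z
  \<ge> 1/2, where \<open>H\<close> has polynomial growth, and its zeros lie to the left of the
  centre because there are none with real part above 1.\<close>

lemma neg_log_deriv_bounds:
  assumes H: "continuation b d H" and b: "sgn_mult b"
  obtains A where "A \<ge> 1"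
    "\<And>\<sigma> t. 1 < \<sigma> \<Longrightarrow> \<sigma> \<le> 3/2 \<Longrightarrow>
       - Re (deriv H (Complex \<sigma> t) / H (Complex \<sigma> t)) \<le> A * (ell t + ln (1 / (\<sigma> - 1)))"
    "\<And>\<sigma> t \<beta>. 1 < \<sigma> \<Longrightarrow> \<sigma> \<le> 3/2 \<Longrightarrow> H (Complex \<beta> t) = 0 \<Longrightarrow> \<beta> < \<sigma> \<Longrightarrow> \<sigma> - \<beta> < 1/2 \<Longrightarrow>
       - Re (deriv H (Complex \<sigma> t) / H (Complex \<sigma> t)) \<le> A * (ell t + ln (1 / (\<sigma> - 1))) - 1 / (\<sigma> - \<beta>) + 2"
proof -
  obtain K where K: "K > 0" "\<And>z t. Re z \<ge> 1/2 \<Longrightarrow> cmod z \<le> \<bar>t\<bar> + 5/2 \<Longrightarrow> cmod (H z) < K * (\<bar>t\<bar> + 3) ^ 3"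
    by (rule continuation_upper[OF H]) blast
  \<comment> \<open>The factor 8 is 4/r for the radius r = 1/2.\<close>
  define A where "A = 8 * (\<bar>ln (2 * K)\<bar> + 3)"
  have hol: "H holomorphic_on {s. Re s > 0}" using H by (simp add: continuation_def)
  have op: "open {s :: complex. Re s > 0}" by (rule open_halfspace_Re_gt)
  have disc: "cball (Complex \<sigma> t) (1/2) \<subseteq> {s. Re s > 0}"
    and bd: "\<And>z. z \<in> cball (Complex \<sigma> t) (1/2) \<Longrightarrow> cmod (H z) < K * (\<bar>t\<bar> + 3) ^ 3"
    and zer: "\<And>z. z \<in> cball (Complex \<sigma> t) (1/2) \<Longrightarrow> H z = 0 \<Longrightarrow> Re z \<le> Re (Complex \<sigma> t)"
    and nz: "H (Complex \<sigma> t) \<noteq> 0"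
    and L: "4 * ln (K * (\<bar>t\<bar> + 3) ^ 3 / cmod (H (Complex \<sigma> t))) / (1/2) \<le> A * (ell t + ln (1 / (\<sigma> - 1)))"
    if \<sigma>: "1 < \<sigma>" "\<sigma> \<le> 3/2" for \<sigma> t
  proof -
    have near: "Re z \<ge> 1/2" "cmod z \<le> \<bar>t\<bar> + 5/2" if "z \<in> cball (Complex \<sigma> t) (1/2)" for z
    proof -
      have d: "cmod (Complex \<sigma> t - z) \<le> 1/2" using that by (simp add: dist_norm)
      show "Re z \<ge> 1/2" using abs_Re_le_cmod[of "Complex \<sigma> t - z"] d \<sigma> by (simp; linarith)
      have "cmod (Complex \<sigma> t) \<le> \<bar>\<sigma>\<bar> + \<bar>t\<bar>" using cmod_le[of "Complex \<sigma> t"] by simp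
      moreover have "cmod z \<le> cmod (Complex \<sigma> t) + cmod (Complex \<sigma> t - z)"
        using norm_triangle_ineq4[of "Complex \<sigma> t" "Complex \<sigma> t - z"] by simp
      ultimately show "cmod z \<le> \<bar>t\<bar> + 5/2" using d \<sigma> by linarith
    qed
    show "cball (Complex \<sigma> t) (1/2) \<subseteq> {s. Re s > 0}" using near(1) by force
    show "cmod (H z) < K * (\<bar>t\<bar> + 3) ^ 3" if "z \<in> cball (Complex \<sigma> t) (1/2)" for z
      using K(2) near[OF that] by blast
    show "Re z \<le> Re (Complex \<sigma> t)" if "z \<in> cball (Complex \<sigma> t) (1/2)" "H z = 0" for z
      using continuation_nonzero[OF H b, of z] that \<sigma> by (cases "Re z > 1") auto
    show "H (Complex \<sigma> t) \<noteq> 0" using continuation_nonzero[OF H b] \<sigma> by simp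
    define l where "l = ln (1 / (\<sigma> - 1))"
    have l: "l \<ge> 0" unfolding l_def using \<sigma> by (intro ln_ge_zero) (simp add: field_simps)
    have "ln (K * (\<bar>t\<bar> + 3) ^ 3 / cmod (H (Complex \<sigma> t))) \<le> \<bar>ln (2 * K)\<bar> + 3 * ell t + 2 * l"
      unfolding l_def by (rule ln_ratio_bound[OF K(1) continuation_lower[OF H b]]) (use \<sigma> in auto)
    also have "\<dots> \<le> (\<bar>ln (2 * K)\<bar> + 3) * (ell t + l)"
    proof -
      have "\<bar>ln (2 * K)\<bar> * 1 \<le> \<bar>ln (2 * K)\<bar> * (ell t + l)"
        using ell_ge_1[of t] l by (intro mult_left_mono) auto
      thus ?thesis using l by (simp add: algebra_simps)
    qed
    finally have "8 * ln (K * (\<bar>t\<bar> + 3) ^ 3 / cmod (H (Complex \<sigma> t))) \<le> 8 * ((\<bar>ln (2 * K)\<bar> + 3) * (ell t + l))"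
      by (rule mult_left_mono) simp
    thus "4 * ln (K * (\<bar>t\<bar> + 3) ^ 3 / cmod (H (Complex \<sigma> t))) / (1/2) \<le> A * (ell t + ln (1 / (\<sigma> - 1)))"
      by (simp add: A_def l_def mult.assoc[symmetric])
  qed
  show thesis
  proof (rule that[of A])
    show "A \<ge> 1" by (simp add: A_def)
    show "- Re (deriv H (Complex \<sigma> t) / H (Complex \<sigma> t)) \<le> A * (ell t + ln (1 / (\<sigma> - 1)))"
      if "1 < \<sigma>" "\<sigma> \<le> 3/2" for \<sigma> t
    proof -
      have "- Re (deriv H (Complex \<sigma> t) / H (Complex \<sigma> t)) \<le> 4 * ln (K * (\<bar>t\<bar> + 3) ^ 3 / cmod (H (Complex \<sigma> t))) / (1/2)"
        by (rule neg_Re_log_deriv_le[OF hol op disc[OF that] _ bd[OF that] zer[OF that] nz[OF that]]) auto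
      thus ?thesis using L[OF that, of t] by linarith
    qed
    show "- Re (deriv H (Complex \<sigma> t) / H (Complex \<sigma> t)) \<le> A * (ell t + ln (1 / (\<sigma> - 1))) - 1 / (\<sigma> - \<beta>) + 2"
      if \<sigma>: "1 < \<sigma>" "\<sigma> \<le> 3/2" and \<beta>: "H (Complex \<beta> t) = 0" "\<beta> < \<sigma>" "\<sigma> - \<beta> < 1/2" for \<sigma> t \<beta>
    proof -
      have eq: "Complex \<sigma> t - of_real (\<sigma> - \<beta>) = Complex \<beta> t" by (simp add: complex_eq_iff)
      have "- Re (deriv H (Complex \<sigma> t) / H (Complex \<sigma> t))
          \<le> 4 * ln (K * (\<bar>t\<bar> + 3) ^ 3 / cmod (H (Complex \<sigma> t))) / (1/2) - 1 / (\<sigma> - \<beta>) + (\<sigma> - \<beta>) / (1/2)\<^sup>2"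
        by (rule neg_Re_log_deriv_le_zero[OF hol op disc[OF \<sigma>] _ bd[OF \<sigma>] zer[OF \<sigma>] nz[OF \<sigma>]]) (use \<beta> eq in auto)
      moreover have "(\<sigma> - \<beta>) / (1/2)\<^sup>2 \<le> 2" using \<beta> by (simp add: power2_eq_square)
      ultimately show ?thesis using L[OF \<sigma>, of t] by linarith
    qed
  qed
qed

text \<open>In the 3-4-1 inequality a zero \<beta> + it contributes -4/(\<sigma> - \<beta>) and the
  pole of zeta 3/(\<sigma> - 1). Discs of fixed radius add a multiple of ell t + log(1/(\<sigma> -
  1)), which is harmless for \<sigma> - 1 = lam / ell t with small lam. The poles at s = 1 of the
  other functions are controlled by keeping |t| away from 0.\<close>

lemma zero_free_region:
  assumes a: "sgn_mult a" and H: "continuation a d H"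
    and H2: "continuation (\<lambda>n. (a n)\<^sup>2) d2 H2" and Z: "continuation (\<lambda>_. 1) d1 Z"
  obtains c where "0 < c" "c \<le> 1/4" "\<And>s. Re s > 1 - c / ell (Im s) \<Longrightarrow> H s \<noteq> 0"
proof -
  obtain A1 where A1: "A1 \<ge> 1" "\<And>\<sigma> t. 1 < \<sigma> \<Longrightarrow> \<sigma> \<le> 3/2 \<Longrightarrow>
       - Re (deriv Z (Complex \<sigma> t) / Z (Complex \<sigma> t)) \<le> A1 * (ell t + ln (1 / (\<sigma> - 1)))"
    by (rule neg_log_deriv_bounds[OF Z sgn_mult_one]) blast
  obtain A2 where A2: "A2 \<ge> 1" "\<And>\<sigma> t \<beta>. 1 < \<sigma> \<Longrightarrow> \<sigma> \<le> 3/2 \<Longrightarrow> H (Complex \<beta> t) = 0 \<Longrightarrow> \<beta> < \<sigma> \<Longrightarrow> \<sigma> - \<beta> < 1/2 \<Longrightarrow>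
       - Re (deriv H (Complex \<sigma> t) / H (Complex \<sigma> t)) \<le> A2 * (ell t + ln (1 / (\<sigma> - 1))) - 1 / (\<sigma> - \<beta>) + 2"
    by (rule neg_log_deriv_bounds[OF H a]) blast
  obtain A3 where A3: "A3 \<ge> 1" "\<And>\<sigma> t. 1 < \<sigma> \<Longrightarrow> \<sigma> \<le> 3/2 \<Longrightarrow>
       - Re (deriv H2 (Complex \<sigma> t) / H2 (Complex \<sigma> t)) \<le> A3 * (ell t + ln (1 / (\<sigma> - 1)))"
    by (rule neg_log_deriv_bounds[OF H2 sgn_mult_square[OF a]]) blast
  have op: "open {s :: complex. Re s > 0}" by (rule open_halfspace_Re_gt)
  have "continuous_on {s. Re s > 0} H" using H by (auto simp: continuation_def holomorphic_on_imp_continuous_on)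
  hence "isCont H 1" using continuous_on_eq_continuous_at[OF op, of H] by simp
  moreover have "H 1 \<noteq> 0" using H by (simp add: continuation_def)
  ultimately obtain e where e: "e > 0" "\<And>z. dist 1 z < e \<Longrightarrow> H z \<noteq> 0"
    using continuous_at_avoid[of 1 H 0] by blast
  \<comment> \<open>Continuity of \<open>H\<close> at 1 keeps a neighbourhood free of zeros. It
    disposes of all |t| < \<open>t0\<close>, real zeros included, and beyond it the terms d/(s - 1)
    are at most 1/\<open>t0\<close>.\<close>
  define t0 where "t0 = min (e / 2) (1/4)"
  have t0: "0 < t0" "t0 \<le> 1/4" using e by (auto simp: t0_def)
  have nearone: "H z \<noteq> 0" if "cmod (z - 1) < 2 * t0" for z
    using e(2)[of z] that by (auto simp: t0_def dist_norm norm_minus_commute)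
  \<comment> \<open>Collects everything in the 3-4-1 inequality except the zero and the pole of
    zeta; the 2 at \<open>A3\<close> stems from evaluation at height 2t.\<close>
  define B where "B = 3 * A1 + 4 * A2 + 2 * A3 + 8 + 5 / t0"
  have B: "B \<ge> 1" using A1(1) A2(1) A3(1) t0 unfolding B_def by (smt (verit) divide_nonneg_pos)
  have "((\<lambda>x::real. B * (x * (2 + ln (1 / x)))) \<longlongrightarrow> B * 0) (at_right 0)"
    by (intro tendsto_mult tendsto_const) real_asymp
  hence "eventually (\<lambda>x. B * (x * (2 + ln (1 / x))) < 1/2) (at_right 0)"
    by (rule order_tendstoD) simp
  moreover have "eventually (\<lambda>x::real. 0 < x \<and> x < 1/4) (at_right 0)"
    by (intro eventually_conj eventually_at_right_less) (auto simp: eventually_at_right[of 0 1] intro!: exI[of _ "1/4"])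
  \<comment> \<open>With this lam the remaining terms amount to at most half of ell t / lam, so that
    4/(\<sigma> - \<beta>) \<le> (3 + 1/2) ell t / lam, with a coefficient below 4.\<close>
  ultimately obtain lam where lam: "B * (lam * (2 + ln (1 / lam))) < 1/2" "0 < lam" "lam < 1/4"
    using eventually_happens'[OF _ eventually_conj] trivial_limit_at_right_real by blast
  \<comment> \<open>From 8 lam / ell t \<le> 7(\<sigma> - \<beta>) and \<sigma> = 1 + lam / ell t it
    follows that \<beta> \<le> 1 - lam / (7 ell t).\<close>
  define c where "c = min (lam / 7) t0"
  have c: "0 < c" "c \<le> 1/4" using lam t0 by (auto simp: c_def)
  have "H s \<noteq> 0" if s: "Re s > 1 - c / ell (Im s)" for s
  proof
    assume zero: "H s = 0"
    define \<beta> t where "\<beta> = Re s" and "t = Im s"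
    define \<l> where "\<l> = ell t"
    have s': "s = Complex \<beta> t" by (simp add: \<beta>_def t_def)
    have \<l>: "\<l> \<ge> 1" by (simp add: \<l>_def ell_ge_1)
    have \<beta>1: "\<beta> \<le> 1" using zero continuation_nonzero[OF H a, of s] by (force simp: \<beta>_def)
    have "c / \<l> \<le> c / 1" using c \<l> by (intro divide_left_mono) auto
    hence \<beta>2: "\<beta> > 1 - c" using s by (simp add: \<beta>_def \<l>_def t_def)
    have t_ge: "\<bar>t\<bar> \<ge> t0"
    proof (rule ccontr)
      assume "\<not> \<bar>t\<bar> \<ge> t0"
      moreover have "cmod (s - 1) \<le> \<bar>\<beta> - 1\<bar> + \<bar>t\<bar>" using cmod_le[of "s - 1"] by (simp add: \<beta>_def t_def)
      moreover have "c \<le> t0" by (simp add: c_def)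
      ultimately have "cmod (s - 1) < 2 * t0" using \<beta>1 \<beta>2 by linarith
      thus False using nearone zero by blast
    qed
    define \<sigma> where "\<sigma> = 1 + lam / \<l>"
    have lam_le: "lam / \<l> \<le> lam / 1" using lam \<l> by (intro divide_left_mono) auto
    have \<sigma>: "1 < \<sigma>" "\<sigma> \<le> 3/2" using lam \<l> lam_le by (auto simp: \<sigma>_def)
    have \<sigma>\<beta>: "\<beta> < \<sigma>" "\<sigma> - \<beta> < 1/2" using \<sigma> \<beta>1 \<beta>2 c lam_le lam by (auto simp: \<sigma>_def)
    define l where "l = ln (1 / (\<sigma> - 1))"
    have l: "l \<ge> 0" unfolding l_def using \<sigma> by (intro ln_ge_zero) (simp add: field_simps)
    have inv: "Re (of_nat d' / (Complex \<sigma> u - 1)) \<le> 1 / t0" if "d' \<le> 1" "\<bar>u\<bar> \<ge> t0" for d' :: nat and u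
    proof -
      have "cmod (Complex \<sigma> u - 1) \<ge> t0" using abs_Im_le_cmod[of "Complex \<sigma> u - 1"] that by simp
      hence "cmod (of_nat d' / (Complex \<sigma> u - 1)) \<le> 1 / t0"
        unfolding norm_divide using that t0 by (intro frac_le) auto
      thus ?thesis using complex_Re_le_cmod order_trans by blast
    qed
    have dle: "d \<le> 1" "d2 \<le> 1" "d1 \<le> 1" using H H2 Z by (auto simp: continuation_def)
    have z1: "Re (- deriv (dser (\<lambda>_. 1)) (of_real \<sigma>) / dser (\<lambda>_. 1) (of_real \<sigma>)) \<le> A1 * (\<l> + l) + \<l> / lam"
    proof -
      have s0: "of_real \<sigma> = Complex \<sigma> 0" by (simp add: complex_eq_iff)
      have "Re (- deriv (dser (\<lambda>_. 1)) (of_real \<sigma>) / dser (\<lambda>_. 1) (of_real \<sigma>))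
         = - Re (deriv Z (Complex \<sigma> 0) / Z (Complex \<sigma> 0)) + Re (of_nat d1 / (of_real \<sigma> - 1))"
        using continuation_log_deriv[OF Z sgn_mult_one, of "of_real \<sigma>"] \<sigma> by (simp add: s0)
      also have "Re (of_nat d1 / (of_real \<sigma> - 1)) \<le> 1 / (\<sigma> - 1)"
      proof -
        have "of_nat d1 / (of_real \<sigma> - 1) = complex_of_real (real d1 / (\<sigma> - 1))" by simp
        hence "Re (of_nat d1 / (of_real \<sigma> - 1)) = real d1 / (\<sigma> - 1)" by (simp only: Re_complex_of_real)
        thus ?thesis using dle \<sigma> by (simp add: divide_right_mono)
      qed
      also have "1 / (\<sigma> - 1) = \<l> / lam" by (simp add: \<sigma>_def)
      also have "- Re (deriv Z (Complex \<sigma> 0) / Z (Complex \<sigma> 0)) \<le> A1 * (ell 0 + l)"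
        unfolding l_def by (rule A1(2)[OF \<sigma>])
      also have "A1 * (ell 0 + l) \<le> A1 * (\<l> + l)"
        using A1(1) ell_mono[of 0 t] by (intro mult_left_mono) (auto simp: \<l>_def)
      finally show ?thesis by simp
    qed
    have z2: "Re (- deriv (dser a) (Complex \<sigma> t) / dser a (Complex \<sigma> t)) \<le> A2 * (\<l> + l) - 1 / (\<sigma> - \<beta>) + 2 + 1 / t0"
    proof -
      have "Re (- deriv (dser a) (Complex \<sigma> t) / dser a (Complex \<sigma> t))
         = - Re (deriv H (Complex \<sigma> t) / H (Complex \<sigma> t)) + Re (of_nat d / (Complex \<sigma> t - 1))"
        using continuation_log_deriv[OF H a, of "Complex \<sigma> t"] \<sigma> by simp
      moreover have "- Re (deriv H (Complex \<sigma> t) / H (Complex \<sigma> t)) \<le> A2 * (\<l> + l) - 1 / (\<sigma> - \<beta>) + 2"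
        unfolding l_def \<l>_def by (rule A2(2)[OF \<sigma> _ \<sigma>\<beta>]) (use zero s' in simp)
      ultimately show ?thesis using inv[OF dle(1) t_ge] by linarith
    qed
    have z3: "Re (- deriv (dser (\<lambda>n. (a n)\<^sup>2)) (Complex \<sigma> (2 * t)) / dser (\<lambda>n. (a n)\<^sup>2) (Complex \<sigma> (2 * t))) \<le> A3 * (2 * \<l> + l) + 1 / t0"
    proof -
      have "Re (- deriv (dser (\<lambda>n. (a n)\<^sup>2)) (Complex \<sigma> (2 * t)) / dser (\<lambda>n. (a n)\<^sup>2) (Complex \<sigma> (2 * t)))
         = - Re (deriv H2 (Complex \<sigma> (2 * t)) / H2 (Complex \<sigma> (2 * t))) + Re (of_nat d2 / (Complex \<sigma> (2 * t) - 1))"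
        using continuation_log_deriv[OF H2 sgn_mult_square[OF a], of "Complex \<sigma> (2 * t)"] \<sigma> by simp
      moreover have "- Re (deriv H2 (Complex \<sigma> (2 * t)) / H2 (Complex \<sigma> (2 * t))) \<le> A3 * (ell (2 * t) + l)"
        unfolding l_def by (rule A3(2)[OF \<sigma>])
      moreover have "A3 * (ell (2 * t) + l) \<le> A3 * (2 * \<l> + l)"
        using A3(1) ell_double[of "2 * t" t] by (intro mult_left_mono) (auto simp: \<l>_def)
      moreover have "\<bar>2 * t\<bar> \<ge> t0" using t_ge t0 by (simp add: abs_mult)
      ultimately show ?thesis using inv[OF dle(2), of "2 * t"] by linarith
    qed
    have "0 \<le> 3 * (A1 * (\<l> + l) + \<l> / lam) + 4 * (A2 * (\<l> + l) - 1 / (\<sigma> - \<beta>) + 2 + 1 / t0) + (A3 * (2 * \<l> + l) + 1 / t0)"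
      by (rule order_trans[OF log_deriv_341[OF a \<sigma>(1), of t]
            add_mono[OF add_mono[OF mult_left_mono[OF z1] mult_left_mono[OF z2]] z3]]) auto
    moreover have "4 * x \<le> 3 * y + (3 * p + 4 * q + r + 8 + 5 * w)"
      if "0 \<le> 3 * (p + y) + 4 * (q - x + 2 + w) + (r + w)" for p q r w x y :: real
      using that by argo
    ultimately have "4 * (1 / (\<sigma> - \<beta>)) \<le> 3 * (\<l> / lam) + (3 * (A1 * (\<l> + l)) + 4 * (A2 * (\<l> + l)) + A3 * (2 * \<l> + l) + 8 + 5 * (1 / t0))"
      by blast
    also have "3 * (A1 * (\<l> + l)) + 4 * (A2 * (\<l> + l)) + A3 * (2 * \<l> + l) + 8 + 5 * (1 / t0) \<le> B * (\<l> + l)"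
    proof -
      have "A3 * (2 * \<l> + l) \<le> A3 * (2 * (\<l> + l))" using A3(1) l by (intro mult_left_mono) auto
      moreover have "(8 + 5 / t0) * 1 \<le> (8 + 5 / t0) * (\<l> + l)" using t0 l \<l> by (intro mult_left_mono) auto
      ultimately show ?thesis by (simp add: B_def algebra_simps)
    qed
    also have "l \<le> \<l> + \<l> * ln (1 / lam)"
    proof -
      have "l = ln (\<l> * (1 / lam))" by (simp add: l_def \<sigma>_def)
      also have "\<dots> = ln \<l> + ln (1 / lam)" using \<l> lam by (intro ln_mult_pos) auto
      also have "ln \<l> \<le> \<l>" using \<l> ln_le_minus_one[of \<l>] by simp
      also have "ln (1 / lam) \<le> \<l> * ln (1 / lam)"
      proof -
        have "ln (1 / lam) \<ge> 0" using lam by (intro ln_ge_zero) (simp add: field_simps)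
        thus ?thesis using \<l> mult_right_mono[of 1 \<l>] by simp
      qed
      finally show ?thesis by simp
    qed
    hence "B * (\<l> + l) \<le> B * (\<l> + (\<l> + \<l> * ln (1 / lam)))" using B by (intro mult_left_mono) auto
    also have "\<dots> = (B * (lam * (2 + ln (1 / lam)))) * (\<l> / lam)" using lam by (simp add: field_simps)
    also have "\<dots> \<le> (1/2) * (\<l> / lam)" using lam \<l> by (intro mult_right_mono) auto
    finally have "4 * (1 / (\<sigma> - \<beta>)) \<le> (7/2) * (\<l> / lam)" by simp
    hence "8 * lam \<le> 7 * \<l> * (\<sigma> - \<beta>)" using \<sigma>\<beta> lam by (simp add: field_simps)
    hence "8 * (lam / \<l>) \<le> 7 * (\<sigma> - \<beta>)" using \<l> by (simp add: field_simps)
    hence "7 * \<beta> \<le> 7 - lam / \<l>" by (simp add: \<sigma>_def)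
    moreover have "c / \<l> \<le> (lam / 7) / \<l>" using \<l> by (intro divide_right_mono) (auto simp: c_def)
    ultimately have "\<beta> \<le> 1 - c / \<l>" by simp
    thus False using s by (simp add: \<beta>_def \<l>_def t_def)
  qed
  thus thesis using that c by blast
qed

text \<open>The lower bound of \<open>continuation_lower\<close> at \<open>s0\<close>, just to the
  right of 1, is carried across the line by \<open>nonvanishing_log\<close> on a zero-free disc of
  radius \<open>\<rho>\<close>. Since s is within \<open>\<rho> / 80\<close> of \<open>s0\<close>,
  the loss is about exp(M/20) with M at most 5 ell t plus a constant. The factor (ell t)^2 from the
  start value costs another exp(ell t / 4), and together this is the square root of |t| + 3.\<close>

lemma lower_bound_near_one:
  assumes a: "sgn_mult a" and H: "continuation a d H" and c: "0 < c" "c \<le> 1/4"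
    and zf: "\<And>s. Re s > 1 - c / ell (Im s) \<Longrightarrow> H s \<noteq> 0"
  obtains c' C where "0 < c'" "c' < c" "C > 0"
    "\<And>s. Re s \<ge> 1 - c' / ell (Im s) \<Longrightarrow> Re s \<le> 1 \<Longrightarrow> 1 / cmod (H s) \<le> C * sqrt (\<bar>Im s\<bar> + 3)"
proof -
  obtain K where K: "K > 0" "\<And>z t. Re z \<ge> 1/2 \<Longrightarrow> cmod z \<le> \<bar>t\<bar> + 5/2 \<Longrightarrow> cmod (H z) < K * (\<bar>t\<bar> + 3) ^ 3"
    by (rule continuation_upper[OF H]) blast
  \<comment> \<open>small enough for the loss in the Borel--Caratheodory step to be at most the fourth root of \<open>\<bar>t\<bar> + 3\<close>\<close>
  define \<eta> :: real where "\<eta> = 1 / 640"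
  define c' where "c' = \<eta> * c"
  have c': "0 < c'" "c' < c" "c' \<le> 1" using c by (auto simp: c'_def \<eta>_def)
  define M0 where "M0 = \<bar>ln (2 * K)\<bar> + 2 * ln (1 / c')"
  define C where "C = 128 / c'\<^sup>2 * exp (M0 * (1/20))"
  have lnc: "ln (1 / c') \<ge> 0" using c' by (intro ln_ge_zero) (simp add: field_simps)
  show thesis
  proof (rule that[of c' C])
    show "C > 0" using c' by (simp add: C_def)
    fix s assume s: "Re s \<ge> 1 - c' / ell (Im s)" "Re s \<le> 1"
    define t where "t = Im s"
    define \<l> where "\<l> = ell t"
    have \<l>: "\<l> \<ge> 1" by (simp add: \<l>_def ell_ge_1)
    define s0 where "s0 = Complex (1 + c' / \<l>) t"
    \<comment> \<open>On the disc \<open>ell\<close> is at most twice its value at the centre, so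
      the region is zero-free to a depth c / (2 ell t), which \<open>\<rho>\<close> does not
      exceed.\<close>
    define \<rho> where "\<rho> = c / (4 * \<l>)"
    have cl: "c / \<l> \<le> 1/4" using c \<l> divide_left_mono[of 1 \<l> c] by simp
    have cl': "0 < c' / \<l>" "c' / \<l> \<le> 1" using c' \<l> by (auto simp: field_simps)
    have \<rho>: "\<rho> > 0" "\<rho> \<le> 1/16" using c \<l> cl by (auto simp: \<rho>_def field_simps)
    have c'l: "c' / \<l> = 4 * \<eta> * \<rho>" by (simp add: c'_def \<rho>_def)
    have near: "Re z > 1 - c / ell (Im z)" "Re z \<ge> 1/2" "cmod z \<le> \<bar>t\<bar> + 5/2" if "z \<in> ball s0 \<rho>" for z
    proof -
      have d: "cmod (s0 - z) < \<rho>" using that by (simp add: dist_norm)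
      have R: "Re z > 1 + c' / \<l> - \<rho>" using abs_Re_le_cmod[of "s0 - z"] d by (simp add: s0_def; linarith)
      have "\<bar>Im z\<bar> \<le> \<bar>t\<bar> + 1" using abs_Im_le_cmod[of "s0 - z"] d \<rho> by (simp add: s0_def; linarith)
      hence "ell (Im z) \<le> 2 * \<l>" unfolding \<l>_def by (intro ell_double) auto
      hence "c / (2 * \<l>) \<le> c / ell (Im z)" using c ell_ge_1[of "Im z"] by (intro divide_left_mono mult_pos_pos) auto
      moreover have "\<rho> \<le> c / (2 * \<l>)" using c \<l> by (simp add: \<rho>_def field_simps)
      ultimately show "Re z > 1 - c / ell (Im z)" using R cl' by linarith
      show "Re z \<ge> 1/2" using R \<rho> cl' by linarith
      have "cmod s0 \<le> \<bar>1 + c' / \<l>\<bar> + \<bar>t\<bar>" using cmod_le[of s0] by (simp add: s0_def)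
      moreover have "cmod z \<le> cmod s0 + cmod (s0 - z)"
        using norm_triangle_ineq4[of s0 "s0 - z"] by simp
      ultimately show "cmod z \<le> \<bar>t\<bar> + 5/2" using d \<rho> cl' by linarith
    qed
    have hol: "H holomorphic_on ball s0 \<rho>"
      by (rule holomorphic_on_subset[of _ "{s. Re s > 0}"]) (use H near(2) in \<open>force simp: continuation_def\<close>)+
    have s_eq: "s - s0 = of_real (Re s - (1 + c' / \<l>))" by (simp add: s0_def t_def complex_eq_iff)
    have dist: "cmod (s - s0) \<le> 8 * \<eta> * \<rho>"
      unfolding s_eq norm_of_real using s c'l cl' by (simp add: \<l>_def t_def)
    have \<eta>8: "8 * \<eta> * \<rho> = \<rho> / 80" by (simp add: \<eta>_def)
    have sball: "s \<in> ball s0 \<rho>" using dist \<rho> \<eta>8 by (simp add: dist_norm norm_minus_commute)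
    define K' where "K' = K * (\<bar>t\<bar> + 3) ^ 3"
    define M where "M = ln (K' / cmod (H s0))"
    have main: "cmod (H s) \<ge> cmod (H s0) * exp (- (2 * M * cmod (s - s0) / (\<rho> - cmod (s - s0))))"
      unfolding M_def K'_def
      by (rule nonvanishing_log(2)[OF hol \<rho>(1)]) (use near zf K sball in auto)
    have H0: "cmod (H s0) \<ge> (c' / \<l>)\<^sup>2 / 2"
      using continuation_lower[OF H a, of "1 + c' / \<l>" t] cl' by (simp add: s0_def)
    have "M \<le> \<bar>ln (2 * K)\<bar> + 3 * ell t + 2 * ln (1 / (c' / \<l>))"
      unfolding M_def K'_def by (rule ln_ratio_bound[OF K(1) H0]) (use cl' in auto)
    also have "ln (1 / (c' / \<l>)) = ln (\<l> * (1 / c'))" by simp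
    also have "\<dots> = ln \<l> + ln (1 / c')" using \<l> c' by (intro ln_mult_pos) auto
    also have "ln \<l> \<le> \<l>" using \<l> ln_le_minus_one[of \<l>] by simp
    finally have M: "M \<le> M0 + 5 * \<l>" by (simp add: M0_def \<l>_def)
    have M0: "M0 \<ge> 0" using lnc by (simp add: M0_def)
    have frac: "cmod (s - s0) / (\<rho> - cmod (s - s0)) \<le> 1 / 40"
    proof -
      have "cmod (s - s0) \<le> \<rho> / 80" using dist \<eta>8 by simp
      hence "cmod (s - s0) / (\<rho> - cmod (s - s0)) \<le> (\<rho> / 80) / (\<rho> / 2)"
        using \<rho> by (intro frac_le) auto
      thus ?thesis using \<rho> by simp
    qed
    have frac0: "cmod (s - s0) / (\<rho> - cmod (s - s0)) \<ge> 0" using sball by (simp add: dist_norm norm_minus_commute)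
    have "2 * M * cmod (s - s0) / (\<rho> - cmod (s - s0)) = 2 * (M * (cmod (s - s0) / (\<rho> - cmod (s - s0))))" by simp
    also have "M * (cmod (s - s0) / (\<rho> - cmod (s - s0))) \<le> (M0 + 5 * \<l>) * (cmod (s - s0) / (\<rho> - cmod (s - s0)))"
      using M frac0 by (rule mult_right_mono)
    also have "\<dots> \<le> (M0 + 5 * \<l>) * (1 / 40)" using frac M0 \<l> by (intro mult_left_mono) auto
    finally have ex: "2 * M * cmod (s - s0) / (\<rho> - cmod (s - s0)) \<le> M0 * (1/20) + \<l> / 4" by simp
    have "\<l> / 8 \<le> exp (\<l> / 8)" using exp_ge_add_one_self[of "\<l> / 8"] by linarith
    hence "(\<l> / 8)\<^sup>2 \<le> (exp (\<l> / 8))\<^sup>2" using \<l> by (intro power_mono) auto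
    also have "(exp (\<l> / 8))\<^sup>2 = exp (\<l> / 4)" by (simp flip: exp_of_nat_mult)
    finally have l2: "\<l>\<^sup>2 \<le> 64 * exp (\<l> / 4)" by (simp add: power_divide)
    have pos: "cmod (H s0) > 0" using H0 cl' by (smt (verit) half_gt_zero zero_less_power)
    have "1 / cmod (H s) \<le> 1 / (cmod (H s0) * exp (- (M0 * (1/20) + \<l> / 4)))"
    proof (rule divide_left_mono)
      have "cmod (H s0) * exp (- (M0 * (1/20) + \<l> / 4)) \<le> cmod (H s0) * exp (- (2 * M * cmod (s - s0) / (\<rho> - cmod (s - s0))))"
        using ex by (intro mult_left_mono) auto
      thus "cmod (H s0) * exp (- (M0 * (1/20) + \<l> / 4)) \<le> cmod (H s)" using main by linarith
      show "0 < cmod (H s) * (cmod (H s0) * exp (- (M0 * (1/20) + \<l> / 4)))"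
        using pos zf near(1)[OF sball] by auto
    qed simp
    also have "\<dots> = exp (M0 * (1/20) + \<l> / 4) * (1 / cmod (H s0))" by (simp add: exp_minus field_simps)
    also have "\<dots> \<le> exp (M0 * (1/20) + \<l> / 4) * (1 / ((c' / \<l>)\<^sup>2 / 2))"
      using H0 pos cl' by (intro mult_left_mono divide_left_mono mult_pos_pos) (auto intro!: divide_pos_pos zero_less_power)
    also have "1 / ((c' / \<l>)\<^sup>2 / 2) = 2 / c'\<^sup>2 * \<l>\<^sup>2" by (simp add: power_divide)
    also have "exp (M0 * (1/20) + \<l> / 4) * (2 / c'\<^sup>2 * \<l>\<^sup>2) \<le> exp (M0 * (1/20) + \<l> / 4) * (2 / c'\<^sup>2 * (64 * exp (\<l> / 4)))"
      using l2 by (intro mult_left_mono) auto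
    also have "\<dots> = C * exp (\<l> / 2)"
    proof -
      have "exp (\<l> / 4) * exp (\<l> / 4) = exp (\<l> / 2)" by (simp flip: exp_add)
      thus ?thesis by (simp add: C_def exp_add mult_ac)
    qed
    also have "exp (\<l> / 2) = sqrt (\<bar>Im s\<bar> + 3)"
    proof -
      have "(exp (\<l> / 2))\<^sup>2 = exp \<l>" by (simp flip: exp_of_nat_mult)
      also have "\<dots> = \<bar>Im s\<bar> + 3" by (simp add: \<l>_def exp_ell t_def)
      finally show ?thesis by (metis exp_ge_zero real_sqrt_unique)
    qed
    finally show "1 / cmod (H s) \<le> C * sqrt (\<bar>Im s\<bar> + 3)" .
  qed (use c' in auto)
qed

subsection \<open>The prime number theorem for \<open>\<mu>\<chi>\<close> with classical error term\<close>

text \<open>\<open>Newman_bound\<close> with F(z) = 1/L(1 + z), height R = exp(\<eta> u) and u =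
  sqrt(log N). At this height the zero-free region has depth of order 1/u, so N^(-\<delta>) is
  exponentially small in u, like the powers of R that it must beat.\<close>

lemma mob_over_n_estimate:
  assumes a: "sgn_mult a" and H: "continuation a d H" and c: "0 < c" "c \<le> 1/4"
    and zf: "\<And>s. Re s > 1 - c / ell (Im s) \<Longrightarrow> H s \<noteq> 0"
  obtains m \<eta> C U where "\<eta> > 0" "C > 0"
    "\<And>N. N > 0 \<Longrightarrow> sqrt (ln (real N)) \<ge> U \<Longrightarrow>
       \<bar>(\<Sum>n=1..N. mob n * a n / real n) - m\<bar> \<le> C * exp (- \<eta> * sqrt (ln (real N)))"
proof -
  obtain c' C where c': "0 < c'" "c' < c" and C: "C > 0"
    and low: "\<And>s. Re s \<ge> 1 - c' / ell (Im s) \<Longrightarrow> Re s \<le> 1 \<Longrightarrow> 1 / cmod (H s) \<le> C * sqrt (\<bar>Im s\<bar> + 3)"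
    by (rule lower_bound_near_one[OF a H c zf]) auto
  define F where "F = (\<lambda>z. z ^ d / H (1 + z))"
  \<comment> \<open>Then ell R \<le> 2 \<eta> u = c' u / 4, hence \<delta> \<ge> 4/u and
    N^(-\<delta>) \<le> exp(-4u). This outweighs 1/\<delta> \<le> exp(u) and the powers of R, as
    \<eta> is at most 1/8.\<close>
  define \<eta> where "\<eta> = c' / 8"
  have \<eta>: "0 < \<eta>" "\<eta> \<le> 1/8" using c' c by (auto simp: \<eta>_def)
  have d: "d \<le> 1" using H by (simp add: continuation_def)
  have ma: "\<bar>mob n * a n\<bar> \<le> 1" for n
    by (rule abs_mob_mult_le[OF a])
  have est: "\<bar>(\<Sum>n=1..N. mob n * a n / real n) - Re (F 0)\<bar> \<le> (6 + 8 * C) * exp (- (\<eta> / 2) * sqrt (ln (real N)))"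
    if N: "N > 0" and U: "sqrt (ln (real N)) \<ge> 2 / \<eta>" for N
  proof -
    define u where "u = sqrt (ln (real N))"
    define R where "R = exp (\<eta> * u)"
    define \<delta> where "\<delta> = c' / ell R"
    define B where "B = C * (R + 1) * sqrt (R + 3)"
    have "2 / \<eta> > 0" using \<eta> by simp
    hence u: "u \<ge> 2 / \<eta>" "u > 0" using U unfolding u_def by linarith+
    have \<eta>u: "\<eta> * u \<ge> 2" using u \<eta> by (simp add: field_simps)
    have u16: "u \<ge> 16"
    proof -
      have "2 / (1/8) \<le> 2 / \<eta>" using \<eta> by (intro divide_left_mono) auto
      thus ?thesis using u by simp
    qed
    have u2: "u\<^sup>2 = ln (real N)" using N by (simp add: u_def)
    have R1: "R \<ge> 1" using \<eta>u by (simp add: R_def)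
    have RN: "R \<le> real N"
    proof -
      have "\<eta> * u \<le> u * u" using \<eta> u16 by (intro mult_right_mono) auto
      hence "\<eta> * u \<le> ln (real N)" using u2 by (simp add: power2_eq_square)
      hence "R \<le> exp (ln (real N))" by (simp add: R_def)
      thus ?thesis using N by simp
    qed
    have ellR: "ell R \<ge> 1" by (rule ell_ge_1)
    have \<delta>: "0 < \<delta>" "\<delta> \<le> 1"
      using c' c ellR by (auto simp: \<delta>_def field_simps)
    have ell_le: "ell (Im z) \<le> ell R" if "\<bar>Im z\<bar> \<le> R" for z
      using that R1 by (intro ell_mono) auto
    have \<delta>le: "\<delta> \<le> c' / ell (Im z)" if "\<bar>Im z\<bar> \<le> R" for z
      unfolding \<delta>_def using ell_le[OF that] ell_ge_1[of "Im z"] c' by (intro divide_left_mono mult_pos_pos) auto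
    have Hnz: "H (1 + z) \<noteq> 0" if "- \<delta> \<le> Re z" "\<bar>Im z\<bar> \<le> R" for z
    proof (rule zf)
      have "c' / ell (Im z) < c / ell (Im z)" using c' ell_ge_1[of "Im z"] by (intro divide_strict_right_mono) auto
      thus "1 - c / ell (Im (1 + z)) < Re (1 + z)" using \<delta>le[OF that(2)] that(1) by simp
    qed
    have "\<delta> < 1" using c' c ellR by (auto simp: \<delta>_def field_simps)
    hence im: "(\<lambda>z. 1 + z) ` cbox (Complex (-\<delta>) (-R)) (Complex R R) \<subseteq> {s. Re s > 0}"
      by (auto simp: in_cbox_complex_iff)
    have "H holomorphic_on {s. Re s > 0}" using H by (simp add: continuation_def)
    from holomorphic_on_compose_gen[OF _ this im]
    have "(\<lambda>z. H (1 + z)) holomorphic_on cbox (Complex (-\<delta>) (-R)) (Complex R R)"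
      by (simp add: o_def holomorphic_on_add)
    hence holF: "F holomorphic_on cbox (Complex (-\<delta>) (-R)) (Complex R R)"
      unfolding F_def using Hnz by (intro holomorphic_intros) (auto simp: in_cbox_complex_iff)
    have sums: "(\<lambda>n. complex_of_real (mob n * a n) * of_nat n powr (-1 - z)) sums F z" if z: "Re z > 0" for z
    proof -
      have s: "Re (1 + z) > 1" using z by simp
      have z0: "z \<noteq> 0" using z by auto
      have "F z = z ^ d / (z ^ d * dser a (1 + z))" using continuation_eq[OF H s] by (simp add: F_def)
      also have "\<dots> = 1 / dser a (1 + z)" using z0 by simp
      also have "\<dots> = dser (\<lambda>n. mob n * a n) (1 + z)"
        using dser_mob[OF a s] dser_nonzero[OF a s] by (simp add: field_simps)
      finally have "F z = dser (\<lambda>n. mob n * a n) (1 + z)" .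
      moreover have "-1 - z = - (1 + z)" by simp
      ultimately show ?thesis using dabs_sums[OF dabs_bounded[OF ma s]] by (simp only:)
    qed
    have bound: "cmod (F z) \<le> B" if z: "- \<delta> \<le> Re z" "Re z \<le> 0" "\<bar>Im z\<bar> \<le> R" for z
    proof -
      have "cmod z \<le> \<bar>Re z\<bar> + \<bar>Im z\<bar>" by (rule cmod_le)
      hence "cmod z \<le> R + 1" using z \<delta> by linarith
      hence "cmod z ^ d \<le> (R + 1) ^ d" by (intro power_mono) auto
      also have "\<dots> \<le> (R + 1) ^ 1" using d R1 by (intro power_increasing) auto
      finally have 1: "cmod z ^ d \<le> R + 1" by simp
      have "1 / cmod (H (1 + z)) \<le> C * sqrt (\<bar>Im (1 + z)\<bar> + 3)"
        by (rule low) (use \<delta>le[OF z(3)] z in auto)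
      also have "\<dots> \<le> C * sqrt (R + 3)" using z C by (intro mult_left_mono real_sqrt_le_mono) auto
      finally have "cmod z ^ d * (1 / cmod (H (1 + z))) \<le> (R + 1) * (C * sqrt (R + 3))"
        using 1 R1 by (intro mult_mono) auto
      thus ?thesis by (simp add: F_def B_def norm_divide norm_power mult_ac)
    qed
    have "cmod (F 0 - (\<Sum>n=1..N. complex_of_real (mob n * a n) / of_nat n)) \<le> 6 / R + B / R\<^sup>2 + B * R * real N powr (- \<delta>) / \<delta>"
      by (rule Newman_bound[OF _ R1 RN \<delta> holF sums bound]) (use ma in \<open>simp_all add: norm_mult abs_mult\<close>)
    moreover have "(\<Sum>n=1..N. complex_of_real (mob n * a n) / of_nat n) = of_real (\<Sum>n=1..N. mob n * a n / real n)"
      by simp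
    ultimately have 1: "\<bar>(\<Sum>n=1..N. mob n * a n / real n) - Re (F 0)\<bar> \<le> 6 / R + B / R\<^sup>2 + B * R * real N powr (- \<delta>) / \<delta>"
      using abs_Re_le_cmod[of "F 0 - of_real (\<Sum>n=1..N. mob n * a n / real n)"] by (simp add: abs_minus_commute)
    \<comment> \<open>\<open>B\<close> has order R^(3/2), so the terms with \<open>B\<close> save
      only \<open>r\<close>, the square root of R. This fixes the final rate \<eta>/2.\<close>
    define r where "r = exp (\<eta> * u / 2)"
    have r: "r\<^sup>2 = R" "r > 0" by (simp_all add: r_def R_def flip: exp_of_nat_mult)
    have B: "B \<le> 4 * C * (R * r)"
    proof -
      have "sqrt (R + 3) \<le> sqrt (4 * R)" using R1 by (intro real_sqrt_le_mono) auto
      also have "sqrt (4 * R) = 2 * r" unfolding r(1)[symmetric] using r(2) by (simp add: real_sqrt_mult)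
      finally have "(R + 1) * sqrt (R + 3) \<le> (2 * R) * (2 * r)" using R1 by (intro mult_mono) auto
      hence "C * ((R + 1) * sqrt (R + 3)) \<le> C * ((2 * R) * (2 * r))" using C by (intro mult_left_mono) auto
      thus ?thesis by (simp add: B_def mult_ac)
    qed
    have B0: "B \<ge> 0" using C R1 by (simp add: B_def)
    have e1: "6 / R \<le> 6 * (1 / r)"
    proof -
      have "1 \<le> r" using \<eta>u by (simp add: r_def)
      hence "r \<le> R" using r mult_right_mono[of 1 r r] by (simp add: power2_eq_square)
      thus ?thesis using r by (simp add: frac_le)
    qed
    have e2: "B / R\<^sup>2 \<le> 4 * C * (1 / r)"
    proof -
      have "B / R\<^sup>2 \<le> 4 * C * (R * r) / R\<^sup>2" using B by (intro divide_right_mono) auto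
      also have "\<dots> = 4 * C * (1 / r)" unfolding r(1)[symmetric] using r(2) by (simp add: power2_eq_square)
      finally show ?thesis .
    qed
    have e3: "B * R * real N powr (- \<delta>) / \<delta> \<le> 4 * C * (1 / r)"
    proof -
      have "ell R \<le> 2 * (\<eta> * u)"
      proof -
        have "R + 3 \<le> 4 * R" using R1 by simp
        also have "4 \<le> exp (2::real)"
        proof -
          have "(2::real) \<le> exp 1" using exp_ge_add_one_self[of 1] by simp
          hence "2 * 2 \<le> exp 1 * exp (1::real)" by (intro mult_mono) auto
          thus ?thesis by (simp flip: exp_add)
        qed
        hence "4 * R \<le> exp 2 * R" using R1 by (intro mult_right_mono) auto
        also have "exp 2 * R \<le> exp (\<eta> * u) * R" using R1 \<eta>u by (intro mult_right_mono) auto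
        also have "\<dots> = exp (2 * (\<eta> * u))" by (simp add: R_def flip: exp_add)
        finally have "ln (R + 3) \<le> ln (exp (2 * (\<eta> * u)))" using R1 by (subst ln_le_cancel_iff) auto
        thus ?thesis using R1 by (simp add: ell_def)
      qed
      hence "ell R \<le> c' * (u / 4)" by (simp add: \<eta>_def)
      hence 1: "1 / \<delta> \<le> u / 4" using c' ellR by (simp add: \<delta>_def field_simps)
      hence "4 \<le> \<delta> * u" using \<delta> by (simp add: field_simps)
      hence "4 * u \<le> \<delta> * u * u" using u by (intro mult_right_mono) auto
      hence "4 * u \<le> \<delta> * ln (real N)" using u2 by (simp add: power2_eq_square mult.assoc)
      hence "real N powr (- \<delta>) \<le> exp (- (4 * u))" using N by (simp add: powr_def)
      moreover have "1 / \<delta> \<le> exp u" using 1 exp_ge_add_one_self[of u] u by linarith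
      ultimately have "real N powr (- \<delta>) * (1 / \<delta>) \<le> exp (- (4 * u)) * exp u"
        using \<delta> by (intro mult_mono) auto
      also have "\<dots> = exp (- (3 * u))" by (simp flip: exp_add)
      finally have 2: "real N powr (- \<delta>) * (1 / \<delta>) \<le> exp (- (3 * u))" .
      have BR: "B * R \<le> 4 * C * (R * r) * R" using B R1 by (intro mult_right_mono) auto
      have "(B * R) * (real N powr (- \<delta>) * (1 / \<delta>)) \<le> (4 * C * (R * r) * R) * exp (- (3 * u))"
        by (rule mult_mono[OF BR 2]) (use R1 r C \<delta> in auto)
      also have "\<dots> = 4 * C * (1 / r) * (R * R * R * exp (- (3 * u)))"
        unfolding r(1)[symmetric] using r(2) by (simp add: power2_eq_square field_simps)
      also have "R * R * R * exp (- (3 * u)) = exp (3 * (\<eta> * u) - 3 * u)"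
        by (simp add: R_def flip: exp_add)
      also have "4 * C * (1 / r) * exp (3 * (\<eta> * u) - 3 * u) \<le> 4 * C * (1 / r) * 1"
        using C r \<eta> u mult_right_mono[of \<eta> 1 u] by (intro mult_left_mono) auto
      finally show ?thesis by simp
    qed
    have "6 / R + B / R\<^sup>2 + B * R * real N powr (- \<delta>) / \<delta> \<le> 6 * (1 / r) + 4 * C * (1 / r) + 4 * C * (1 / r)"
      by (intro add_mono e1 e2 e3)
    also have "\<dots> = (6 + 8 * C) * (1 / r)" by (simp only: ring_distribs)
    also have "1 / r = exp (- (\<eta> * u / 2))" by (simp only: r_def exp_minus inverse_eq_divide)
    also have "- (\<eta> * u / 2) = - (\<eta> / 2) * u" by simp
    finally show ?thesis using 1 by (simp add: u_def)
  qed
  show thesis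
    by (rule that[of "\<eta> / 2" "6 + 8 * C" "2 / \<eta>" "Re (F 0)"]) (use \<eta> C est in auto)
qed

section \<open>From sums of \<mu>(n)\<chi>(n)/n to sums of \<mu>(n)\<chi>(n)\<close>

lemma exp_sqrt_ln_le:
  assumes x: "x \<ge> 1" and c: "c \<ge> 0"
  shows "sqrt x \<le> exp (c\<^sup>2) * (x * exp (- c * sqrt (ln x)))"
proof -
  define u where "u = sqrt (ln x)"
  have u2: "u\<^sup>2 = ln x" using x by (simp add: u_def)
  have "0 \<le> (u - c)\<^sup>2 + c\<^sup>2" by simp
  hence "c * u \<le> u\<^sup>2 / 2 + c\<^sup>2" by (simp add: power2_eq_square algebra_simps)
  hence "u\<^sup>2 / 2 \<le> c\<^sup>2 + (u\<^sup>2 - c * u)" by (simp add: field_simps)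
  hence "exp (u\<^sup>2 / 2) \<le> exp (c\<^sup>2 + (u\<^sup>2 - c * u))" by simp
  also have "\<dots> = exp (c\<^sup>2) * (exp (u\<^sup>2) * exp (- c * u))" by (simp flip: exp_add)
  finally have "exp (ln x / 2) \<le> exp (c\<^sup>2) * (x * exp (- c * u))" using x by (simp add: u2)
  moreover have "exp (ln x / 2) = sqrt x"
  proof -
    have "(exp (ln x / 2))\<^sup>2 = x" using x by (simp flip: exp_of_nat_mult)
    thus ?thesis by (metis exp_ge_zero real_sqrt_unique)
  qed
  ultimately show ?thesis by (simp add: u_def)
qed

text \<open>Summation by parts expresses \<Sum> b(n) through the deviations \<open>e n\<close>
  alone, so the limit m drops out except for e(0) = -m. For n \<ge> sqrt N the root of log n is at
  least half that of log N, which is why the rate is halved; the smaller n number at most sqrt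
  N.\<close>

lemma partial_summation_bound:
  fixes b :: "nat \<Rightarrow> real"
  assumes \<eta>: "\<eta> > 0"
    and est: "\<And>N. N > 0 \<Longrightarrow> \<bar>(\<Sum>n=1..N. b n / real n) - m\<bar> \<le> C * exp (- \<eta> * sqrt (ln (real N)))"
  shows "\<exists>C'>0. \<forall>N>0. \<bar>\<Sum>n=1..N. b n\<bar> \<le> C' * (real N * exp (- (\<eta> / 2) * sqrt (ln (real N))))"
proof -
  define e where "e = (\<lambda>n. (\<Sum>i=1..n. b i / real i) - m)"
  have C: "C \<ge> 0"
  proof -
    have "0 \<le> C * exp (- \<eta> * sqrt (ln (real 1)))" using est[of 1] by (smt (verit) zero_less_one)
    thus ?thesis by simp
  qed
  define D where "D = C + (\<bar>m\<bar> + C) * exp ((\<eta> / 2)\<^sup>2) + C"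
  have "\<bar>\<Sum>n=1..N. b n\<bar> \<le> D * (real N * exp (- (\<eta> / 2) * sqrt (ln (real N))))" if N: "N > 0" for N
  proof -
    define X where "X = exp (- (\<eta> / 2) * sqrt (ln (real N)))"
    have "(\<Sum>n=1..N. b n) = real N * e N - (\<Sum>n<N. e n)" for N
    proof (induction N)
      case (Suc N)
      have "e (Suc N) = e N + b (Suc N) / real (Suc N)" by (simp add: e_def)
      hence "real (Suc N) * e (Suc N) = real (Suc N) * e N + b (Suc N)" by (simp add: field_simps)
      thus ?case using Suc by (simp add: algebra_simps)
    qed simp
    hence "\<bar>\<Sum>n=1..N. b n\<bar> \<le> real N * \<bar>e N\<bar> + (\<Sum>n<N. \<bar>e n\<bar>)"
      using sum_abs[of e "{..<N}"] by (simp add: abs_mult order_trans[OF abs_triangle_ineq4])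
    also have "\<bar>e N\<bar> \<le> C * X"
    proof -
      have "\<bar>e N\<bar> \<le> C * exp (- \<eta> * sqrt (ln (real N)))" using est[OF N] by (simp add: e_def)
      also have "\<dots> \<le> C * X" unfolding X_def using \<eta> C N by (intro mult_left_mono) auto
      finally show ?thesis .
    qed
    hence "real N * \<bar>e N\<bar> \<le> real N * (C * X)" by (intro mult_left_mono) auto
    \<comment> \<open>Three ranges: n = 0, where e(0) = -m; small n, where the saving is given up;
      and n \<ge> sqrt N with the halved rate.\<close>
    also have "(\<Sum>n<N. \<bar>e n\<bar>) \<le> (\<Sum>n<N. (if n = 0 then \<bar>m\<bar> else 0) + (if 0 < n \<and> real n < sqrt N then C else 0) + C * X)"
    proof (rule sum_mono)
      fix n assume n: "n \<in> {..<N}"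
      have CX: "C * X \<ge> 0" using C by (simp add: X_def)
      show "\<bar>e n\<bar> \<le> (if n = 0 then \<bar>m\<bar> else 0) + (if 0 < n \<and> real n < sqrt N then C else 0) + C * X"
      proof (cases "n = 0")
        case True thus ?thesis using CX by (simp add: e_def)
      next
        case False
        have en: "\<bar>e n\<bar> \<le> C * exp (- \<eta> * sqrt (ln (real n)))" using est[of n] False by (simp add: e_def)
        show ?thesis
        proof (cases "real n < sqrt N")
          case True
          have "C * exp (- \<eta> * sqrt (ln (real n))) \<le> C * 1"
            using C \<eta> False by (intro mult_left_mono) auto
          thus ?thesis using en True False CX by simp
        next
          case *: False
          have "ln (sqrt N) \<le> ln (real n)" using * False N by (subst ln_le_cancel_iff) auto
          hence "ln (real N) / 2 \<le> ln (real n)" using N by (simp add: ln_sqrt)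
          moreover have "ln (real N) \<ge> 0" using N by simp
          ultimately have "ln (real N) / 4 \<le> ln (real n)" by linarith
          hence "sqrt (ln (real N) / 4) \<le> sqrt (ln (real n))" by simp
          hence "sqrt (ln (real N)) / 2 \<le> sqrt (ln (real n))" by (simp add: real_sqrt_divide)
          hence "(\<eta> / 2) * sqrt (ln (real N)) \<le> \<eta> * sqrt (ln (real n))" using \<eta> by (simp add: field_simps)
          hence "C * exp (- \<eta> * sqrt (ln (real n))) \<le> C * X" unfolding X_def using C by (intro mult_left_mono) auto
          thus ?thesis using en * False by simp
        qed
      qed
    qed
    also have "\<dots> = \<bar>m\<bar> + C * real (card {n\<in>{..<N}. 0 < n \<and> real n < sqrt N}) + real N * (C * X)"
      using N by (simp add: sum.distrib sum.If_cases Int_def Collect_conj_eq[symmetric] conj_ac)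
    also have "real (card {n\<in>{..<N}. 0 < n \<and> real n < sqrt N}) \<le> sqrt N"
    proof -
      have "{n\<in>{..<N}. 0 < n \<and> real n < sqrt N} \<subseteq> {1..nat \<lfloor>sqrt N\<rfloor>}"
        by (auto simp: le_nat_floor)
      from card_mono[OF _ this] have "card {n\<in>{..<N}. 0 < n \<and> real n < sqrt N} \<le> nat \<lfloor>sqrt N\<rfloor>"
        by simp
      hence "real (card {n\<in>{..<N}. 0 < n \<and> real n < sqrt N}) \<le> real (nat \<lfloor>sqrt N\<rfloor>)" by (simp only: of_nat_le_iff)
      also have "\<dots> \<le> sqrt N" by (rule of_nat_floor) simp
      finally show ?thesis .
    qed
    hence "C * real (card {n\<in>{..<N}. 0 < n \<and> real n < sqrt N}) \<le> C * sqrt N" using C by (rule mult_left_mono)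
    also have "\<bar>m\<bar> \<le> \<bar>m\<bar> * sqrt N" using N by (simp add: mult_le_cancel_left1)
    finally have "\<bar>\<Sum>n=1..N. b n\<bar> \<le> real N * (C * X) + ((\<bar>m\<bar> + C) * sqrt N + real N * (C * X))"
      by (simp add: algebra_simps)
    also have "(\<bar>m\<bar> + C) * sqrt N \<le> (\<bar>m\<bar> + C) * (exp ((\<eta> / 2)\<^sup>2) * (real N * X))"
      unfolding X_def using exp_sqrt_ln_le[of "real N" "\<eta> / 2"] N \<eta> C by (intro mult_left_mono) auto
    finally show ?thesis unfolding D_def X_def[symmetric] by (simp add: algebra_simps)
  qed
  moreover have "D \<le> D + 1" "D + 1 > 0" using C by (auto simp: D_def intro!: add_nonneg_pos add_nonneg_nonneg mult_nonneg_nonneg)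
  ultimately show ?thesis
    by (intro exI[of _ "D + 1"]) (meson mult_right_mono order_trans mult_nonneg_nonneg of_nat_0_le_iff exp_ge_zero)
qed

lemma sum_real_eq_sum_nat:
  assumes "x \<ge> 0"
  shows "(\<Sum>n | n > 0 \<and> real n \<le> x. b n) = (\<Sum>n=1..nat \<lfloor>x\<rfloor>. b n)"
  by (rule sum.cong) (use assms in \<open>auto simp: le_nat_floor le_nat_iff le_floor_iff\<close>)

theorem mob_sgn_mult_bound:
  assumes a: "sgn_mult a" and H: "continuation a d H"
    and H2: "continuation (\<lambda>n. (a n)\<^sup>2) d2 H2" and Z: "continuation (\<lambda>_. 1) d1 Z"
  obtains c C where "c > 0" "C > 0"
    "\<And>x. x \<ge> 1 \<Longrightarrow> \<bar>\<Sum>n | n > 0 \<and> real n \<le> x. mob n * a n\<bar> \<le> C * (x * exp (- c * sqrt (ln x)))"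
proof -
  obtain c where c: "0 < c" "c \<le> 1/4" "\<And>s. Re s > 1 - c / ell (Im s) \<Longrightarrow> H s \<noteq> 0"
    by (rule zero_free_region[OF a H H2 Z]) blast
  obtain m \<eta> C U where \<eta>: "\<eta> > 0" and C: "C > 0" and est: "\<And>N. N > 0 \<Longrightarrow> sqrt (ln (real N)) \<ge> U \<Longrightarrow>
       \<bar>(\<Sum>n=1..N. mob n * a n / real n) - m\<bar> \<le> C * exp (- \<eta> * sqrt (ln (real N)))"
    by (rule mob_over_n_estimate[OF a H c(1,2) c(3)]) auto
  have ma: "\<bar>mob n * a n\<bar> \<le> 1" for n
    by (rule abs_mob_mult_le[OF a])
  obtain N0 :: nat where N0: "real N0 > exp (U\<^sup>2) + 1" using reals_Archimedean2 by blast
  \<comment> \<open>The second summand takes care of N < \<open>N0\<close>, where the sum is bounded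
    by the number of its terms.\<close>
  define C1 where "C1 = C + (real N0 + \<bar>m\<bar>) * exp (\<eta> * sqrt (ln (real N0)))"
  have all: "\<bar>(\<Sum>n=1..N. mob n * a n / real n) - m\<bar> \<le> C1 * exp (- \<eta> * sqrt (ln (real N)))" if N: "N > 0" for N
  proof (cases "N \<ge> N0")
    case True
    have "exp (U\<^sup>2) \<le> real N" using N0 True by linarith
    hence "ln (exp (U\<^sup>2)) \<le> ln (real N)" using N by (subst ln_le_cancel_iff) auto
    hence "sqrt (U\<^sup>2) \<le> sqrt (ln (real N))" by (intro real_sqrt_le_mono) simp
    hence "U \<le> sqrt (ln (real N))" by simp
    from est[OF N this] show ?thesis
      by (rule order_trans) (auto simp: C1_def intro!: mult_right_mono)
  next
    case False
    have "\<bar>\<Sum>n=1..N. mob n * a n / real n\<bar> \<le> (\<Sum>n=1..N. 1)"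
    proof (rule order_trans[OF sum_abs sum_mono])
      fix n assume "n \<in> {1..N}"
      hence "\<bar>mob n * a n\<bar> / real n \<le> 1 / 1" using ma by (intro frac_le) auto
      thus "\<bar>mob n * a n / real n\<bar> \<le> 1" by simp
    qed
    hence "\<bar>(\<Sum>n=1..N. mob n * a n / real n) - m\<bar> \<le> real N0 + \<bar>m\<bar>" using False by simp
    also have "\<dots> = (real N0 + \<bar>m\<bar>) * (exp (\<eta> * sqrt (ln (real N0))) * exp (- \<eta> * sqrt (ln (real N0))))"
      by (simp flip: exp_add)
    also have "\<dots> \<le> (real N0 + \<bar>m\<bar>) * (exp (\<eta> * sqrt (ln (real N0))) * exp (- \<eta> * sqrt (ln (real N))))"
      using False N \<eta> by (intro mult_left_mono) auto
    also have "\<dots> \<le> C1 * exp (- \<eta> * sqrt (ln (real N)))"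
      using C by (simp add: C1_def algebra_simps)
    finally show ?thesis .
  qed
  define \<theta> where "\<theta> = \<eta> / 2"
  have \<theta>: "\<theta> > 0" using \<eta> by (simp add: \<theta>_def)
  obtain C' where C': "C' > 0" "\<And>N. N > 0 \<Longrightarrow> \<bar>\<Sum>n=1..N. mob n * a n\<bar> \<le> C' * (real N * exp (- \<theta> * sqrt (ln (real N))))"
    using partial_summation_bound[OF \<eta> all] unfolding \<theta>_def by blast
  show thesis
  proof (rule that[of \<theta> "C' * exp \<theta>"])
    fix x :: real assume x: "x \<ge> 1"
    define N where "N = nat \<lfloor>x\<rfloor>"
    have N: "N > 0" "real N \<le> x" "x < real N + 1" using x by (auto simp: N_def)
    hence "x / 2 \<le> real N" by linarith
    hence "ln (x / 2) \<le> ln (real N)" using x N by (subst ln_le_cancel_iff) auto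
    hence "ln x \<le> ln (real N) + ln 2" using x by (simp add: ln_div)
    also have "\<dots> \<le> ln (real N) + 1" using ln_2_less_1 by simp
    finally have "sqrt (ln x) \<le> sqrt (ln (real N) + 1)" by simp
    also have "\<dots> \<le> sqrt (ln (real N)) + sqrt 1" using N by (intro sqrt_add_le_add_sqrt) auto
    finally have "\<theta> * sqrt (ln x) \<le> \<theta> * (sqrt (ln (real N)) + 1)" using \<theta> by (intro mult_left_mono) auto
    hence "exp (- \<theta> * sqrt (ln (real N))) \<le> exp (\<theta> + - \<theta> * sqrt (ln x))" by (simp add: algebra_simps)
    hence "real N * exp (- \<theta> * sqrt (ln (real N))) \<le> x * (exp \<theta> * exp (- \<theta> * sqrt (ln x)))"
      using N x unfolding exp_add by (intro mult_mono) auto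
    hence "C' * (real N * exp (- \<theta> * sqrt (ln (real N)))) \<le> C' * (x * (exp \<theta> * exp (- \<theta> * sqrt (ln x))))"
      using C'(1) by (intro mult_left_mono) auto
    with C'(2)[OF N(1)] have "\<bar>\<Sum>n=1..N. mob n * a n\<bar> \<le> C' * exp \<theta> * (x * exp (- \<theta> * sqrt (ln x)))"
      by (simp add: mult_ac)
    thus "\<bar>\<Sum>n | n > 0 \<and> real n \<le> x. mob n * a n\<bar> \<le> C' * exp \<theta> * (x * exp (- \<theta> * sqrt (ln x)))"
      using sum_real_eq_sum_nat[of x "\<lambda>n. mob n * a n"] x by (simp add: N_def)
  qed (use \<theta> C' in auto)
qed

subsection \<open>Sums over integers composed of few primes\<close>

text \<open>A finite Euler product, one prime at a time: the exact power of p is split off and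
  contributes a geometric series. For an upper bound, submultiplicativity takes the place of
  multiplicativity.\<close>

lemma smooth_sum_le_prod:
  fixes w :: "nat \<Rightarrow> real"
  assumes w0: "\<And>n. w n \<ge> 0" and w1: "w 1 \<le> 1" and sub: "\<And>m n. m > 0 \<Longrightarrow> n > 0 \<Longrightarrow> w (m * n) \<le> w m * w n"
    and P: "finite P" "\<And>p. p \<in> P \<Longrightarrow> prime p" "\<And>p. p \<in> P \<Longrightarrow> w p < 1"
    and D: "finite D" "\<And>n. n \<in> D \<Longrightarrow> n > 0 \<and> prime_factors n \<subseteq> P"
  shows "(\<Sum>n\<in>D. w n) \<le> (\<Prod>p\<in>P. 1 / (1 - w p))"
  using P D
proof (induction P arbitrary: D rule: finite_induct)
  case empty
  have "D \<subseteq> {1}"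
  proof
    fix n assume "n \<in> D"
    hence "n > 0" "prime_factors n = {}" using empty by auto
    thus "n \<in> {1}" using prime_factorization_empty_iff[of n] by auto
  qed
  hence "(\<Sum>n\<in>D. w n) \<le> (\<Sum>n\<in>{1}. w n)" using w0 by (intro sum_mono2) auto
  thus ?case using w1 by simp
next
  case (insert p P)
  define j where "j = (\<lambda>n. multiplicity p n)"
  define m where "m = (\<lambda>n. n div p ^ multiplicity p n)"
  have p: "prime p" "w p < 1" "p > 0" using insert.prems by (auto simp: prime_gt_0_nat)
  have dec: "n = p ^ j n * m n" "m n > 0" "prime_factors (m n) \<subseteq> P" if n: "n \<in> D" for n
  proof -
    have n0: "n > 0" "prime_factors n \<subseteq> insert p P" using insert.prems n by auto
    have "p ^ j n dvd n" by (simp add: j_def multiplicity_dvd)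
    thus e: "n = p ^ j n * m n" by (simp add: m_def j_def)
    thus m0: "m n > 0" using n0 by (metis gr0I mult_0_right)
    have "\<not> p dvd m n"
      using multiplicity_decompose[of n p] n0 prime_gt_1_nat[OF p(1)] by (auto simp: m_def)
    moreover have "prime_factors (m n) \<subseteq> prime_factors n"
      using n0 e by (intro dvd_prime_factors) (auto intro: dvdI[of _ _ "p ^ j n"] simp: mult.commute)
    ultimately show "prime_factors (m n) \<subseteq> P" using n0(2) by auto
  qed
  have wpow: "w (p ^ i) \<le> w p ^ i" for i
  proof (induction i)
    case (Suc i)
    have "w (p * p ^ i) \<le> w p * w (p ^ i)" using p by (intro sub) auto
    also have "\<dots> \<le> w p * w p ^ i" using Suc w0 by (intro mult_left_mono) auto
    finally show ?case by simp
  qed (use w1 in simp)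
  define J where "J = Max (insert 0 (j ` D))"
  have J: "j n \<le> J" if "n \<in> D" for n
    unfolding J_def using that insert.prems by (intro Max_ge) auto
  have inj: "inj_on (\<lambda>n. (j n, m n)) D"
    by (rule inj_onI) (metis dec(1) prod.inject)
  have "(\<Sum>n\<in>D. w n) \<le> (\<Sum>n\<in>D. w p ^ j n * w (m n))"
  proof (rule sum_mono)
    fix n assume n: "n \<in> D"
    have "w n \<le> w (p ^ j n) * w (m n)"
      using sub[of "p ^ j n" "m n"] dec[OF n] p by simp
    also have "\<dots> \<le> w p ^ j n * w (m n)" using wpow w0 by (intro mult_right_mono) auto
    finally show "w n \<le> w p ^ j n * w (m n)" .
  qed
  also have "\<dots> = (\<Sum>(i,e)\<in>(\<lambda>n. (j n, m n)) ` D. w p ^ i * w e)"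
    using inj by (simp add: sum.reindex)
  also have "\<dots> \<le> (\<Sum>(i,e)\<in>{..J} \<times> m ` D. w p ^ i * w e)"
    using J w0 insert.prems by (intro sum_mono2) auto
  also have "\<dots> = (\<Sum>i\<le>J. w p ^ i) * (\<Sum>e\<in>m ` D. w e)"
    by (simp add: sum_product sum.cartesian_product)
  also have "\<dots> \<le> (1 / (1 - w p)) * (\<Prod>p\<in>P. 1 / (1 - w p))"
  proof (rule mult_mono)
    have "(\<Sum>i\<le>J. w p ^ i) = (1 - w p ^ Suc J) / (1 - w p)"
      using p by (simp add: sum_gp0)
    also have "\<dots> \<le> 1 / (1 - w p)" using p w0 by (intro divide_right_mono) auto
    finally show "(\<Sum>i\<le>J. w p ^ i) \<le> 1 / (1 - w p)" .
    show "(\<Sum>e\<in>m ` D. w e) \<le> (\<Prod>p\<in>P. 1 / (1 - w p))"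
    proof (rule insert.IH)
      show "e > 0 \<and> prime_factors e \<subseteq> P" if "e \<in> m ` D" for e
        using dec(2,3) that by blast
    qed (use insert.prems in auto)
  qed (use p w0 in \<open>auto intro: sum_nonneg\<close>)
  finally show ?case using insert.hyps by simp
qed

text \<open>1/(1 - w) \<le> exp(w/(1 - \<theta>)) for w \<le> \<theta> turns the Euler product into
  the exponential of the sum over primes, uniformly in \<open>D\<close>.\<close>

lemma smooth_sum_bounded:
  fixes w :: "nat \<Rightarrow> real"
  assumes w0: "\<And>n. w n \<ge> 0" and w1: "w 1 \<le> 1" and sub: "\<And>m n. m > 0 \<Longrightarrow> n > 0 \<Longrightarrow> w (m * n) \<le> w m * w n"
    and \<theta>: "\<theta> < 1" "\<And>p. prime p \<Longrightarrow> w p \<le> \<theta>"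
    and S: "\<And>F. finite F \<Longrightarrow> F \<subseteq> {p. prime p \<and> bad p} \<Longrightarrow> (\<Sum>p\<in>F. w p) \<le> S"
  shows "\<exists>W>0. \<forall>D. finite D \<longrightarrow> (\<forall>n\<in>D. n > 0 \<and> (\<forall>p. prime p \<and> p dvd n \<longrightarrow> bad p)) \<longrightarrow> (\<Sum>n\<in>D. w n) \<le> W"
proof (intro exI conjI allI impI)
  show "exp (S / (1 - \<theta>)) > 0" by simp
  fix D :: "nat set" assume D: "finite D" "\<forall>n\<in>D. n > 0 \<and> (\<forall>p. prime p \<and> p dvd n \<longrightarrow> bad p)"
  define P where "P = (\<Union>n\<in>D. prime_factors n)"
  have P: "finite P" "P \<subseteq> {p. prime p \<and> bad p}" using D by (auto simp: P_def)
  have "(\<Sum>n\<in>D. w n) \<le> (\<Prod>p\<in>P. 1 / (1 - w p))"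
  proof (rule smooth_sum_le_prod[OF w0 w1 sub P(1)])
    show "w p < 1" if "p \<in> P" for p using \<theta>(1) \<theta>(2)[of p] P that by force
    show "n > 0 \<and> prime_factors n \<subseteq> P" if "n \<in> D" for n using D that by (auto simp: P_def)
  qed (use P D in auto)
  also have "\<dots> \<le> (\<Prod>p\<in>P. exp (w p / (1 - \<theta>)))"
  proof (rule prod_mono)
    fix p assume p: "p \<in> P"
    have wp: "w p \<le> \<theta>" using \<theta>(2) P p by auto
    have "1 / (1 - w p) = 1 + w p / (1 - w p)" using wp \<theta> by (simp add: field_simps)
    also have "\<dots> \<le> 1 + w p / (1 - \<theta>)" using wp \<theta> w0[of p] by (intro add_left_mono divide_left_mono mult_pos_pos) auto
    also have "\<dots> \<le> exp (w p / (1 - \<theta>))" by (rule exp_ge_add_one_self)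
    finally show "0 \<le> 1 / (1 - w p) \<and> 1 / (1 - w p) \<le> exp (w p / (1 - \<theta>))" using wp \<theta> by simp
  qed
  also have "\<dots> = exp ((\<Sum>p\<in>P. w p) / (1 - \<theta>))"
    using P(1) by (simp add: exp_sum sum_divide_distrib)
  also have "\<dots> \<le> exp (S / (1 - \<theta>))"
    using S[OF P] \<theta> by (simp add: divide_right_mono)
  finally show "(\<Sum>n\<in>D. w n) \<le> exp (S / (1 - \<theta>))" .
qed

lemma finite_real_bounded: "finite {n :: nat. P n \<and> real n \<le> x}"
  by (rule finite_subset[of _ "{..nat \<lfloor>x\<rfloor>}"]) (auto simp: le_nat_floor)

text \<open>The coefficients live on integers composed of primes with u(p) \<noteq> v(p) and are at
  most the number of divisors. Distributing the weight over \<open>d\<close> and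
  \<open>n div d\<close> majorises the sum by the square of a sum over such integers.\<close>

lemma dconv_quotient_weighted_sum:
  assumes u: "sgn_mult u" and v: "sgn_mult v" and w0: "\<And>n. w n \<ge> 0"
    and sub: "\<And>m n. m > 0 \<Longrightarrow> n > 0 \<Longrightarrow> w (m * n) \<le> w m * w n"
    and W: "\<And>D. finite D \<Longrightarrow> (\<forall>n\<in>D. n > 0 \<and> (\<forall>p. prime p \<and> p dvd n \<longrightarrow> u p \<noteq> v p)) \<Longrightarrow> (\<Sum>n\<in>D. w n) \<le> W"
  shows "(\<Sum>n | n > 0 \<and> real n \<le> x. \<bar>dconv (\<lambda>d. mob d * u d) v n\<bar> * w n) \<le> W\<^sup>2"
proof -
  define Q where "Q = {n. (n > 0 \<and> (\<forall>p. prime p \<and> p dvd n \<longrightarrow> u p \<noteq> v p)) \<and> real n \<le> x}"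
  have fin: "finite Q" unfolding Q_def by (rule finite_real_bounded)
  have finx: "finite {n. n > 0 \<and> real n \<le> x}" by (rule finite_real_bounded)
  have "(\<Sum>n | n > 0 \<and> real n \<le> x. \<bar>dconv (\<lambda>d. mob d * u d) v n\<bar> * w n) = (\<Sum>n\<in>Q. \<bar>dconv (\<lambda>d. mob d * u d) v n\<bar> * w n)"
  proof (rule sum.mono_neutral_right[OF finx])
    show "\<forall>n\<in>{n. n > 0 \<and> real n \<le> x} - Q. \<bar>dconv (\<lambda>d. mob d * u d) v n\<bar> * w n = 0"
      using mob_conv_eq_0[OF u v] by (auto simp: Q_def)
  qed (auto simp: Q_def)
  also have "\<dots> \<le> (\<Sum>n\<in>Q. \<Sum>d | d dvd n. w d * w (n div d))"
  proof (rule sum_mono)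
    fix n assume n: "n \<in> Q"
    have "\<bar>dconv (\<lambda>d. mob d * u d) v n\<bar> \<le> (\<Sum>d | d dvd n. \<bar>mob d * u d * v (n div d)\<bar>)"
      unfolding dconv_def by (rule sum_abs)
    also have "\<dots> \<le> (\<Sum>d | d dvd n. 1)"
    proof (rule sum_mono)
      fix d
      have "\<bar>mob d\<bar> * \<bar>u d\<bar> * \<bar>v (n div d)\<bar> \<le> 1 * 1 * 1"
        using abs_mob_le sgn_multD(3)[OF u] sgn_multD(3)[OF v] by (intro mult_mono) auto
      thus "\<bar>mob d * u d * v (n div d)\<bar> \<le> 1" by (simp add: abs_mult)
    qed
    finally have "\<bar>dconv (\<lambda>d. mob d * u d) v n\<bar> * w n \<le> (\<Sum>d | d dvd n. 1) * w n"
      using w0 by (intro mult_right_mono) auto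
    also have "\<dots> = (\<Sum>d | d dvd n. w n)" by simp
    also have "\<dots> \<le> (\<Sum>d | d dvd n. w d * w (n div d))"
    proof (rule sum_mono)
      fix d assume "d \<in> {d. d dvd n}"
      then obtain e where e: "n = d * e" by auto
      hence "d > 0" "e > 0" using n by (auto simp: Q_def)
      thus "w n \<le> w d * w (n div d)" using sub[of d e] e by simp
    qed
    finally show "\<bar>dconv (\<lambda>d. mob d * u d) v n\<bar> * w n \<le> (\<Sum>d | d dvd n. w d * w (n div d))" .
  qed
  also have "\<dots> = (\<Sum>(n,d)\<in>(SIGMA n:Q. {d. d dvd n}). w d * w (n div d))"
    using fin by (subst sum.Sigma) (auto simp: Q_def)
  also have "\<dots> = (\<Sum>(d,e)\<in>(\<lambda>(n,d). (d, n div d)) ` (SIGMA n:Q. {d. d dvd n}). w d * w e)"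
    by (subst sum.reindex) (auto simp: inj_on_def Q_def case_prod_unfold elim!: dvdE)
  also have "\<dots> \<le> (\<Sum>(d,e)\<in>Q \<times> Q. w d * w e)"
  proof (rule sum_mono2)
    show "(\<lambda>(n,d). (d, n div d)) ` (SIGMA n:Q. {d. d dvd n}) \<subseteq> Q \<times> Q"
    proof (rule image_subsetI, clarify)
      fix n d assume n: "n \<in> Q" and "d dvd n"
      then obtain e where e: "n = d * e" by auto
      hence de: "d > 0" "e > 0" using n by (auto simp: Q_def)
      have "d \<le> n" "e \<le> n" using de e by auto
      hence "real d \<le> x" "real e \<le> x" using n by (auto simp: Q_def)
      thus "d \<in> Q \<and> n div d \<in> Q" using n de e by (auto simp: Q_def)
    qed
  qed (use fin w0 in auto)
  also have "\<dots> = (\<Sum>n\<in>Q. w n)\<^sup>2"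
    by (simp add: power2_eq_square sum_product sum.cartesian_product)
  also have "\<dots> \<le> W\<^sup>2"
    using W[OF fin] w0 by (intro power_mono sum_nonneg) (auto simp: Q_def)
  finally show ?thesis .
qed

text \<open>With \<kappa> = 1/k the first factor normalises by the trivial order of magnitude, and
  the second is the saving to be gained. It enters as exp(\<tau> sqrt(log n)) because sqrt(log(mn))
  \<le> sqrt(log m) + sqrt(log n) keeps the weight submultiplicative.\<close>

definition weight :: "real \<Rightarrow> real \<Rightarrow> nat \<Rightarrow> real" where
  "weight \<kappa> \<tau> n = real n powr (- \<kappa>) * exp (\<tau> * sqrt (ln (real n)))"

lemma weight_nonneg: "weight \<kappa> \<tau> n \<ge> 0"
  by (simp add: weight_def)

lemma weight_1: "weight \<kappa> \<tau> 1 = 1"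
  by (simp add: weight_def)

lemma weight_submult:
  assumes "\<tau> \<ge> 0" "m > 0" "n > 0"
  shows "weight \<kappa> \<tau> (m * n) \<le> weight \<kappa> \<tau> m * weight \<kappa> \<tau> n"
proof -
  have "sqrt (ln (real m) + ln (real n)) \<le> sqrt (ln (real m)) + sqrt (ln (real n))"
    using assms by (intro sqrt_add_le_add_sqrt) auto
  hence "\<tau> * sqrt (ln (real (m * n))) \<le> \<tau> * sqrt (ln (real m)) + \<tau> * sqrt (ln (real n))"
    using assms mult_left_mono[of _ _ \<tau>] by (simp add: ln_mult_pos flip: distrib_left)
  hence "exp (\<tau> * sqrt (ln (real (m * n)))) \<le> exp (\<tau> * sqrt (ln (real m))) * exp (\<tau> * sqrt (ln (real n)))"
    by (simp flip: exp_add)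
  hence "real (m * n) powr (- \<kappa>) * exp (\<tau> * sqrt (ln (real (m * n))))
      \<le> real (m * n) powr (- \<kappa>) * (exp (\<tau> * sqrt (ln (real m))) * exp (\<tau> * sqrt (ln (real n))))"
    by (intro mult_left_mono) auto
  also have "real (m * n) powr (- \<kappa>) = real m powr (- \<kappa>) * real n powr (- \<kappa>)"
    by (simp add: powr_mult)
  finally show ?thesis by (simp add: weight_def powr_mult mult_ac)
qed

text \<open>The condition on \<tau> is governed by the prime 2: it keeps the weight of every prime
  uniformly below 1, so that the Euler factors stay bounded.\<close>

lemma weight_prime_le:
  assumes \<tau>: "\<tau> \<le> \<kappa> * sqrt (ln 2) / 2" and n: "n \<ge> 2" and \<kappa>: "\<kappa> > 0"
  shows "weight \<kappa> \<tau> n \<le> exp (- (\<kappa> * ln 2 / 2))"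
proof -
  define s where "s = sqrt (ln (real n))"
  have l: "ln 2 \<le> ln (real n)" using n by simp
  have s2: "s\<^sup>2 = ln (real n)" using n by (simp add: s_def)
  have "sqrt (ln 2) \<le> s" using l by (simp add: s_def)
  hence "\<kappa> * sqrt (ln 2) / 2 \<le> \<kappa> * s / 2" using \<kappa> by simp
  hence "\<tau> \<le> \<kappa> * s / 2" using \<tau> by linarith
  hence "\<tau> * s \<le> (\<kappa> * s / 2) * s" by (rule mult_right_mono) (use n in \<open>auto simp: s_def\<close>)
  hence "\<tau> * s - \<kappa> * s\<^sup>2 \<le> - (\<kappa> * s\<^sup>2 / 2)" by (simp add: power2_eq_square)
  also have "\<dots> \<le> - (\<kappa> * ln 2 / 2)" using l \<kappa> s2 by simp
  finally have "exp (\<tau> * s - \<kappa> * s\<^sup>2) \<le> exp (- (\<kappa> * ln 2 / 2))" by simp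
  moreover have "weight \<kappa> \<tau> n = exp (\<tau> * s - \<kappa> * s\<^sup>2)"
    using n by (simp add: weight_def s2 powr_def s_def[symmetric] flip: exp_add)
  ultimately show ?thesis by simp
qed

text \<open>n^\<kappa> exp(-\<tau> sqrt(log n)) increases only from sqrt(log n) = \<tau>/(2\<kappa>)
  onwards; the factor exp(\<tau>^2/\<kappa>) makes up for the initial decrease.\<close>

lemma inverse_weight_le:
  assumes \<kappa>: "\<kappa> > 0" and \<tau>: "\<tau> \<ge> 0" and n: "n > 0" "real n \<le> y"
  shows "1 \<le> weight \<kappa> \<tau> n * (exp (\<tau>\<^sup>2 / \<kappa>) * (y powr \<kappa> * exp (- \<tau> * sqrt (ln y))))"
proof -
  define a b where "a = sqrt (ln (real n))" and "b = sqrt (ln y)"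
  have y: "y \<ge> 1" using n by linarith
  have ab: "0 \<le> a" "a \<le> b" using n y by (auto simp: a_def b_def)
  have a2: "a\<^sup>2 = ln (real n)" and b2: "b\<^sup>2 = ln y" using n y by (auto simp: a_def b_def)
  have "0 \<le> (- \<kappa> * a\<^sup>2 + \<tau> * a) + \<tau>\<^sup>2 / \<kappa> + (\<kappa> * b\<^sup>2 - \<tau> * b)"
  proof (cases "\<tau> \<le> \<kappa> * (a + b)")
    case True
    have "0 \<le> (b - a) * (\<kappa> * (a + b) - \<tau>)" using True ab by (intro mult_nonneg_nonneg) auto
    moreover have "0 \<le> \<tau>\<^sup>2 / \<kappa>" using \<kappa> by simp
    ultimately show ?thesis by (simp add: power2_eq_square algebra_simps)
  next
    case False
    hence "\<kappa> * (a + b) \<le> \<tau>" by simp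
    moreover have "\<kappa> * b \<le> \<kappa> * (a + b)" using ab \<kappa> by (intro mult_left_mono) auto
    ultimately have "\<kappa> * b \<le> \<tau>" by linarith
    hence "\<tau> * (\<kappa> * b) \<le> \<tau> * \<tau>" using \<tau> by (rule mult_left_mono)
    hence "\<tau> * b \<le> \<tau>\<^sup>2 / \<kappa>" using \<kappa> by (simp add: field_simps power2_eq_square)
    moreover have "a * a \<le> b * b" using ab by (intro mult_mono) auto
    hence "\<kappa> * (a * a) \<le> \<kappa> * (b * b)" using \<kappa> by (intro mult_left_mono) auto
    moreover have "0 \<le> \<tau> * a" using \<tau> ab by simp
    ultimately show ?thesis by (simp add: power2_eq_square)
  qed
  hence "exp 0 \<le> exp ((- \<kappa> * a\<^sup>2 + \<tau> * a) + (\<tau>\<^sup>2 / \<kappa> + (\<kappa> * b\<^sup>2 - \<tau> * b)))" by (subst exp_le_cancel_iff) simp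
  also have "\<dots> = exp (- \<kappa> * a\<^sup>2) * exp (\<tau> * a) * (exp (\<tau>\<^sup>2 / \<kappa>) * (exp (\<kappa> * b\<^sup>2) * exp (- \<tau> * b)))"
    by (simp flip: exp_add)
  also have "exp (- \<kappa> * a\<^sup>2) = real n powr (- \<kappa>)" using n by (simp add: a2 powr_def)
  also have "exp (\<kappa> * b\<^sup>2) = y powr \<kappa>" using y by (simp add: b2 powr_def)
  finally show ?thesis by (simp add: weight_def a_def b_def)
qed

text \<open>Dyadic blocks: up to X there are at most about X^\<kappa> exp(-c v) bad primes with v =
  sqrt(log X), each of weight about X^(-\<kappa>) exp(\<tau> v). Half of \<open>c\<close> pays for
  \<tau>, and the other half makes the sum over blocks converge.\<close>

lemma weight_sum_primes_bounded:
  assumes \<kappa>: "0 < \<kappa>" "\<kappa> \<le> 1" and c: "c > 0" and \<tau>: "0 \<le> \<tau>" "\<tau> \<le> c / 2"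
    and count: "\<And>x. x \<ge> 1 \<Longrightarrow> real (card {p. (prime p \<and> bad p) \<and> real p \<le> x}) \<le> C * (x powr \<kappa> * exp (- c * sqrt (ln x)))"
  shows "\<exists>S. \<forall>F. finite F \<longrightarrow> F \<subseteq> {p. prime p \<and> bad p} \<longrightarrow> (\<Sum>p\<in>F. weight \<kappa> \<tau> p) \<le> S"
proof -
  have C: "C \<ge> 0"
  proof -
    have "0 \<le> C * (1 powr \<kappa> * exp (- c * sqrt (ln 1)))" using count[of 1] of_nat_0_le_iff order_trans by blast
    thus ?thesis by simp
  qed
  define q where "q = (c / 2)\<^sup>2 * ln 2"
  have q: "q > 0" using c by (simp add: q_def)
  \<comment> \<open>exp(z) \<ge> (z/4)^4 with z = (c/2) sqrt((j+1) log 2) gives z^4 = (q(j+1))^2 and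
    the constant 256; the factor 2 bounds 2^\<kappa> from comparing X/2 with X.\<close>
  define T where "T = (\<lambda>j::nat. 2 * C * (256 / q\<^sup>2) * (1 / (real (Suc j))\<^sup>2))"
  have sT: "summable T"
  proof -
    have "summable (\<lambda>n. 1 / (real n)\<^sup>2)" using inverse_power_summable[of 2, where 'a = real] by (simp add: field_simps)
    hence "summable (\<lambda>j. 1 / (real (Suc j))\<^sup>2)" by (subst summable_Suc_iff)
    thus ?thesis unfolding T_def by (rule summable_mult)
  qed
  have T0: "T j \<ge> 0" for j using C by (simp add: T_def)
  have blk: "(\<Sum>p\<in>F \<inter> {2 ^ j..<2 ^ Suc j}. weight \<kappa> \<tau> p) \<le> T j"
    if F: "finite F" "F \<subseteq> {p. prime p \<and> bad p}" for F j
  proof -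
    define X where "X = (2::real) ^ Suc j"
    have X: "X \<ge> 1" unfolding X_def by (rule one_le_power) simp
    define v where "v = sqrt (ln X)"
    have v2: "v\<^sup>2 = ln X" using X by (simp add: v_def)
    have lnX: "ln X = real (Suc j) * ln 2" unfolding X_def by (subst ln_realpow) auto
    define V where "V = (X / 2) powr (- \<kappa>) * exp (\<tau> * v)"
    have V0: "V \<ge> 0" by (simp add: V_def)
    have "(\<Sum>p\<in>F \<inter> {2 ^ j..<2 ^ Suc j}. weight \<kappa> \<tau> p) \<le> (\<Sum>p\<in>F \<inter> {2 ^ j..<2 ^ Suc j}. V)"
    proof (rule sum_mono)
      fix p assume p: "p \<in> F \<inter> {2 ^ j..<2 ^ Suc j}"
      have "real (2 ^ j) \<le> real p" "real p \<le> real (2 ^ Suc j)" using p by (auto simp only: of_nat_le_iff Int_iff atLeastLessThan_iff)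
      hence pX: "X / 2 \<le> real p" "real p \<le> X" by (simp_all add: X_def)
      have p0: "p > 0" using p F by (auto simp: prime_gt_0_nat)
      have "real p powr (- \<kappa>) \<le> (X / 2) powr (- \<kappa>)" using pX X \<kappa> by (intro powr_mono2') auto
      moreover have "sqrt (ln (real p)) \<le> v" unfolding v_def using pX p0 X by simp
      hence "exp (\<tau> * sqrt (ln (real p))) \<le> exp (\<tau> * v)" using \<tau> by (simp add: mult_left_mono)
      ultimately show "weight \<kappa> \<tau> p \<le> V" unfolding weight_def V_def by (intro mult_mono) auto
    qed
    also have "\<dots> = real (card (F \<inter> {2 ^ j..<2 ^ Suc j})) * V" by simp
    also have "\<dots> \<le> (C * (X powr \<kappa> * exp (- c * v))) * V"
    proof (rule mult_right_mono[OF _ V0])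
      have "F \<inter> {2 ^ j..<2 ^ Suc j} \<subseteq> {p. (prime p \<and> bad p) \<and> real p \<le> X}"
      proof
        fix p assume p: "p \<in> F \<inter> {2 ^ j..<2 ^ Suc j}"
        have "real p \<le> real (2 ^ Suc j)" using p by (auto simp only: of_nat_le_iff Int_iff atLeastLessThan_iff)
        thus "p \<in> {p. (prime p \<and> bad p) \<and> real p \<le> X}" using p F by (auto simp: X_def)
      qed
      from card_mono[OF finite_real_bounded this]
      have "real (card (F \<inter> {2 ^ j..<2 ^ Suc j})) \<le> real (card {p. (prime p \<and> bad p) \<and> real p \<le> X})" by simp
      also have "\<dots> \<le> C * (X powr \<kappa> * exp (- c * v))" unfolding v_def by (rule count[OF X])
      finally show "real (card (F \<inter> {2 ^ j..<2 ^ Suc j})) \<le> C * (X powr \<kappa> * exp (- c * v))" .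
    qed
    also have "\<dots> = C * (2 powr \<kappa>) * exp (\<tau> * v - c * v)"
      using X by (simp add: V_def powr_divide powr_minus exp_diff exp_minus field_simps)
    also have "\<dots> \<le> C * 2 * exp (- (c / 2 * v))"
    proof (intro mult_mono)
      show "2 powr \<kappa> \<le> (2::real)" using powr_mono[of \<kappa> 1 2] \<kappa> by simp
      have "\<tau> * v \<le> c / 2 * v" using \<tau> X by (intro mult_right_mono) (auto simp: v_def)
      thus "exp (\<tau> * v - c * v) \<le> exp (- (c / 2 * v))" by (simp add: algebra_simps)
    qed (use C in auto)
    also have "exp (- (c / 2 * v)) \<le> 256 / (c / 2 * v) ^ 4"
    proof -
      define z where "z = c / 2 * v"
      have z: "z > 0" using c lnX by (simp add: z_def v_def)
      have "(z / 4) ^ 4 \<le> (1 + z / real 4) ^ 4" using z by (intro power_mono) auto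
      also have "\<dots> \<le> exp z" by (rule exp_ge_one_plus_x_over_n_power_n) (use z in auto)
      finally have "z ^ 4 / 256 \<le> exp z" by (simp add: power_divide)
      hence "1 / exp z \<le> 1 / (z ^ 4 / 256)" using z by (intro divide_left_mono mult_pos_pos) auto
      thus ?thesis unfolding z_def[symmetric] by (simp add: exp_minus field_simps)
    qed
    hence "C * 2 * exp (- (c / 2 * v)) \<le> C * 2 * (256 / (c / 2 * v) ^ 4)" using C by (intro mult_left_mono) auto
    also have "(c / 2 * v) ^ 4 = (q * real (Suc j))\<^sup>2"
    proof -
      have "(c / 2 * v) ^ 4 = ((c / 2 * v)\<^sup>2)\<^sup>2" by (simp flip: power_mult)
      also have "(c / 2 * v)\<^sup>2 = q * real (Suc j)" unfolding power_mult_distrib[of "c / 2"] v2 lnX q_def by (simp only: mult_ac)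
      finally show ?thesis .
    qed
    also have "C * 2 * (256 / (q * real (Suc j))\<^sup>2) = T j" by (simp add: T_def power_mult_distrib)
    finally show ?thesis .
  qed
  have "(\<Sum>p\<in>F. weight \<kappa> \<tau> p) \<le> suminf T" if F: "finite F" "F \<subseteq> {p. prime p \<and> bad p}" for F
  proof -
    have ex: "\<exists>j. p \<in> {2 ^ j..<2 ^ Suc j}" if "p \<in> F" for p
      using ex_power_ivl1[of 2 p] F that prime_gt_0_nat[of p] by auto
    then obtain J where J: "\<And>p. p \<in> F \<Longrightarrow> p \<in> {2 ^ J p..<2 ^ Suc (J p)}" by metis
    define M where "M = Suc (Max (insert 0 (J ` F)))"
    have JM: "J p < M" if "p \<in> F" for p
      unfolding M_def using F that by (intro le_imp_less_Suc Max_ge) auto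
    have "(\<Sum>p\<in>F. weight \<kappa> \<tau> p) \<le> (\<Sum>p\<in>F. \<Sum>j<M. if p \<in> {2 ^ j..<2 ^ Suc j} then weight \<kappa> \<tau> p else 0)"
    proof (rule sum_mono)
      fix p assume p: "p \<in> F"
      have "(if p \<in> {2 ^ J p..<2 ^ Suc (J p)} then weight \<kappa> \<tau> p else 0)
          \<le> (\<Sum>j<M. if p \<in> {2 ^ j..<2 ^ Suc j} then weight \<kappa> \<tau> p else 0)"
        by (rule member_le_sum[of "J p"]) (use JM[OF p] weight_nonneg in auto)
      thus "weight \<kappa> \<tau> p \<le> (\<Sum>j<M. if p \<in> {2 ^ j..<2 ^ Suc j} then weight \<kappa> \<tau> p else 0)"
        using J[OF p] by (simp only: if_True)
    qed
    also have "\<dots> = (\<Sum>j<M. \<Sum>p\<in>F. if p \<in> {2 ^ j..<2 ^ Suc j} then weight \<kappa> \<tau> p else 0)"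
      by (rule sum.swap)
    also have "\<dots> = (\<Sum>j<M. \<Sum>p\<in>F \<inter> {2 ^ j..<2 ^ Suc j}. weight \<kappa> \<tau> p)"
      using F by (simp only: sum.inter_restrict)
    also have "\<dots> \<le> (\<Sum>j<M. T j)" using blk F by (intro sum_mono) auto
    also have "\<dots> \<le> suminf T" using sT T0 by (intro sum_le_suminf) auto
    finally show ?thesis .
  qed
  thus ?thesis by blast
qed

subsection \<open>Partial sums of real characters\<close>

lemma periodic_window_sum:
  fixes b :: "nat \<Rightarrow> real"
  assumes per: "\<And>n. b (n + q) = b n"
  shows "(\<Sum>n<q. b (N + n)) = (\<Sum>n<q. b n)"
proof (induction N)
  case (Suc N)
  have "(\<Sum>n<q. b (Suc N + n)) = (\<Sum>n<Suc q. b (N + n)) - b N"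
    by (subst sum.lessThan_Suc_shift) simp
  also have "\<dots> = (\<Sum>n<q. b (N + n))" using per[of N] by simp
  finally show ?case using Suc by simp
qed simp

text \<open>Whole periods match the mean value exactly. Fewer than q terms remain, and both the sum
  and its expected value are then at most q.\<close>

lemma periodic_sum_bound:
  fixes b :: "nat \<Rightarrow> real"
  assumes per: "\<And>n. b (n + q) = b n" and q: "q > 0" and b1: "\<And>n. \<bar>b n\<bar> \<le> 1"
  shows "\<bar>(\<Sum>n=1..N. b n) - (\<Sum>n<q. b n) / real q * real N\<bar> \<le> 2 * real q"
proof (induction N rule: less_induct)
  case (less N)
  define P where "P = (\<Sum>n<q. b n)"
  have ab: "\<bar>\<Sum>n\<in>A. b n\<bar> \<le> real (card A)" for A
    using order_trans[OF sum_abs sum_bounded_above[of A "\<lambda>n. \<bar>b n\<bar>" 1]] b1 by simp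
  show ?case
  proof (cases "N < q")
    case True
    have 1: "\<bar>\<Sum>n=1..N. b n\<bar> \<le> real N"
      using ab[of "{1..N}"] by simp
    have "\<bar>P\<bar> \<le> real q"
      unfolding P_def using ab[of "{..<q}"] by simp
    hence "\<bar>P\<bar> / real q * real N \<le> 1 * real N" using q by (intro mult_right_mono) auto
    hence "\<bar>P / real q * real N\<bar> \<le> real N" by (simp add: abs_mult)
    thus ?thesis using 1 True unfolding P_def[symmetric] by linarith
  next
    case False
    define M where "M = N - q"
    have N: "N = M + q" "M < N" using False q by (auto simp: M_def)
    have "(\<Sum>n=1..N. b n) = (\<Sum>n=1..M. b n) + (\<Sum>n=Suc M..M + q. b n)"
      unfolding N(1) using sum.ub_add_nat[of 1 M b q] by simp
    also have "(\<Sum>n=Suc M..M + q. b n) = (\<Sum>n<q. b (Suc M + n))"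
      by (rule sum.reindex_bij_witness[of _ "\<lambda>n. Suc M + n" "\<lambda>n. n - Suc M"]) auto
    also have "\<dots> = P" unfolding P_def by (rule periodic_window_sum[of b, OF per])
    finally have "(\<Sum>n=1..N. b n) - P / real q * real N = (\<Sum>n=1..M. b n) - P / real q * real M"
      using q N(1) by (simp add: field_simps)
    thus ?thesis using less.IH[OF N(2)] unfolding P_def[symmetric] by simp
  qed
qed

lemma real_character_facts:
  assumes chi: "dirichlet_character q chi" and re: "real_character chi"
  shows "q > 0" "sgn_mult (\<lambda>n. Re (chi n))" "\<And>n. Re (chi (n + q)) = Re (chi n)"
    "\<And>n. chi n = of_real (Re (chi n))"
proof -
  show q: "q > 0" using chi by (simp add: dirichlet_character_def)
  have vals: "chi n = -1 \<or> chi n = 0 \<or> chi n = 1" for n using re by (auto simp: real_character_def)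
  show eq: "chi n = of_real (Re (chi n))" for n using vals[of n] by auto
  show "Re (chi (n + q)) = Re (chi n)" for n using chi by (simp add: dirichlet_character_def)
  have mul: "chi (m * n) = chi m * chi n" for m n using chi by (simp add: dirichlet_character_def)
  have "chi 1 \<noteq> 0" using chi by (simp add: dirichlet_character_def)
  hence "chi 1 = 1" using mul[of 1 1] by simp
  moreover have "Re (chi (m * n)) = Re (chi m) * Re (chi n)" for m n
    unfolding mul using vals[of m] vals[of n] by auto
  moreover have "Re (chi n) \<in> {-1, 0, 1}" for n using vals[of n] by auto
  ultimately show "sgn_mult (\<lambda>n. Re (chi n))" unfolding sgn_mult_def by auto
qed

text \<open>A real character other than the principal one takes the value -1 at some m prime to q.
  Multiplication by m permutes the residues and changes the sign of the sum.\<close>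

lemma character_period_sum:
  assumes chi: "dirichlet_character q chi" and re: "real_character chi" and np: "chi \<noteq> principal_character q"
  shows "(\<Sum>n<q. Re (chi n)) = 0"
proof -
  note F = real_character_facts[OF chi re]
  define X where "X = (\<lambda>n. Re (chi n))"
  obtain m where m: "chi m \<noteq> principal_character q m" using np by blast
  have vals: "chi m = -1 \<or> chi m = 0 \<or> chi m = 1" using re by (auto simp: real_character_def)
  have cop: "chi m \<noteq> 0 \<longleftrightarrow> coprime m q" using chi by (auto simp: dirichlet_character_def)
  have m': "coprime m q" "X m = -1" using m vals cop by (auto simp: principal_character_def X_def split: if_splits)
  have mul: "X (a * b) = X a * X b" for a b
  proof -
    have "chi (a * b) = chi a * chi b" using chi by (simp add: dirichlet_character_def)
    thus ?thesis using F(4)[of a] F(4)[of b] by (metis X_def Re_complex_of_real of_real_mult)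
  qed
  have Xadd: "X (n + q * i) = X n" for n i
  proof (induction i)
    case (Suc i) thus ?case using F(3)[of "n + q * i"] by (simp add: X_def add_ac)
  qed simp
  have Xmod: "X (n mod q) = X n" for n using Xadd[of "n mod q" "n div q"] by simp
  have inj: "inj_on (\<lambda>n. (m * n) mod q) {..<q}"
  proof (rule inj_onI)
    fix a b assume ab: "a \<in> {..<q}" "b \<in> {..<q}" "(m * a) mod q = (m * b) mod q"
    hence "[m * a = m * b] (mod q)" by (simp add: cong_def)
    hence "[a = b] (mod q)" using m'(1) by (simp add: cong_mult_lcancel_nat)
    thus "a = b" using ab by (simp add: cong_def)
  qed
  have "(\<lambda>n. (m * n) mod q) ` {..<q} = {..<q}"
    by (rule endo_inj_surj) (use inj F(1) in auto)
  hence "(\<Sum>n<q. X n) = (\<Sum>n<q. X ((m * n) mod q))"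
    using sum.reindex[OF inj, of X] by simp
  also have "\<dots> = - (\<Sum>n<q. X n)" by (simp add: Xmod mul m'(2) sum_negf)
  finally show ?thesis by (simp add: X_def)
qed

lemma continuation_one: "\<exists>H. continuation (\<lambda>_. 1) 1 H"
  by (rule continuation_pole[of "\<lambda>_. 1" 1 0]) auto

lemma character_continuations:
  assumes chi: "dirichlet_character q chi" and re: "real_character chi" and np: "chi \<noteq> principal_character q"
  shows "\<exists>H. continuation (\<lambda>n. Re (chi n)) 0 H" "\<exists>H. continuation (\<lambda>n. (Re (chi n))\<^sup>2) 1 H"
    "\<And>N. \<bar>\<Sum>n=1..N. Re (chi n)\<bar> \<le> 2 * real q"
proof -
  note F = real_character_facts[OF chi re]
  show bd: "\<bar>\<Sum>n=1..N. Re (chi n)\<bar> \<le> 2 * real q" for N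
    using periodic_sum_bound[of "\<lambda>n. Re (chi n)" q N] F sgn_multD(3)[OF F(2)] character_period_sum[OF assms] by simp
  show "\<exists>H. continuation (\<lambda>n. Re (chi n)) 0 H" by (rule continuation_entire[OF F(2) bd])
  define P where "P = (\<Sum>n<q. (Re (chi n))\<^sup>2)"
  have sq: "sgn_mult (\<lambda>n. (Re (chi n))\<^sup>2)" by (rule sgn_mult_square[OF F(2)])
  have per: "(Re (chi (n + q)))\<^sup>2 = (Re (chi n))\<^sup>2" for n using F(3) by simp
  \<comment> \<open>The window is shifted to start at 1, where the character is 1, so that
    positivity is visible for every modulus.\<close>
  have "P = (\<Sum>n<q. (Re (chi (1 + n)))\<^sup>2)"
    unfolding P_def by (rule periodic_window_sum[of "\<lambda>n. (Re (chi n))\<^sup>2" q 1, symmetric]) (rule per)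
  also have "\<dots> \<ge> (Re (chi (1 + 0)))\<^sup>2"
    using F(1) by (intro member_le_sum[of 0 "{..<q}" "\<lambda>n. (Re (chi (1 + n)))\<^sup>2"]) auto
  finally have "P > 0" using sgn_multD(1)[OF F(2)] by simp
  hence "P / real q > 0" using F(1) by simp
  moreover have "\<bar>(\<Sum>n=1..N. (Re (chi n))\<^sup>2) - P / real q * real N\<bar> \<le> 2 * real q" for N
    unfolding P_def by (rule periodic_sum_bound[of "\<lambda>n. (Re (chi n))\<^sup>2", OF per F(1) sgn_multD(3)[OF sq]])
  ultimately show "\<exists>H. continuation (\<lambda>n. (Re (chi n))\<^sup>2) 1 H"
    using sgn_multD(3)[OF sq] by (intro continuation_pole[of _ "P / real q" "2 * real q"]) auto
qed

subsection \<open>Transfer between the character and the function imitating it\<close>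

lemma dconv_cong:
  assumes "n > 0" "\<And>m. m > 0 \<Longrightarrow> f m = f' m" "\<And>m. m > 0 \<Longrightarrow> g m = g' m"
  shows "dconv f g n = dconv f' g' n"
  unfolding dconv_def using assms by (intro sum.cong) (auto elim!: dvdE)

lemma dconv_mob_cancel:
  assumes u: "sgn_mult u" and n: "n > 0"
  shows "dconv (dconv f u) (\<lambda>d. mob d * u d) n = f n" "dconv (dconv (\<lambda>d. mob d * u d) f) u n = f n"
proof -
  define U where "U = (\<lambda>d. mob d * u d)"
  have "dconv (dconv f u) U n = dconv f (dconv u U) n" by (rule dconv_assoc[OF n])
  also have "\<dots> = f n"
    by (rule dconv_delta[OF _ n]) (use mob_conv_self[OF u] dconv_commute[of _ u U] in \<open>auto simp: U_def\<close>)
  finally show "dconv (dconv f u) (\<lambda>d. mob d * u d) n = f n" by (simp add: U_def)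
  have "dconv (dconv U f) u n = dconv (dconv f U) u n"
    by (rule dconv_cong[OF n]) (auto intro: dconv_commute)
  also have "\<dots> = dconv f (dconv U u) n" by (rule dconv_assoc[OF n])
  also have "\<dots> = f n"
    by (rule dconv_delta[OF _ n]) (use mob_conv_self[OF u] in \<open>auto simp: U_def\<close>)
  finally show "dconv (dconv (\<lambda>d. mob d * u d) f) u n = f n" by (simp add: U_def)
qed

text \<open>g = h * u with h the quotient of the series of g and u. The inner sums over u are
  bounded, so everything rests on \<Sum> |h(m)| for m \<le> y, and the weight converts its
  convergence into the saving.\<close>

lemma sum_sgn_mult_transfer:
  assumes u: "sgn_mult u" and g: "sgn_mult g"
    and Q: "\<And>x. \<bar>\<Sum>n | n > 0 \<and> real n \<le> x. u n\<bar> \<le> Q"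
    and V: "\<And>x. (\<Sum>n | n > 0 \<and> real n \<le> x. \<bar>dconv (\<lambda>d. mob d * u d) g n\<bar> * weight \<kappa> \<tau> n) \<le> V"
    and \<kappa>: "\<kappa> > 0" and \<tau>: "\<tau> \<ge> 0"
  shows "\<bar>\<Sum>n | n > 0 \<and> real n \<le> y. g n\<bar> \<le> Q * V * exp (\<tau>\<^sup>2 / \<kappa>) * (y powr \<kappa> * exp (- \<tau> * sqrt (ln y)))"
proof -
  define h where "h = dconv (\<lambda>d. mob d * u d) g"
  define E where "E = exp (\<tau>\<^sup>2 / \<kappa>) * (y powr \<kappa> * exp (- \<tau> * sqrt (ln y)))"
  have Q0: "Q \<ge> 0" using Q[of 0] by (smt (verit) abs_ge_zero)
  have "(\<Sum>n | n > 0 \<and> real n \<le> y. g n) = (\<Sum>n | n > 0 \<and> real n \<le> y. dconv h u n)"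
    unfolding h_def using dconv_mob_cancel(2)[OF u] by (intro sum.cong) auto
  also have "\<dots> = (\<Sum>m | m > 0 \<and> real m \<le> y. h m * (\<Sum>n | n > 0 \<and> real n \<le> y / real m. u n))"
    by (rule sum_dconv)
  also have "\<bar>\<dots>\<bar> \<le> (\<Sum>m | m > 0 \<and> real m \<le> y. (\<bar>h m\<bar> * weight \<kappa> \<tau> m) * (E * Q))"
  proof (rule order_trans[OF sum_abs sum_mono])
    fix m assume m: "m \<in> {m. m > 0 \<and> real m \<le> y}"
    have "\<bar>h m\<bar> * 1 \<le> \<bar>h m\<bar> * (weight \<kappa> \<tau> m * E)"
      unfolding E_def using inverse_weight_le[OF \<kappa> \<tau>, of m y] m by (intro mult_left_mono) auto
    hence "\<bar>h m\<bar> * \<bar>\<Sum>n | n > 0 \<and> real n \<le> y / real m. u n\<bar> \<le> (\<bar>h m\<bar> * (weight \<kappa> \<tau> m * E)) * Q"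
      using Q Q0 weight_nonneg[of \<kappa> \<tau> m] by (intro mult_mono) (auto simp: E_def)
    thus "\<bar>h m * (\<Sum>n | n > 0 \<and> real n \<le> y / real m. u n)\<bar> \<le> (\<bar>h m\<bar> * weight \<kappa> \<tau> m) * (E * Q)"
      by (simp add: abs_mult mult_ac)
  qed
  also have "\<dots> = (\<Sum>m | m > 0 \<and> real m \<le> y. \<bar>h m\<bar> * weight \<kappa> \<tau> m) * (E * Q)"
    by (simp add: sum_distrib_right)
  also have "\<dots> \<le> V * (E * Q)"
    using V[of y] Q0 by (intro mult_right_mono) (auto simp: h_def E_def)
  finally show ?thesis by (simp add: E_def mult_ac)
qed

text \<open>The series of \<mu>g is that of \<mu>u times the quotient of u by g, opposite to the
  quotient for g itself. Replacing z by z/m costs at most exp(c sqrt(log m)), which the weight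
  covers because c \<le> \<tau>; and 1/m \<le> m^(-\<kappa>).\<close>

lemma sum_mob_transfer:
  assumes u: "sgn_mult u" and g: "sgn_mult g"
    and P: "\<And>x. x \<ge> 1 \<Longrightarrow> \<bar>\<Sum>n | n > 0 \<and> real n \<le> x. mob n * u n\<bar> \<le> C * (x * exp (- c * sqrt (ln x)))"
    and C: "C \<ge> 0" and c: "c \<ge> 0"
    and V: "\<And>x. (\<Sum>n | n > 0 \<and> real n \<le> x. \<bar>dconv (\<lambda>d. mob d * g d) u n\<bar> * weight \<kappa> \<tau> n) \<le> V"
    and \<kappa>: "\<kappa> \<le> 1" and \<tau>: "c \<le> \<tau>" and z: "z \<ge> 1"
  shows "\<bar>\<Sum>n | n > 0 \<and> real n \<le> z. mob n * g n\<bar> \<le> C * V * (z * exp (- c * sqrt (ln z)))"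
proof -
  define h where "h = dconv (\<lambda>d. mob d * g d) u"
  define E where "E = z * exp (- c * sqrt (ln z))"
  have E0: "E \<ge> 0" using z by (simp add: E_def)
  have "(\<Sum>n | n > 0 \<and> real n \<le> z. mob n * g n) = (\<Sum>n | n > 0 \<and> real n \<le> z. dconv h (\<lambda>d. mob d * u d) n)"
    unfolding h_def using dconv_mob_cancel(1)[OF u] by (intro sum.cong) auto
  also have "\<dots> = (\<Sum>m | m > 0 \<and> real m \<le> z. h m * (\<Sum>n | n > 0 \<and> real n \<le> z / real m. mob n * u n))"
    by (rule sum_dconv)
  also have "\<bar>\<dots>\<bar> \<le> (\<Sum>m | m > 0 \<and> real m \<le> z. (\<bar>h m\<bar> * weight \<kappa> \<tau> m) * (C * E))"
  proof (rule order_trans[OF sum_abs sum_mono])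
    fix m assume m: "m \<in> {m. m > 0 \<and> real m \<le> z}"
    hence m1: "real m \<ge> 1" "real m \<le> z" by auto
    have zm: "z / real m \<ge> 1" using m1 by simp
    have "sqrt (ln (z / real m) + ln (real m)) \<le> sqrt (ln (z / real m)) + sqrt (ln (real m))"
      using zm m1 by (intro sqrt_add_le_add_sqrt) auto
    moreover have "ln (z / real m) + ln (real m) = ln z" using m1 z by (simp add: ln_div)
    ultimately have "c * sqrt (ln z) \<le> c * (sqrt (ln (z / real m)) + sqrt (ln (real m)))"
      using c by (intro mult_left_mono) auto
    moreover have "c * sqrt (ln (real m)) \<le> \<tau> * sqrt (ln (real m))" using \<tau> m1 by (intro mult_right_mono) auto
    ultimately have "exp (- c * sqrt (ln (z / real m))) \<le> exp (\<tau> * sqrt (ln (real m)) + - c * sqrt (ln z))"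
      by (simp add: algebra_simps)
    hence 1: "exp (- c * sqrt (ln (z / real m))) \<le> exp (\<tau> * sqrt (ln (real m))) * exp (- c * sqrt (ln z))"
      by (simp only: exp_add)
    have "real m powr (-1) \<le> real m powr (- \<kappa>)" using m1 \<kappa> by (intro powr_mono) auto
    hence "1 / real m \<le> real m powr (- \<kappa>)" using m1 by (simp add: powr_minus_divide)
    hence 2: "z * (1 / real m) \<le> z * real m powr (- \<kappa>)" using z by (intro mult_left_mono) auto
    have "(z * (1 / real m)) * exp (- c * sqrt (ln (z / real m)))
        \<le> (z * real m powr (- \<kappa>)) * (exp (\<tau> * sqrt (ln (real m))) * exp (- c * sqrt (ln z)))"
      by (rule mult_mono[OF 2 1]) (use z in auto)
    hence "z / real m * exp (- c * sqrt (ln (z / real m))) \<le> weight \<kappa> \<tau> m * E"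
      by (simp add: weight_def E_def mult_ac)
    hence "C * (z / real m * exp (- c * sqrt (ln (z / real m)))) \<le> C * (weight \<kappa> \<tau> m * E)"
      using C by (rule mult_left_mono)
    with P[OF zm] have "\<bar>\<Sum>n | n > 0 \<and> real n \<le> z / real m. mob n * u n\<bar> \<le> C * (weight \<kappa> \<tau> m * E)"
      by linarith
    hence "\<bar>h m\<bar> * \<bar>\<Sum>n | n > 0 \<and> real n \<le> z / real m. mob n * u n\<bar> \<le> \<bar>h m\<bar> * (C * (weight \<kappa> \<tau> m * E))"
      by (intro mult_left_mono) auto
    thus "\<bar>h m * (\<Sum>n | n > 0 \<and> real n \<le> z / real m. mob n * u n)\<bar> \<le> (\<bar>h m\<bar> * weight \<kappa> \<tau> m) * (C * E)"
      by (simp add: abs_mult mult_ac)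
  qed
  also have "\<dots> = (\<Sum>m | m > 0 \<and> real m \<le> z. \<bar>h m\<bar> * weight \<kappa> \<tau> m) * (C * E)"
    by (simp add: sum_distrib_right)
  also have "\<dots> \<le> V * (C * E)"
    using V[of z] C E0 by (intro mult_right_mono) (auto simp: h_def)
  finally show ?thesis by (simp add: E_def mult_ac)
qed

subsection \<open>The hyperbola method for \<open>k\<close>-free integers\<close>

text \<open>\<open>D\<close> is the largest integer whose k-th power divides n. Hence d^k divides n
  exactly if d divides \<open>D\<close>, and n is k-free exactly if \<open>D = 1\<close>.\<close>

lemma kfree_mob_sum:
  assumes k: "k > 0" and n: "n > 0"
  shows "(\<Sum>d | d ^ k dvd n. mob d) = (if kfree k n then 1 else 0)"
proof -
  define D where "D = (\<Prod>p\<in>prime_factors n. p ^ (multiplicity p n div k))"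
  have D0: "D > 0" unfolding D_def by (intro prod_pos) (auto dest!: in_prime_factors_imp_prime simp: prime_gt_0_nat)
  have mult: "multiplicity p D = multiplicity p n div k" if p: "prime p" for p
  proof -
    have "multiplicity p D = (if p \<in> prime_factors n then multiplicity p n div k else 0)"
      unfolding D_def by (rule multiplicity_prod_prime_powers) (use p in auto)
    thus ?thesis using p n by (auto simp: prime_factors_multiplicity)
  qed
  have iff: "d ^ k dvd n \<longleftrightarrow> d dvd D" for d
  proof (cases "d = 0")
    case True thus ?thesis using k n D0 by (simp add: zero_power)
  next
    case False
    have "d ^ k dvd n \<longleftrightarrow> (\<forall>p. prime p \<longrightarrow> multiplicity p (d ^ k) \<le> multiplicity p n)"
      using False n by (auto intro: multiplicity_le_imp_dvd dvd_imp_multiplicity_le)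
    also have "\<dots> \<longleftrightarrow> (\<forall>p. prime p \<longrightarrow> multiplicity p d \<le> multiplicity p D)"
      using False k by (auto simp: mult prime_elem_multiplicity_power_distrib less_eq_div_iff_mult_less_eq mult.commute)
    also have "\<dots> \<longleftrightarrow> d dvd D"
      using False D0 by (auto intro: multiplicity_le_imp_dvd dvd_imp_multiplicity_le)
    finally show ?thesis .
  qed
  have "kfree k n \<longleftrightarrow> D = 1"
    unfolding kfree_def iff by (metis prime_factor_nat nat_dvd_1_iff_1 not_prime_1)
  thus ?thesis using mob_sum[OF D0] by (simp add: iff)
qed

lemma powr_inverse_power:
  assumes "k > 0" "y > 0" shows "(y powr (1 / real k)) ^ k = y"
  using assms by (simp add: powr_powr flip: powr_realpow)

lemma power_le_iff_le_powr:
  assumes "k > 0" "y > 0"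
  shows "real d ^ k \<le> y \<longleftrightarrow> real d \<le> y powr (1 / real k)"
proof -
  note eq = powr_inverse_power[OF assms]
  show ?thesis
  proof
    assume "real d ^ k \<le> y"
    hence "real d ^ k \<le> (y powr (1 / real k)) ^ k" using eq by simp
    thus "real d \<le> y powr (1 / real k)" using assms by (subst (asm) power_mono_iff) auto
  next
    assume "real d \<le> y powr (1 / real k)"
    hence "real d ^ k \<le> (y powr (1 / real k)) ^ k" by (intro power_mono) auto
    thus "real d ^ k \<le> y" using eq by simp
  qed
qed

text \<open>Pairs with d^k m \<le> x are split at d = V. If d > V then m \<le> Y, and for such m the
  remaining d fill the range from V to (x/m)^(1/k), a difference of two values of
  \<open>B\<close>.\<close>

lemma kth_power_hyperbola:
  fixes b g :: "nat \<Rightarrow> real"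
  assumes k: "k > 0" and x: "x \<ge> 1" and V: "V > 0" and Y: "Y * V ^ k = x"
  defines "B \<equiv> (\<lambda>z. \<Sum>d | d > 0 \<and> real d \<le> z. b d)" and "G \<equiv> (\<lambda>z. \<Sum>m | m > 0 \<and> real m \<le> z. g m)"
  shows "(\<Sum>n | n > 0 \<and> real n \<le> x. \<Sum>d | d ^ k dvd n. b d * g (n div d ^ k))
    = (\<Sum>d | d > 0 \<and> real d \<le> V. b d * G (x / real d ^ k))
      + (\<Sum>m | m > 0 \<and> real m \<le> Y. g m * (B ((x / real m) powr (1 / real k)) - B V))"
proof -
  define S where "S = (\<lambda>z. {n :: nat. n > 0 \<and> real n \<le> z})"
  have fin: "finite (S z)" for z unfolding S_def by (rule finite_real_bounded)
  define T where "T = {(d :: nat, m :: nat). d > 0 \<and> m > 0 \<and> real d ^ k * real m \<le> x}"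
  define T1 where "T1 = {(d, m) \<in> T. real d \<le> V}"
  define T2 where "T2 = {(d, m) \<in> T. real d > V}"
  have Tsub: "T \<subseteq> S x \<times> S x"
  proof clarify
    fix d m assume "(d, m) \<in> T"
    hence dm: "d > 0" "m > 0" "real d ^ k * real m \<le> x" by (auto simp: T_def)
    have "real d ^ 1 \<le> real d ^ k" using dm k by (intro power_increasing) auto
    hence "real d * 1 \<le> real d ^ k * real m" "1 * real m \<le> real d ^ k * real m"
      using dm by (intro mult_mono; simp)+
    hence "real d \<le> x" "real m \<le> x" using dm(3) by linarith+
    thus "d \<in> S x \<and> m \<in> S x" using dm by (auto simp: S_def)
  qed
  have finT: "finite T" "finite T1" "finite T2"
    by (rule finite_subset[of _ "S x \<times> S x"]; use Tsub fin in \<open>auto simp: T1_def T2_def\<close>)+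
  have findiv: "finite {d. d ^ k dvd n}" if "n > 0" for n :: nat
  proof (rule finite_subset[of _ "{d. d dvd n}"])
    show "{d. d ^ k dvd n} \<subseteq> {d. d dvd n}" using k dvd_power[of k] dvd_trans by blast
  qed (use that in auto)
  have "(\<Sum>n\<in>S x. \<Sum>d | d ^ k dvd n. b d * g (n div d ^ k))
      = (\<Sum>(n,d)\<in>(SIGMA n:S x. {d. d ^ k dvd n}). b d * g (n div d ^ k))"
    using fin findiv by (subst sum.Sigma) (auto simp: S_def)
  also have "\<dots> = (\<Sum>(d,m)\<in>T. b d * g m)"
  proof (rule sum.reindex_bij_witness[of _ "\<lambda>(d,m). (d ^ k * m, d)" "\<lambda>(n,d). (d, n div d ^ k)"])
    fix a assume "a \<in> (SIGMA n:S x. {d. d ^ k dvd n})"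
    then obtain d e where a: "a = (d ^ k * e, d)" "d ^ k * e > 0" "real (d ^ k * e) \<le> x" by (auto simp: S_def elim!: dvdE)
    hence "d > 0" using k by (auto intro: Nat.gr0I simp: zero_power)
    thus "(case a of (n, d) \<Rightarrow> (d, n div d ^ k)) \<in> T" using a by (auto simp: T_def)
  qed (use k in \<open>auto simp: T_def S_def elim!: dvdE\<close>)
  also have "\<dots> = (\<Sum>(d,m)\<in>T1. b d * g m) + (\<Sum>(d,m)\<in>T2. b d * g m)"
  proof -
    have "T = T1 \<union> T2" "T1 \<inter> T2 = {}" by (auto simp: T1_def T2_def)
    thus ?thesis using sum.union_disjoint[of T1 T2 "\<lambda>(d,m). b d * g m"] finT by simp
  qed
  also have "(\<Sum>(d,m)\<in>T1. b d * g m) = (\<Sum>d\<in>S V. b d * G (x / real d ^ k))"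
  proof -
    have "T1 = (SIGMA d:S V. S (x / real d ^ k))"
      by (auto simp: T1_def T_def S_def field_simps)
    hence "(\<Sum>(d,m)\<in>T1. b d * g m) = (\<Sum>d\<in>S V. \<Sum>m\<in>S (x / real d ^ k). b d * g m)"
      using fin by (subst sum.Sigma) auto
    thus ?thesis by (simp add: G_def S_def sum_distrib_left)
  qed
  also have "(\<Sum>(d,m)\<in>T2. b d * g m) = (\<Sum>m\<in>S Y. g m * (B ((x / real m) powr (1 / real k)) - B V))"
  proof -
    have iff: "real d ^ k * real m \<le> x \<longleftrightarrow> real d \<le> (x / real m) powr (1 / real k)" if "m > 0" for d m
      using power_le_iff_le_powr[OF k, of "x / real m" d] that x by (simp add: field_simps)
    have "(\<Sum>(d,m)\<in>T2. b d * g m) = (\<Sum>(m,d)\<in>(SIGMA m:S Y. S ((x / real m) powr (1 / real k)) - S V). g m * b d)"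
    proof (rule sum.reindex_bij_witness[of _ "\<lambda>(m,d). (d,m)" "\<lambda>(d,m). (m,d)"])
      fix a assume "a \<in> T2"
      then obtain d m where a: "a = (d, m)" "d > 0" "m > 0" "real d ^ k * real m \<le> x" "real d > V"
        by (auto simp: T2_def T_def)
      have "V ^ k * real m \<le> real d ^ k * real m" using a V by (intro mult_right_mono power_mono) auto
      also note a(4)
      also have "x = V ^ k * Y" using Y by (simp add: mult.commute)
      finally have "V ^ k * real m \<le> V ^ k * Y" .
      hence "real m \<le> Y" using V by simp
      thus "(case a of (d, m) \<Rightarrow> (m, d)) \<in> (SIGMA m:S Y. S ((x / real m) powr (1 / real k)) - S V)"
        using a iff by (auto simp: S_def)
    next
      fix a assume "a \<in> (SIGMA m:S Y. S ((x / real m) powr (1 / real k)) - S V)"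
      thus "(case a of (m, d) \<Rightarrow> (d, m)) \<in> T2" using iff by (auto simp: S_def T2_def T_def)
    qed auto
    also have "\<dots> = (\<Sum>m\<in>S Y. g m * (\<Sum>d\<in>S ((x / real m) powr (1 / real k)) - S V. b d))"
      using fin by (subst sum.Sigma[symmetric]) (auto simp: sum_distrib_left)
    also have "\<dots> = (\<Sum>m\<in>S Y. g m * (B ((x / real m) powr (1 / real k)) - B V))"
    proof (rule sum.cong)
      fix m assume m: "m \<in> S Y"
      have "V ^ k * real m \<le> V ^ k * Y" using m V by (intro mult_left_mono) (auto simp: S_def)
      hence "V ^ k \<le> x / real m" using m Y by (simp add: S_def field_simps)
      hence "(V ^ k) powr (1 / real k) \<le> (x / real m) powr (1 / real k)" using V by (intro powr_mono2) auto
      moreover have "(V ^ k) powr (1 / real k) = V" using V k by (simp add: powr_powr flip: powr_realpow)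
      ultimately have "S V \<subseteq> S ((x / real m) powr (1 / real k))" by (auto simp: S_def)
      thus "g m * (\<Sum>d\<in>S ((x / real m) powr (1 / real k)) - S V. b d) = g m * (B ((x / real m) powr (1 / real k)) - B V)"
        using sum_diff[OF fin, of "S V" "(x / real m) powr (1 / real k)" b] by (simp add: B_def S_def)
    qed auto
    finally show ?thesis .
  qed
  finally show ?thesis by (simp add: S_def)
qed

lemma harmonic_sum_le:
  assumes "V \<ge> 1" shows "(\<Sum>d | d > 0 \<and> real d \<le> V. 1 / real d) \<le> 1 + ln V"
proof -
  define N where "N = nat \<lfloor>V\<rfloor>"
  have N: "N > 0" "real N \<le> V" using assms by (auto simp: N_def)
  have "(\<Sum>n=1..N. 1 / real n) \<le> 1 + ln (real N)"
    using N(1)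
  proof (induction N rule: nat_induct_non_zero)
    case (Suc n)
    have "1 / real (Suc n) \<le> - ln (1 - 1 / real (Suc n))"
      using ln_le_minus_one[of "1 - 1 / real (Suc n)"] Suc.hyps by simp
    also have "1 - 1 / real (Suc n) = real n / real (Suc n)" by (simp add: field_simps)
    also have "- ln (real n / real (Suc n)) = ln (real (Suc n)) - ln (real n)" using Suc.hyps by (simp add: ln_div)
    finally show ?case using Suc.IH by simp
  qed simp
  also have "ln (real N) \<le> ln V" using N by simp
  finally show ?thesis using sum_real_eq_sum_nat[of V "\<lambda>d. 1 / real d"] assms by (simp add: N_def)
qed

lemma kfree_sum_estimate:
  fixes b g :: "nat \<Rightarrow> real"
  assumes k: "k > 0" and b1: "\<And>d. \<bar>b d\<bar> \<le> 1" and g1: "\<And>m. \<bar>g m\<bar> \<le> 1"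
    and B: "\<And>z. z \<ge> 1 \<Longrightarrow> \<bar>\<Sum>d | d > 0 \<and> real d \<le> z. b d\<bar> \<le> CB * (z * exp (- c * sqrt (ln z)))"
    and G: "\<And>y. y \<ge> 1 \<Longrightarrow> \<bar>\<Sum>m | m > 0 \<and> real m \<le> y. g m\<bar> \<le> CG * (y powr (1 / real k) * exp (- \<tau> * sqrt (ln y)))"
    and c: "c > 0" and \<tau>: "\<tau> > 0" and CB: "CB \<ge> 0" and CG: "CG \<ge> 0"
  shows "\<exists>lam>0. \<exists>C. eventually (\<lambda>x. \<bar>\<Sum>n | n > 0 \<and> real n \<le> x. \<Sum>d | d ^ k dvd n. b d * g (n div d ^ k)\<bar>
      \<le> C * (x powr (1 / real k) / exp (lam * ln x powr (1 / 4)))) at_top"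
proof -
  define \<kappa> where "\<kappa> = 1 / real k"
  have \<kappa>: "0 < \<kappa>" "\<kappa> \<le> 1" using k by (auto simp: \<kappa>_def)
  \<comment> \<open>For d beyond \<open>V\<close> the root of log z is at least sqrt(\<kappa>/2)
    sqrt(log x), so the Moebius sums save exp(-2 \<eta> sqrt(log x)). The cut Y = exp(\<eta>
    sqrt(log x)) spends half of this on the sum over m.\<close>
  define \<eta> where "\<eta> = c * sqrt (\<kappa> / 2) / 2"
  have \<eta>: "\<eta> > 0" using c \<kappa> by (simp add: \<eta>_def)
  \<comment> \<open>The sums of g save exp(-\<tau> sqrt \<eta> v) with v the fourth root of log x.
    Half of this absorbs the factor 1 + log x = 1 + v^4 from the harmonic sum, by exp(z) \<ge>
    (z/4)^4.\<close>
  define lam where "lam = \<tau> * sqrt \<eta> / 2"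
  have lam: "lam > 0" using \<tau> \<eta> by (simp add: lam_def)
  define C where "C = CG * (1 + 256 / lam ^ 4) + 2 * CB"
  \<comment> \<open>The first largeness condition keeps Y below sqrt x, so that log V is at least
    (\<kappa>/2) log x; the second makes exp(-\<eta> sqrt(log x)) smaller than the target.\<close>
  have main: "\<bar>\<Sum>n | n > 0 \<and> real n \<le> x. \<Sum>d | d ^ k dvd n. b d * g (n div d ^ k)\<bar>
      \<le> C * (x powr \<kappa> / exp (lam * ln x powr (1 / 4)))"
    if x: "x > 1" and big: "sqrt (ln x) \<ge> 2 * \<eta>" "sqrt (sqrt (ln x)) \<ge> lam / \<eta>" for x
  proof -
    define L where "L = ln x"
    define s where "s = sqrt L"
    define v where "v = sqrt s"
    have L: "L > 0" using x by (simp add: L_def)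
    have s: "s > 0" "s\<^sup>2 = L" using L by (auto simp: s_def)
    have v: "v > 0" "v\<^sup>2 = s" using s by (auto simp: v_def)
    have v4: "v ^ 4 = L"
    proof -
      have "v ^ 4 = (v\<^sup>2)\<^sup>2" by (simp flip: power_mult)
      thus ?thesis using v s by simp
    qed
    have vpowr: "ln x powr (1 / 4) = v"
    proof -
      have "v powr 4 = L" using powr_realpow[of v 4] v v4 by simp
      hence "ln x powr (1 / 4) = (v powr 4) powr (1 / 4)" by (simp only: L_def)
      also have "\<dots> = v" using v by (subst powr_powr) simp
      finally show ?thesis .
    qed
    define Y where "Y = exp (\<eta> * s)"
    define V where "V = (x / Y) powr \<kappa>"
    have Y: "Y \<ge> 1" using \<eta> s by (simp add: Y_def)
    have \<eta>s: "\<eta> * s \<le> L / 2"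
    proof -
      have "2 * \<eta> * s \<le> s * s" using big(1) s by (intro mult_right_mono) (auto simp: s_def L_def)
      thus ?thesis using s(2) unfolding power2_eq_square by linarith
    qed
    have lnxY: "ln (x / Y) = L - \<eta> * s" using x Y by (simp add: ln_div L_def Y_def)
    have xY: "x / Y \<ge> 1"
    proof -
      have "ln (x / Y) \<ge> 0" using lnxY \<eta>s L by simp
      thus ?thesis using x Y by (subst (asm) ln_ge_zero_iff) auto
    qed
    have V: "V \<ge> 1" unfolding V_def using xY \<kappa> by (intro ge_one_powr_ge_zero) auto
    have lnV: "ln V = \<kappa> * (L - \<eta> * s)" using xY by (simp add: V_def ln_powr lnxY)
    have Vx: "V \<le> x"
    proof -
      have "V \<le> x powr 1" unfolding V_def using x Y xY \<kappa>
        by (intro order_trans[OF powr_mono2[of \<kappa> "x / Y" x] powr_mono]) (auto simp: field_simps)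
      thus ?thesis using x by simp
    qed
    have Vk: "V ^ k = x / Y" using powr_inverse_power[OF k, of "x / Y"] xY unfolding V_def \<kappa>_def by linarith
    define X where "X = x powr \<kappa>"
    have X0: "X \<ge> 0" by (simp add: X_def)
    have hyp: "(\<Sum>n | n > 0 \<and> real n \<le> x. \<Sum>d | d ^ k dvd n. b d * g (n div d ^ k))
      = (\<Sum>d | d > 0 \<and> real d \<le> V. b d * (\<Sum>m | m > 0 \<and> real m \<le> x / real d ^ k. g m))
      + (\<Sum>m | m > 0 \<and> real m \<le> Y. g m * ((\<Sum>d | d > 0 \<and> real d \<le> (x / real m) powr (1 / real k). b d) - (\<Sum>d | d > 0 \<and> real d \<le> V. b d)))"
      (is "_ = ?S1 + ?S2")
      by (rule kth_power_hyperbola) (use k x V Y Vk in auto)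
    have S1: "\<bar>?S1\<bar> \<le> CG * X * exp (- \<tau> * (sqrt \<eta> * v)) * (1 + L)"
    proof -
      have "\<bar>?S1\<bar> \<le> (\<Sum>d | d > 0 \<and> real d \<le> V. (CG * X * exp (- \<tau> * (sqrt \<eta> * v))) * (1 / real d))"
      proof (rule order_trans[OF sum_abs sum_mono])
        fix d assume d: "d \<in> {d. d > 0 \<and> real d \<le> V}"
        have dk: "real d ^ k > 0" using d by simp
        have "real d ^ k \<le> V ^ k" using d by (intro power_mono) auto
        hence "real d ^ k * Y \<le> x" using Vk Y by (simp add: field_simps)
        hence Yx: "Y \<le> x / real d ^ k" using dk by (simp add: field_simps)
        have "ln Y \<le> ln (x / real d ^ k)" using Y Yx by simp
        hence "sqrt (\<eta> * s) \<le> sqrt (ln (x / real d ^ k))" by (simp add: Y_def)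
        hence "sqrt \<eta> * v \<le> sqrt (ln (x / real d ^ k))" by (simp add: real_sqrt_mult v_def)
        hence e: "exp (- \<tau> * sqrt (ln (x / real d ^ k))) \<le> exp (- \<tau> * (sqrt \<eta> * v))" using \<tau> by simp
        have p: "(x / real d ^ k) powr (1 / real k) = X * (1 / real d)"
        proof -
          have "(real d ^ k) powr (1 / real k) = real d" using d k by (simp add: powr_powr flip: powr_realpow)
          thus ?thesis using x dk by (simp add: powr_divide X_def \<kappa>_def)
        qed
        have "\<bar>\<Sum>m | m > 0 \<and> real m \<le> x / real d ^ k. g m\<bar> \<le> CG * ((X * (1 / real d)) * exp (- \<tau> * sqrt (ln (x / real d ^ k))))"
          using G[of "x / real d ^ k"] Y Yx p by simp
        also have "\<dots> \<le> CG * ((X * (1 / real d)) * exp (- \<tau> * (sqrt \<eta> * v)))"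
          using e CG X0 by (intro mult_left_mono) auto
        finally have "\<bar>b d\<bar> * \<bar>\<Sum>m | m > 0 \<and> real m \<le> x / real d ^ k. g m\<bar> \<le> 1 * (CG * ((X * (1 / real d)) * exp (- \<tau> * (sqrt \<eta> * v))))"
          using b1 by (intro mult_mono) auto
        thus "\<bar>b d * (\<Sum>m | m > 0 \<and> real m \<le> x / real d ^ k. g m)\<bar> \<le> (CG * X * exp (- \<tau> * (sqrt \<eta> * v))) * (1 / real d)"
          by (simp add: abs_mult mult_ac)
      qed
      also have "\<dots> = (CG * X * exp (- \<tau> * (sqrt \<eta> * v))) * (\<Sum>d | d > 0 \<and> real d \<le> V. 1 / real d)"
        by (rule sum_distrib_left[symmetric])
      also have "\<dots> \<le> (CG * X * exp (- \<tau> * (sqrt \<eta> * v))) * (1 + L)"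
      proof (rule mult_left_mono)
        have "ln V \<le> L" unfolding L_def using V Vx by simp
        thus "(\<Sum>d | d > 0 \<and> real d \<le> V. 1 / real d) \<le> 1 + L" using harmonic_sum_le[OF V] by linarith
      qed (use CG X0 in auto)
      finally show ?thesis .
    qed
    have S2: "\<bar>?S2\<bar> \<le> 2 * CB * X * exp (- (\<eta> * s))"
    proof -
      define E where "E = CB * (X * exp (- (2 * \<eta> * s)))"
      have Bz: "\<bar>\<Sum>d | d > 0 \<and> real d \<le> z. b d\<bar> \<le> E" if z: "V \<le> z" "z \<le> X" for z
      proof -
        have "ln V \<ge> \<kappa> / 2 * L"
        proof -
          have "\<kappa> * (L / 2) \<le> \<kappa> * (L - \<eta> * s)" using \<eta>s \<kappa> by (intro mult_left_mono) auto
          thus ?thesis by (simp add: lnV)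
        qed
        also have "ln V \<le> ln z" using V z by simp
        finally have "sqrt (\<kappa> / 2 * L) \<le> sqrt (ln z)" by (rule real_sqrt_le_mono)
        hence "sqrt (\<kappa> / 2) * s \<le> sqrt (ln z)" by (simp only: real_sqrt_mult s_def)
        hence "c * (sqrt (\<kappa> / 2) * s) \<le> c * sqrt (ln z)"
          using c by (intro mult_left_mono) auto
        hence "2 * \<eta> * s \<le> c * sqrt (ln z)" by (simp add: \<eta>_def mult.assoc)
        hence "z * exp (- c * sqrt (ln z)) \<le> X * exp (- (2 * \<eta> * s))"
          using z V by (intro mult_mono) auto
        hence "CB * (z * exp (- c * sqrt (ln z))) \<le> E" unfolding E_def using CB by (rule mult_left_mono)
        thus ?thesis using B[of z] V z by linarith
      qed
      have VX: "V \<le> X" unfolding V_def X_def using xY Y x \<kappa> by (intro powr_mono2) (auto simp: field_simps)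
      have E0: "E \<ge> 0" using CB X0 by (simp add: E_def)
      have "\<bar>?S2\<bar> \<le> (\<Sum>m | m > 0 \<and> real m \<le> Y. 2 * E)"
      proof (rule order_trans[OF sum_abs sum_mono])
        fix m assume m: "m \<in> {m. m > 0 \<and> real m \<le> Y}"
        define z where "z = (x / real m) powr (1 / real k)"
        have "x / Y \<le> x / real m" using m x by (intro divide_left_mono) auto
        hence z1: "V \<le> z" unfolding V_def z_def \<kappa>_def using xY by (intro powr_mono2) auto
        have "x / real m \<le> x / 1" using m x by (intro divide_left_mono) auto
        hence z2: "z \<le> X" unfolding X_def z_def \<kappa>_def using x by (intro powr_mono2) auto
        have "\<bar>(\<Sum>d | d > 0 \<and> real d \<le> z. b d) - (\<Sum>d | d > 0 \<and> real d \<le> V. b d)\<bar> \<le> 2 * E"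
          using Bz[OF z1 z2] Bz[OF order_refl VX] by linarith
        hence "\<bar>g m\<bar> * \<bar>(\<Sum>d | d > 0 \<and> real d \<le> z. b d) - (\<Sum>d | d > 0 \<and> real d \<le> V. b d)\<bar> \<le> 1 * (2 * E)"
          using g1 by (intro mult_mono) auto
        thus "\<bar>g m * ((\<Sum>d | d > 0 \<and> real d \<le> (x / real m) powr (1 / real k). b d) - (\<Sum>d | d > 0 \<and> real d \<le> V. b d))\<bar> \<le> 2 * E"
          by (simp add: abs_mult z_def)
      qed
      also have "\<dots> = real (nat \<lfloor>Y\<rfloor>) * (2 * E)"
        using sum_real_eq_sum_nat[of Y "\<lambda>_. 2 * E"] Y by simp
      also have "\<dots> \<le> Y * (2 * E)" using E0 Y by (intro mult_right_mono of_nat_floor) auto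
      also have "\<dots> = 2 * CB * X * exp (- (\<eta> * s))"
      proof -
        have "exp (\<eta> * s) * exp (- (2 * \<eta> * s)) = exp (- (\<eta> * s))" by (simp flip: exp_add)
        thus ?thesis by (simp add: Y_def E_def mult_ac)
      qed
      finally show ?thesis .
    qed
    have e1: "exp (- \<tau> * (sqrt \<eta> * v)) * (1 + L) \<le> (1 + 256 / lam ^ 4) * exp (- (lam * v))"
    proof -
      have lv: "lam * v > 0" using lam v by simp
      have "(lam * v / 4) ^ 4 \<le> (1 + (lam * v) / real 4) ^ 4" using lv by (intro power_mono) auto
      also have "\<dots> \<le> exp (lam * v)" by (rule exp_ge_one_plus_x_over_n_power_n) (use lv in auto)
      finally have "lam ^ 4 * L / 256 \<le> exp (lam * v)" by (simp add: power_divide power_mult_distrib v4)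
      hence "L \<le> 256 / lam ^ 4 * exp (lam * v)" using lam by (simp add: field_simps)
      moreover have "1 \<le> exp (lam * v)" using lv by simp
      ultimately have "1 + L \<le> exp (lam * v) + 256 / lam ^ 4 * exp (lam * v)" by (rule add_mono[rotated])
      hence "1 + L \<le> (1 + 256 / lam ^ 4) * exp (lam * v)" by (simp only: ring_distribs mult_1_left)
      hence "exp (- \<tau> * (sqrt \<eta> * v)) * (1 + L) \<le> exp (- \<tau> * (sqrt \<eta> * v)) * ((1 + 256 / lam ^ 4) * exp (lam * v))"
        by (intro mult_left_mono) auto
      also have "\<dots> = (1 + 256 / lam ^ 4) * (exp (- \<tau> * (sqrt \<eta> * v)) * exp (lam * v))" by (simp only: mult_ac)
      also have "exp (- \<tau> * (sqrt \<eta> * v)) * exp (lam * v) = exp (- (lam * v))"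
        by (simp add: lam_def flip: exp_add)
      finally show ?thesis .
    qed
    have e2: "exp (- (\<eta> * s)) \<le> exp (- (lam * v))"
    proof -
      have "lam \<le> \<eta> * v" using big(2) \<eta> by (simp add: v_def s_def L_def field_simps)
      hence "lam * v \<le> \<eta> * v * v" using v by (intro mult_right_mono) auto
      also have "\<eta> * v * v = \<eta> * s" using v by (simp add: power2_eq_square)
      finally show ?thesis by simp
    qed
    have "\<bar>?S1 + ?S2\<bar> \<le> CG * X * (exp (- \<tau> * (sqrt \<eta> * v)) * (1 + L)) + 2 * CB * X * exp (- (\<eta> * s))"
      using order_trans[OF abs_triangle_ineq add_mono[OF S1 S2]] by (simp only: mult.assoc)
    also have "\<dots> \<le> CG * X * ((1 + 256 / lam ^ 4) * exp (- (lam * v))) + 2 * CB * X * exp (- (lam * v))"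
      using e1 e2 CG CB X0 by (intro add_mono mult_left_mono) auto
    also have "\<dots> = C * (X * exp (- (lam * v)))" unfolding C_def by (simp only: ring_distribs mult_ac)
    also have "X * exp (- (lam * v)) = x powr \<kappa> / exp (lam * ln x powr (1 / 4))"
      unfolding vpowr by (simp only: X_def exp_minus divide_inverse)
    finally show ?thesis unfolding hyp .
  qed
  have "eventually (\<lambda>x::real. x > 1) at_top" by (rule eventually_gt_at_top)
  moreover have "eventually (\<lambda>x::real. sqrt (ln x) \<ge> 2 * \<eta>) at_top"
  proof -
    have "filterlim (\<lambda>x::real. sqrt (ln x)) at_top at_top" by real_asymp
    thus ?thesis by (simp add: filterlim_at_top)
  qed
  moreover have "eventually (\<lambda>x::real. sqrt (sqrt (ln x)) \<ge> lam / \<eta>) at_top"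
  proof -
    have "filterlim (\<lambda>x::real. sqrt (sqrt (ln x))) at_top at_top" by real_asymp
    thus ?thesis by (simp add: filterlim_at_top)
  qed
  ultimately have "eventually (\<lambda>x. \<bar>\<Sum>n | n > 0 \<and> real n \<le> x. \<Sum>d | d ^ k dvd n. b d * g (n div d ^ k)\<bar>
      \<le> C * (x powr (1 / real k) / exp (lam * ln x powr (1 / 4)))) at_top"
    by eventually_elim (use main in \<open>simp add: \<kappa>_def\<close>)
  thus ?thesis using lam by blast
qed

subsection \<open>The primes where the two functions disagree\<close>

text \<open>Each disagreement contributes at least 1 to the sum in the hypothesis. That bound holds
  only from \<open>x0\<close> on; for smaller x the trivial bound \<open>x1\<close> for the count is
  put into the constant, multiplied by exp(c sqrt(ln x1)) since the saving can be that
  small.\<close>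

lemma disagreement_count:
  assumes vals: "\<And>p. prime p \<Longrightarrow> bad p \<Longrightarrow> e p \<ge> (1::real)" and e0: "\<And>p. e p \<ge> 0"
    and O: "(\<lambda>x::real. \<Sum>p | prime p \<and> real p \<le> x. e p) \<in> O(\<lambda>x. x powr \<kappa> / exp (c * sqrt (ln x)))"
    and c: "c \<ge> 0" and \<kappa>: "\<kappa> \<ge> 0"
  shows "\<exists>C. \<forall>x\<ge>1. real (card {p. (prime p \<and> bad p) \<and> real p \<le> x}) \<le> C * (x powr \<kappa> * exp (- c * sqrt (ln x)))"
proof -
  obtain K where K: "eventually (\<lambda>x. norm (\<Sum>p | prime p \<and> real p \<le> x. e p) \<le> K * norm (x powr \<kappa> / exp (c * sqrt (ln x)))) at_top" "K > 0"
    using O by (elim landau_o.bigE) auto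
  then obtain x0 where x0: "\<And>x. x \<ge> x0 \<Longrightarrow> norm (\<Sum>p | prime p \<and> real p \<le> x. e p) \<le> K * norm (x powr \<kappa> / exp (c * sqrt (ln x)))"
    unfolding eventually_at_top_linorder by blast
  define x1 where "x1 = max x0 1"
  have "real (card {p. (prime p \<and> bad p) \<and> real p \<le> x}) \<le> (K + x1 * exp (c * sqrt (ln x1))) * (x powr \<kappa> * exp (- c * sqrt (ln x)))"
    if x: "x \<ge> 1" for x
  proof -
    define X where "X = x powr \<kappa> * exp (- c * sqrt (ln x))"
    have X0: "X \<ge> 0" by (simp add: X_def)
    have fin: "finite {p. prime p \<and> real p \<le> x}" by (rule finite_real_bounded)
    show ?thesis
    proof (cases "x \<ge> x0")
      case True
      have "real (card {p. (prime p \<and> bad p) \<and> real p \<le> x}) = (\<Sum>p | (prime p \<and> bad p) \<and> real p \<le> x. 1)" by simp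
      also have "\<dots> \<le> (\<Sum>p | (prime p \<and> bad p) \<and> real p \<le> x. e p)" using vals by (intro sum_mono) auto
      also have "\<dots> \<le> (\<Sum>p | prime p \<and> real p \<le> x. e p)" using fin e0 by (intro sum_mono2) auto
      also have "\<dots> \<le> K * X" using x0[OF True] by (simp add: X_def exp_minus divide_inverse)
      also have "\<dots> \<le> (K + x1 * exp (c * sqrt (ln x1))) * X" using X0 by (intro mult_right_mono) (auto simp: x1_def)
      finally show ?thesis by (simp add: X_def)
    next
      case False
      hence xx: "x \<le> x1" by (simp add: x1_def)
      have "{p. (prime p \<and> bad p) \<and> real p \<le> x} \<subseteq> {1..nat \<lfloor>x\<rfloor>}"
        by (auto simp: le_nat_floor Suc_le_eq prime_gt_0_nat)
      from card_mono[OF _ this] have "card {p. (prime p \<and> bad p) \<and> real p \<le> x} \<le> nat \<lfloor>x\<rfloor>" by simp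
      hence "real (card {p. (prime p \<and> bad p) \<and> real p \<le> x}) \<le> real (nat \<lfloor>x\<rfloor>)" by (simp only: of_nat_le_iff)
      also have "\<dots> \<le> x1" using of_nat_floor[of x] x xx by linarith
      also have "\<dots> = x1 * (exp (c * sqrt (ln x1)) * exp (- c * sqrt (ln x1)))" by (simp flip: exp_add)
      also have "\<dots> \<le> x1 * (exp (c * sqrt (ln x1)) * X)"
      proof -
        have "1 * exp (- c * sqrt (ln x1)) \<le> x powr \<kappa> * exp (- c * sqrt (ln x))"
          using x xx c \<kappa> by (intro mult_mono) (auto intro: ge_one_powr_ge_zero mult_left_mono)
        thus ?thesis using x xx by (intro mult_left_mono) (auto simp: X_def)
      qed
      also have "\<dots> \<le> (K + x1 * exp (c * sqrt (ln x1))) * X" using K(2) X0 by (simp add: algebra_simps)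
      finally show ?thesis by (simp add: X_def)
    qed
  qed
  thus ?thesis by blast
qed

text \<open>Disagreement is symmetric in \<open>u\<close> and \<open>g\<close>, so the same bound
  serves the quotient used for the sums of g and the opposite one used for its Moebius sums.\<close>

lemma weighted_quotients_bounded:
  assumes u: "sgn_mult u" and g: "sgn_mult g" and \<kappa>: "0 < \<kappa>" "\<kappa> \<le> 1" and c: "c > 0"
    and \<tau>: "0 \<le> \<tau>" "\<tau> \<le> c / 2" "\<tau> \<le> \<kappa> * sqrt (ln 2) / 2"
    and count: "\<And>x. x \<ge> 1 \<Longrightarrow> real (card {p. (prime p \<and> u p \<noteq> g p) \<and> real p \<le> x}) \<le> C * (x powr \<kappa> * exp (- c * sqrt (ln x)))"
  obtains V where "\<And>x. (\<Sum>n | n > 0 \<and> real n \<le> x. \<bar>dconv (\<lambda>d. mob d * u d) g n\<bar> * weight \<kappa> \<tau> n) \<le> V"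
    "\<And>x. (\<Sum>n | n > 0 \<and> real n \<le> x. \<bar>dconv (\<lambda>d. mob d * g d) u n\<bar> * weight \<kappa> \<tau> n) \<le> V" "V \<ge> 0"
proof -
  obtain S where S: "\<And>F. finite F \<Longrightarrow> F \<subseteq> {p. prime p \<and> u p \<noteq> g p} \<Longrightarrow> (\<Sum>p\<in>F. weight \<kappa> \<tau> p) \<le> S"
    using weight_sum_primes_bounded[OF \<kappa> c \<tau>(1,2) count] by blast
  have \<theta>: "exp (- (\<kappa> * ln 2 / 2)) < 1" using \<kappa> by simp
  have wp: "weight \<kappa> \<tau> p \<le> exp (- (\<kappa> * ln 2 / 2))" if "prime p" for p
    using weight_prime_le[OF \<tau>(3) prime_ge_2_nat[OF that] \<kappa>(1)] .
  have "\<exists>W>0. \<forall>D. finite D \<longrightarrow> (\<forall>n\<in>D. n > 0 \<and> (\<forall>p. prime p \<and> p dvd n \<longrightarrow> u p \<noteq> g p)) \<longrightarrow> (\<Sum>n\<in>D. weight \<kappa> \<tau> n) \<le> W"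
    by (rule smooth_sum_bounded[where w = "weight \<kappa> \<tau>" and bad = "\<lambda>p. u p \<noteq> g p",
          OF weight_nonneg _ weight_submult[OF \<tau>(1)] \<theta> wp S]) (simp_all add: weight_1[unfolded One_nat_def])
  then obtain W where W: "W > 0" "\<And>D. finite D \<Longrightarrow> (\<forall>n\<in>D. n > 0 \<and> (\<forall>p. prime p \<and> p dvd n \<longrightarrow> u p \<noteq> g p)) \<Longrightarrow> (\<Sum>n\<in>D. weight \<kappa> \<tau> n) \<le> W"
    by blast
  have W': "(\<Sum>n\<in>D. weight \<kappa> \<tau> n) \<le> W"
    if "finite D" "\<forall>n\<in>D. n > 0 \<and> (\<forall>p. prime p \<and> p dvd n \<longrightarrow> g p \<noteq> u p)" for D
    using W(2)[OF that(1)] that(2) by metis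
  show thesis
  proof (rule that[of "W\<^sup>2"])
    show "(\<Sum>n | n > 0 \<and> real n \<le> x. \<bar>dconv (\<lambda>d. mob d * u d) g n\<bar> * weight \<kappa> \<tau> n) \<le> W\<^sup>2" for x
      by (rule dconv_quotient_weighted_sum[OF u g weight_nonneg weight_submult[OF \<tau>(1)] W(2)])
    show "(\<Sum>n | n > 0 \<and> real n \<le> x. \<bar>dconv (\<lambda>d. mob d * g d) u n\<bar> * weight \<kappa> \<tau> n) \<le> W\<^sup>2" for x
      by (rule dconv_quotient_weighted_sum[OF g u weight_nonneg weight_submult[OF \<tau>(1)] W'])
  qed simp
qed

section \<open>Assembly of the estimates for f\<close>

theorem theorem1p3:
  fixes k q :: nat and g chi f :: "nat \<Rightarrow> complex" and c :: real
  assumes "k \<ge> 2"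
    and "completely_multiplicative g"
    and "\<forall>n>0. g n \<in> {-1, 1}"
    and "dirichlet_character q chi"
    and "real_character chi"
    and "chi \<noteq> principal_character q"
    and "pretentious g chi"
    and "c > 0"
    and "(\<lambda>x::real. \<Sum>p | prime p \<and> real p \<le> x. cmod (1 - g p * chi p))
           \<in> O(\<lambda>x. x powr (1 / real k) / exp (c * sqrt (ln x)))"
    and "\<forall>n>0. f n = mu_sq k n * g n"
  shows "\<exists>lam>0. (\<lambda>x::real. cmod (\<Sum>n | n > 0 \<and> real n \<le> x. f n))
           \<in> O(\<lambda>x. x powr (1 / real k) / exp (lam * ln x powr (1 / 4)))"
proof -
  have k: "k > 0" using assms(1) by simp
  define \<kappa> where "\<kappa> = 1 / real k"
  have \<kappa>: "0 < \<kappa>" "\<kappa> \<le> 1" using k by (auto simp: \<kappa>_def)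
  define X where "X = (\<lambda>n. Re (chi n))"
  \<comment> \<open>The value at 0 is set to 0 because \<open>sgn_mult\<close> restricts the values
    everywhere, while g(0) is arbitrary.\<close>
  define G where "G = (\<lambda>n. if n = 0 then 0 else Re (g n))"
  note F = real_character_facts[OF assms(4,5)]
  have X: "sgn_mult X" using F(2) by (simp add: X_def)
  have gval: "g n = -1 \<or> g n = 1" if "n > 0" for n using assms(3) that by auto
  have gG: "g n = of_real (G n)" if "n > 0" for n using gval[OF that] that by (auto simp: G_def)
  have gmul: "g (m * n) = g m * g n" if "m > 0" "n > 0" for m n
    using assms(2) that by (simp add: completely_multiplicative_def)
  have "G 1 = 1"
    using gmul[of 1 1] gval[of 1] by (auto simp: G_def)
  moreover have "G (m * n) = G m * G n" if "m > 0" "n > 0" for m n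
    using gmul[OF that] gval[OF that(1)] gval[OF that(2)] that by (auto simp: G_def)
  moreover have "G n \<in> {-1, 0, 1}" for n using gval[of n] by (auto simp: G_def)
  ultimately have G: "sgn_mult G" by (auto simp: sgn_mult_def)
  have G1: "G n = -1 \<or> G n = 1" if "n > 0" for n using gval[OF that] that by (auto simp: G_def)

  \<comment> \<open>At such a prime g(p)\<chi>(p) is 0 if p divides the modulus and -1 otherwise, so
    the distance to 1 is 1 or 2.\<close>
  have dist: "1 \<le> cmod (1 - g p * chi p)" if "prime p" "X p \<noteq> G p" for p
  proof -
    have p: "p > 0" using that by (simp add: prime_gt_0_nat)
    have "g p * chi p = of_real (G p * X p)" using gG[OF p] F(4)[of p] by (simp add: X_def)
    hence "cmod (1 - g p * chi p) = \<bar>1 - G p * X p\<bar>"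
      by (metis norm_of_real of_real_1 of_real_diff)
    thus ?thesis using G1[OF p] sgn_multD(4)[OF X, of p] that(2) by auto
  qed
  obtain C0 where C0: "\<And>x. x \<ge> 1 \<Longrightarrow> real (card {p. (prime p \<and> X p \<noteq> G p) \<and> real p \<le> x}) \<le> C0 * (x powr \<kappa> * exp (- c * sqrt (ln x)))"
    using disagreement_count[of "\<lambda>p. X p \<noteq> G p" "\<lambda>p. cmod (1 - g p * chi p)" \<kappa> c] dist assms(8,9) \<kappa>
    unfolding \<kappa>_def[symmetric] by auto
  \<comment> \<open>The first bound is for the dyadic sum over disagreeing primes, the second for
    the Euler factor at 2.\<close>
  define \<tau> where "\<tau> = min (c / 2) (\<kappa> * sqrt (ln 2) / 2)"
  have \<tau>: "\<tau> > 0" "\<tau> \<le> c / 2" "\<tau> \<le> \<kappa> * sqrt (ln 2) / 2"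
    using assms(8) \<kappa> by (auto simp: \<tau>_def)
  have \<tau>0: "\<tau> \<ge> 0" using \<tau>(1) by simp
  obtain V where V: "\<And>x. (\<Sum>n | n > 0 \<and> real n \<le> x. \<bar>dconv (\<lambda>d. mob d * X d) G n\<bar> * weight \<kappa> \<tau> n) \<le> V"
    "\<And>x. (\<Sum>n | n > 0 \<and> real n \<le> x. \<bar>dconv (\<lambda>d. mob d * G d) X n\<bar> * weight \<kappa> \<tau> n) \<le> V" "V \<ge> 0"
    by (rule weighted_quotients_bounded[OF X G \<kappa> assms(8) \<tau>0 \<tau>(2,3) C0]) auto

  note cont = character_continuations[OF assms(4-6)]
  have Q: "\<bar>\<Sum>n | n > 0 \<and> real n \<le> x. X n\<bar> \<le> 2 * real q" for x
  proof (cases "x \<ge> 0")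
    case True thus ?thesis using cont(3) sum_real_eq_sum_nat[of x X] by (simp add: X_def)
  next
    case False
    hence "{n :: nat. n > 0 \<and> real n \<le> x} = {}" by auto
    thus ?thesis by (simp only: sum.empty)
  qed
  define CG where "CG = 2 * real q * V * exp (\<tau>\<^sup>2 / \<kappa>)"
  have CG: "CG \<ge> 0" using V(3) by (simp add: CG_def)
  have Gsum: "\<bar>\<Sum>n | n > 0 \<and> real n \<le> y. G n\<bar> \<le> CG * (y powr (1 / real k) * exp (- \<tau> * sqrt (ln y)))" for y
    using sum_sgn_mult_transfer[OF X G Q V(1) \<kappa>(1) \<tau>0] by (simp add: CG_def \<kappa>_def)

  obtain Z where Z: "continuation (\<lambda>_. 1) 1 Z" using continuation_one by blast
  \<comment> \<open>Complete multiplicativity turns \<mu>(d) g(n) into \<mu>(d) g(d)^k g(n/d^k), so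
    the k-th power of g joins the Moebius factor.\<close>
  define b where "b = (\<lambda>d. mob d * G d ^ k)"
  have b1: "\<bar>b d\<bar> \<le> 1" for d
  proof -
    have "\<bar>mob d\<bar> * \<bar>G d\<bar> ^ k \<le> 1 * 1"
      using abs_mob_le sgn_multD(3)[OF G] by (intro mult_mono power_le_one) auto
    thus ?thesis by (simp add: b_def abs_mult power_abs)
  qed
  have "\<exists>CB c'. CB \<ge> 0 \<and> c' > 0 \<and> (\<forall>z\<ge>1. \<bar>\<Sum>d | d > 0 \<and> real d \<le> z. b d\<bar> \<le> CB * (z * exp (- c' * sqrt (ln z))))"
  proof (cases "even k")
    case True
    have bm: "b d = mob d * 1" if "d > 0" for d using G1[OF that] True by (auto simp: b_def)
    \<comment> \<open>For even k the factor G(d)^k is 1, and zeta plays all three roles in the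
      zero-free region.\<close>
    have Z2: "continuation (\<lambda>n. 1\<^sup>2) 1 Z" using Z by simp
    obtain c' C where c': "c' > 0" "C > 0" "\<And>x. x \<ge> 1 \<Longrightarrow> \<bar>\<Sum>n | n > 0 \<and> real n \<le> x. mob n * 1\<bar> \<le> C * (x * exp (- c' * sqrt (ln x)))"
      by (rule mob_sgn_mult_bound[OF sgn_mult_one Z Z2 Z]) blast
    have "(\<Sum>d | d > 0 \<and> real d \<le> z. b d) = (\<Sum>d | d > 0 \<and> real d \<le> z. mob d * 1)" for z
      using bm by (intro sum.cong) auto
    thus ?thesis using c' by (intro exI[of _ C] exI[of _ c']) auto
  next
    case False
    have bm: "b d = mob d * G d" if "d > 0" for d using G1[OF that] False by (auto simp: b_def)
    obtain H H2 where H: "continuation X 0 H" "continuation (\<lambda>n. (X n)\<^sup>2) 1 H2"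
      using cont(1,2) unfolding X_def by blast
    obtain c' C where c': "c' > 0" "C > 0" "\<And>x. x \<ge> 1 \<Longrightarrow> \<bar>\<Sum>n | n > 0 \<and> real n \<le> x. mob n * X n\<bar> \<le> C * (x * exp (- c' * sqrt (ln x)))"
      by (rule mob_sgn_mult_bound[OF X H Z]) blast
    \<comment> \<open>The transfer from \<chi> to g can pass on a saving of rate at most
      \<tau>.\<close>
    define c1 where "c1 = min c' \<tau>"
    have c1: "c1 > 0" "c1 \<le> c'" "c1 \<le> \<tau>" using c' \<tau> by (auto simp: c1_def)
    have P: "\<bar>\<Sum>n | n > 0 \<and> real n \<le> x. mob n * X n\<bar> \<le> C * (x * exp (- c1 * sqrt (ln x)))" if x: "x \<ge> 1" for x
    proof -
      have "c1 * sqrt (ln x) \<le> c' * sqrt (ln x)" using c1 x by (intro mult_right_mono) auto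
      hence "C * (x * exp (- c' * sqrt (ln x))) \<le> C * (x * exp (- c1 * sqrt (ln x)))"
        using c' x by (intro mult_left_mono) auto
      thus ?thesis using c'(3)[OF x] by linarith
    qed
    have "\<bar>\<Sum>d | d > 0 \<and> real d \<le> z. b d\<bar> \<le> C * V * (z * exp (- c1 * sqrt (ln z)))" if z: "z \<ge> 1" for z
    proof -
      have "(\<Sum>d | d > 0 \<and> real d \<le> z. b d) = (\<Sum>d | d > 0 \<and> real d \<le> z. mob d * G d)"
        using bm by (intro sum.cong) auto
      thus ?thesis using sum_mob_transfer[OF X G P _ _ V(2) \<kappa>(2) c1(3) z] c' c1 by simp
    qed
    thus ?thesis using c' c1 V(3) by (intro exI[of _ "C * V"] exI[of _ c1]) auto
  qed
  then obtain CB c' where B: "CB \<ge> 0" "c' > 0"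
    "\<And>z. z \<ge> 1 \<Longrightarrow> \<bar>\<Sum>d | d > 0 \<and> real d \<le> z. b d\<bar> \<le> CB * (z * exp (- c' * sqrt (ln z)))" by blast

  obtain lam C where lam: "lam > 0" and
    ev: "eventually (\<lambda>x. \<bar>\<Sum>n | n > 0 \<and> real n \<le> x. \<Sum>d | d ^ k dvd n. b d * G (n div d ^ k)\<bar>
      \<le> C * (x powr (1 / real k) / exp (lam * ln x powr (1 / 4)))) at_top"
    using kfree_sum_estimate[OF k b1 sgn_multD(3)[OF G] B(3) Gsum B(2) \<tau>(1) B(1) CG] by blast
  have fn: "f n = of_real (\<Sum>d | d ^ k dvd n. b d * G (n div d ^ k))" if n: "n > 0" for n
  proof -
    have "(\<Sum>d | d ^ k dvd n. b d * G (n div d ^ k)) = (\<Sum>d | d ^ k dvd n. mob d * G n)"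
    proof (rule sum.cong)
      fix d assume "d \<in> {d. d ^ k dvd n}"
      then obtain m where m: "n = d ^ k * m" by auto
      have dm: "d > 0" "m > 0" using m n k by (auto intro!: Nat.gr0I simp: zero_power)
      have Gd: "G (d ^ i) = G d ^ i" for i
        by (induction i) (use sgn_multD(1,2)[OF G] dm in auto)
      have "G n = G d ^ k * G m" using sgn_multD(2)[OF G, of "d ^ k" m] dm m Gd by simp
      moreover have "n div d ^ k = m" using m dm by simp
      ultimately show "b d * G (n div d ^ k) = mob d * G n" by (simp add: b_def)
    qed auto
    also have "\<dots> = (\<Sum>d | d ^ k dvd n. mob d) * G n" by (simp add: sum_distrib_right)
    finally have "of_real (\<Sum>d | d ^ k dvd n. b d * G (n div d ^ k)) = mu_sq k n * g n"
      using kfree_mob_sum[OF k n] gG[OF n] by (simp add: mu_sq_def)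
    thus ?thesis using assms(10) n by simp
  qed
  have norm_eq: "cmod (\<Sum>n | n > 0 \<and> real n \<le> x. f n)
      = \<bar>\<Sum>n | n > 0 \<and> real n \<le> x. \<Sum>d | d ^ k dvd n. b d * G (n div d ^ k)\<bar>" for x
  proof -
    have "(\<Sum>n | n > 0 \<and> real n \<le> x. f n) = of_real (\<Sum>n | n > 0 \<and> real n \<le> x. \<Sum>d | d ^ k dvd n. b d * G (n div d ^ k))"
      unfolding of_real_sum[of _ "{n. n > 0 \<and> real n \<le> x}"] by (rule sum.cong) (use fn in auto)
    thus ?thesis by (simp only: norm_of_real)
  qed
  have "(\<lambda>x::real. cmod (\<Sum>n | n > 0 \<and> real n \<le> x. f n))
           \<in> O(\<lambda>x. x powr (1 / real k) / exp (lam * ln x powr (1 / 4)))"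
    by (rule bigoI[of _ C], rule eventually_mono[OF ev]) (simp add: norm_eq)
  thus ?thesis using lam by blast
qed

end
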